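(* Let $N\ge6$, $\mathcal{I}\subset\mathcal{B}_N^d$ finite, $\mathbf z$ a generating vector, and fix the bandwidth parameter $\tilde M:=2\max_{\mathbf k\in\mathcal{I}}|\mathbf k\cdot\mathbf z|+1$. Let $\Lambda(\mathbf z,M)$ be a reconstructing rank-1 lattice for $\mathcal{I}$ with $M\le\tilde M$, let $f\in\mathcal{W}(\mathbb{T}^d)\cap C(\mathbb{T}^d)$ with Fourier coefficients $c=c(f)$, and let each function sample be possibly corrupted by noise at most $e_\infty\ge0$ in absolute magnitude. Apply the Phase Encoding algorithm with the following modifications: 1. use the sublinear-time SFT algorithm $\mathcal{A}^{\mathrm{sub}}_{2s,\tilde M}$ or its Monte Carlo variant $\mathcal{A}^{\mathrm{sub,MC}}_{2s,\tilde M}$ as the univariate SFT (so that frequencies $\omega$ range over $\mathcal{B}_{\tilde M}$), and 2. in the final check only test the equality $\mathbf k_\omega\cdot\mathbf z=\omega$ (rather than equivalence modulo $M$). Then it produces $\mathbf b=(b_{\mathbf k})_{\mathbf k\in\mathcal{B}_N^d}$, a $2s$-sparse approximation of $c$ satisfying the error estimate $$\|\mathbf b-c\|_{\ell^2(\mathbb{Z}^d)}\le(24+3N)\left[\frac{\|c|_{\mathcal{I}}-(c|_{\mathcal{I}})_s^{\mathrm{opt}}\|_1}{\sqrt s}+\sqrt s\,\|c-c|_{\mathcal{I}}\|_1+\sqrt s\,e_\infty\right]+\|c-c|_{\mathcal{I}}\|_2,$$ albeit with probability $1-\sigma\in[0,1)$ for the Monte Carlo version. For $\mathcal{A}^{\mathrm{sub}}_{2s,\tilde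 M}$ and $\mathcal{A}^{\mathrm{sub,MC}}_{2s,\tilde M}$ respectively, the total number of evaluations of $f$ and the computational complexity are $$\mathcal{O}\left(\frac{ds^2\log^4\tilde M}{\log s}\right)\quad\text{or}\quad\mathcal{O}\left(ds\log^3(\tilde M)\log\left(\frac{d\tilde M}\sigma\right)\right)$$ (in the latter case with the failure probability of the individual univariate SFTs chosen suitably in terms of $\sigma$ and $d$).
   Context: Notation. $\mathbb{T}=[0,1]$ with endpoints identified; $[n]=\{0,\dots,n-1\}$; $\mathcal{B}_N:=(-\lceil N/2\rceil,\lfloor N/2\rfloor]\cap\mathbb{Z}$. For $f:\mathbb{T}^d\to\mathbb{C}$, $c_{\mathbf k}(f)=\int_{\mathbb{T}^d}f(\mathbf x)e^{-2\pi i\mathbf k\cdot\mathbf x}\,d\mathbf x$ and $c(f)=(c_{\mathbf k}(f))_{\mathbf k\in\mathbb{Z}^d}$; $\mathcal{W}(\mathbb{T}^d)=\{f\in L^1(\mathbb{T}^d):\sum_{\mathbf k}|c_{\mathbf k}(f)|<\infty\}$ and $C(\mathbb{T}^d)$ is the space of continuous functions. $c|_{\mathcal{I}}$ is the restriction to $\mathcal{I}$; finite vectors and restrictions are extended by zero when compared with sequences on larger index sets, and norms of sequences are those of $\ell^p(\mathbb{Z}^d)$. For a vector $\mathbf y$, $\mathbf y_s^{\mathrm{opt}}$ is $\mathbf y$ restricted to its $s$ largest-magnitude entries. "$s$-sparse" means at most $s$ nonzero entries; $s$ is a positive integer, and sparsity parameters $s$ are always assumed to be at most half the size of the vectors under consideration.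 Coordinates are indexed by $\ell\in[d]$. The shift operator is $S_{\ell,\alpha}(f)(\mathbf x)=f(x_0,\dots,(x_\ell+\alpha)\bmod1,\dots,x_{d-1})$. Reconstructing lattice. For $\mathbf z\in[M]^d$, $\Lambda(\mathbf z,M)=\{\frac jM\mathbf z\bmod1\mid j\in[M]\}$; it is reconstructing for $\mathcal{I}$ if $\mathbf k\mapsto\mathbf k\cdot\mathbf z\bmod M$ is injective on $\mathcal{I}$. Phase Encoding algorithm (unmodified form, with univariate SFT $\mathcal{A}$, an algorithm that takes point samples of a univariate function and returns a sparse vector in $\mathbb{C}^M$ indexed by $\mathcal{B}_M$). (i) Apply $\mathcal{A}$ to $a(t)=f(t\mathbf z)$ to produce $\mathbf v$. (ii) For every $\ell\in[d]$ apply $\mathcal{A}$ to $a^\ell(t)=(S_{\ell,1/N}f)(t\mathbf z)$ to produce $\mathbf v^\ell$. (iii) Set $\mathbf b=(b_{\mathbf k})_{\mathbf k\in\mathcal{B}_N^d}\leftarrow\mathbf 0$. For every $\omega\in\operatorname{supp}(\mathbf v)$: for every $\ell\in[d]$ set $(k_\omega)_\ell\leftarrow\operatorname{round}(N\arg(v^\ell_\omega/v_\omega)/(2\pi))$, taken as the representative modulo $N$ in $\mathcal{B}_N$ (with an arbitrary value if $v_\omega^\ell=0$); then (final check), if $\mathbf k_\omega\cdot\mathbf z\equiv\omega\pmod M$, set $b_{\mathbf k_\omega}\leftarrow b_{\mathbf k_\omega}+v_\omega$. Output $\mathbf b$. The univariate SFT. For a bandwidth $L$ and univariate $a$, let $\hat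 a_\omega=\int_{\mathbb{T}}a(t)e^{-2\pi i\omega t}dt$, $\hat a=(\hat a_\omega)_{\omega\in\mathbb{Z}}$ and let $\hat{\mathbf a}\in\mathbb{C}^L$ be its restriction to $\mathcal{B}_L$. $\mathcal{A}^{\mathrm{sub}}_{2s,L}$ is a deterministic algorithm which, for every $a\in\mathcal{W}(\mathbb{T})\cap C(\mathbb{T})$ with noise $\mu:\mathbb{T}\to\mathbb{C}$, from point samples of $a+\mu$ outputs a $2s$-sparse $\mathbf v\in\mathbb{C}^L$ (indexed by $\mathcal{B}_L$) such that, with $\delta:=\frac{\|\hat{\mathbf a}-\hat{\mathbf a}_s^{\mathrm{opt}}\|_1}{s}+\|\hat a-\hat{\mathbf a}\|_1+\|\mu\|_\infty$: (1) every $\omega\in\mathcal{B}_L$ with $|\hat a_\omega|>(4+2\sqrt2)\delta$ lies in $\operatorname{supp}(\mathbf v)$; (2) $\|(\hat{\mathbf a}-\mathbf v)|_{\operatorname{supp}(\mathbf v)}\|_\infty\le\sqrt2\,\delta$; (3) $\|\hat{\mathbf a}-\mathbf v\|_2\le\|\hat{\mathbf a}-\hat{\mathbf a}_{2s}^{\mathrm{opt}}\|_2+(8\sqrt2+6)\sqrt s\,\delta$; (4) the number of samples and operations is $\mathcal{O}(s^2\log^4L/\log s)$. $\mathcal{A}^{\mathrm{sub,MC}}_{2s,L}$ is a randomized variant which, for prescribed $\sigma'\in(0,1/3]$, satisfies (1)–(3) simultaneously with probability $1-\sigma'$ using $\mathcal{O}(s\log^3(L)\log(L/\sigma'))$ samples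 and operations. *)

theory Defs
  imports "HOL-Probability.Probability" "HOL-Number_Theory.Cong"
begin

definition band :: "nat \<Rightarrow> int set" where
  "band n = {- \<lceil>real n / 2\<rceil> <.. \<lfloor>real n / 2\<rfloor>}"

text \<open>Since the dimension \<open>d\<close> varies inside the result (the constants in the complexity bounds must not
  depend on it), vectors of length \<open>d\<close> are functions on \<open>nat\<close> that are \<open>undefined\<close> outside \<open>{..<d}\<close>.\<close>

definition Zd :: "nat \<Rightarrow> (nat \<Rightarrow> int) set" where
  "Zd d = {..<d} \<rightarrow>\<^sub>E UNIV"

definition band_d :: "nat \<Rightarrow> nat \<Rightarrow> (nat \<Rightarrow> int) set" where
  "band_d d n = {..<d} \<rightarrow>\<^sub>E band n"

definition dot :: "nat \<Rightarrow> (nat \<Rightarrow> int) \<Rightarrow> (nat \<Rightarrow> int) \<Rightarrow> int" where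
  "dot d k z = (\<Sum>l<d. k l * z l)"

definition supp :: "('i \<Rightarrow> complex) \<Rightarrow> 'i set" where
  "supp y = {i. y i \<noteq> 0}"

definition restr :: "'i set \<Rightarrow> ('i \<Rightarrow> complex) \<Rightarrow> 'i \<Rightarrow> complex" where
  "restr J y = (\<lambda>i. if i \<in> J then y i else 0)"

text \<open>\<open>best_terms s J y\<close> is the vector \<open>y\<close> on the finite index set \<open>J\<close>, restricted to \<open>s\<close> entries of
  largest magnitude (to all of \<open>J\<close> if it has fewer than \<open>s\<close> elements). Ties are broken arbitrarily;
  the norms of the remainder do not depend on how.\<close>

definition largest_entries :: "nat \<Rightarrow> 'i set \<Rightarrow> ('i \<Rightarrow> complex) \<Rightarrow> 'i set \<Rightarrow> bool" where
  "largest_entries s J y S \<longleftrightarrow>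
     S \<subseteq> J \<and> card S = min s (card J) \<and> (\<forall>i\<in>S. \<forall>j\<in>J - S. cmod (y j) \<le> cmod (y i))"

definition best_terms :: "nat \<Rightarrow> 'i set \<Rightarrow> ('i \<Rightarrow> complex) \<Rightarrow> 'i \<Rightarrow> complex" where
  "best_terms s J y = restr (SOME S. largest_entries s J y S) y"

text \<open>Norms of sequences indexed by \<open>J\<close>. They are only applied to sequences for which the sum
  converges, respectively the supremum is finite.\<close>

definition l1_norm :: "'i set \<Rightarrow> ('i \<Rightarrow> complex) \<Rightarrow> real" where
  "l1_norm J y = (\<Sum>\<^sub>\<infinity>i\<in>J. cmod (y i))"

definition l2_norm :: "'i set \<Rightarrow> ('i \<Rightarrow> complex) \<Rightarrow> real" where
  "l2_norm J y = sqrt (\<Sum>\<^sub>\<infinity>i\<in>J. (cmod (y i))\<^sup>2)"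

definition sup_norm :: "('i \<Rightarrow> complex) \<Rightarrow> real" where
  "sup_norm y = (SUP i. cmod (y i))"

text \<open>Functions on the torus are functions on all of \<open>real\<close> of period 1. A function on the
  \<open>d\<close>-dimensional torus is one on \<open>nat \<Rightarrow> real\<close> whose value depends only on the first \<open>d\<close> coordinates
  modulo 1; with respect to the product topology on \<open>nat \<Rightarrow> real\<close>, continuity is then
  continuity on the torus.\<close>

definition periodic1 :: "(real \<Rightarrow> complex) \<Rightarrow> bool" where
  "periodic1 a \<longleftrightarrow> (\<forall>x y. x - y \<in> \<int> \<longrightarrow> a x = a y)"

definition fcoeff1 :: "(real \<Rightarrow> complex) \<Rightarrow> int \<Rightarrow> complex" where
  "fcoeff1 a \<omega> = (LINT t:{0..1}|lborel. a t * cis (- 2 * pi * real_of_int \<omega> * t))"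

definition wiener1 :: "(real \<Rightarrow> complex) \<Rightarrow> bool" where
  "wiener1 a \<longleftrightarrow> periodic1 a \<and> set_integrable lborel {0..1} a \<and>
     (\<lambda>\<omega>. cmod (fcoeff1 a \<omega>)) summable_on UNIV"

definition periodic :: "nat \<Rightarrow> ((nat \<Rightarrow> real) \<Rightarrow> complex) \<Rightarrow> bool" where
  "periodic d f \<longleftrightarrow> (\<forall>x y. (\<forall>l<d. x l - y l \<in> \<int>) \<longrightarrow> f x = f y)"

definition torus_measure :: "nat \<Rightarrow> (nat \<Rightarrow> real) measure" where
  "torus_measure d = PiM {..<d} (\<lambda>_. restrict_space lborel {0..1})"

definition fcoeff :: "nat \<Rightarrow> ((nat \<Rightarrow> real) \<Rightarrow> complex) \<Rightarrow> (nat \<Rightarrow> int) \<Rightarrow> complex" where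
  "fcoeff d f k =
     (LINT x|torus_measure d. f x * cis (- 2 * pi * (\<Sum>l<d. real_of_int (k l) * x l)))"

definition wiener :: "nat \<Rightarrow> ((nat \<Rightarrow> real) \<Rightarrow> complex) \<Rightarrow> bool" where
  "wiener d f \<longleftrightarrow> periodic d f \<and> integrable (torus_measure d) f \<and>
     (\<lambda>k. cmod (fcoeff d f k)) summable_on Zd d"

text \<open>The shift operator maps \<open>f\<close> to \<open>f \<circ> shift l \<alpha>\<close>.\<close>

definition shift :: "nat \<Rightarrow> real \<Rightarrow> (nat \<Rightarrow> real) \<Rightarrow> nat \<Rightarrow> real" where
  "shift l \<alpha> x = x(l := frac (x l + \<alpha>))"

text \<open>\<open>line d z t\<close> is \<open>t z mod 1\<close>; the lattice generated by \<open>z\<close> consists of the points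
  \<open>line d z (j / M)\<close>.\<close>

definition line :: "nat \<Rightarrow> (nat \<Rightarrow> int) \<Rightarrow> real \<Rightarrow> nat \<Rightarrow> real" where
  "line d z t = (\<lambda>l\<in>{..<d}. frac (t * real_of_int (z l)))"

definition reconstructing :: "nat \<Rightarrow> (nat \<Rightarrow> int) \<Rightarrow> nat \<Rightarrow> (nat \<Rightarrow> int) set \<Rightarrow> bool" where
  "reconstructing d z M I \<longleftrightarrow>
     z \<in> {..<d} \<rightarrow>\<^sub>E {0..<int M} \<and> inj_on (\<lambda>k. dot d k z mod int M) I"

text \<open>The maximum over the empty set is taken to be 0.\<close>

definition bandwidth :: "nat \<Rightarrow> (nat \<Rightarrow> int) \<Rightarrow> (nat \<Rightarrow> int) set \<Rightarrow> nat" where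
  "bandwidth d z I = nat (2 * Max (insert 0 ((\<lambda>k. \<bar>dot d k z\<bar>) ` I)) + 1)"

text \<open>A program accesses the sampled function only through \<open>Sample\<close>, adaptively; each \<open>Tick\<close> stands
  for one elementary operation (on numbers, or reading or writing an entry of a vector). Producing a
  sample, including forming the point at which it is taken, counts as one operation.\<close>

datatype ('q, 'a) prog =
    Return 'a
  | Sample 'q "complex \<Rightarrow> ('q, 'a) prog"
  | Tick "('q, 'a) prog"

primrec bind_prog :: "('q, 'a) prog \<Rightarrow> ('a \<Rightarrow> ('q, 'b) prog) \<Rightarrow> ('q, 'b) prog" where
  "bind_prog (Return x) g = g x"
| "bind_prog (Sample q h) g = Sample q (\<lambda>y. bind_prog (h y) g)"
| "bind_prog (Tick p) g = Tick (bind_prog p g)"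

adhoc_overloading Monad_Syntax.bind \<rightleftharpoons> bind_prog

primrec result :: "('q \<Rightarrow> complex) \<Rightarrow> ('q, 'a) prog \<Rightarrow> 'a" where
  "result F (Return x) = x"
| "result F (Sample q h) = result F (h (F q))"
| "result F (Tick p) = result F p"

primrec samples :: "('q \<Rightarrow> complex) \<Rightarrow> ('q, 'a) prog \<Rightarrow> nat" where
  "samples F (Return x) = 0"
| "samples F (Sample q h) = Suc (samples F (h (F q)))"
| "samples F (Tick p) = samples F p"

primrec operations :: "('q \<Rightarrow> complex) \<Rightarrow> ('q, 'a) prog \<Rightarrow> nat" where
  "operations F (Return x) = 0"
| "operations F (Sample q h) = Suc (operations F (h (F q)))"
| "operations F (Tick p) = Suc (operations F p)"

definition op :: "'a \<Rightarrow> ('q, 'a) prog" where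
  "op x = Tick (Return x)"

primrec for_each :: "'x list \<Rightarrow> ('x \<Rightarrow> 's \<Rightarrow> ('q, 's) prog) \<Rightarrow> 's \<Rightarrow> ('q, 's) prog" where
  "for_each [] body st = Return st"
| "for_each (x # xs) body st = Tick (body x st \<bind> for_each xs body)"

type_synonym sft = "(real, int \<Rightarrow> complex) prog"

definition sft_error :: "nat \<Rightarrow> nat \<Rightarrow> (real \<Rightarrow> complex) \<Rightarrow> (real \<Rightarrow> complex) \<Rightarrow> real" where
  "sft_error s L a \<mu> =
     l1_norm (band L) (\<lambda>\<omega>. fcoeff1 a \<omega> - best_terms s (band L) (fcoeff1 a) \<omega>) / real s
     + l1_norm UNIV (\<lambda>\<omega>. fcoeff1 a \<omega> - restr (band L) (fcoeff1 a) \<omega>)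
     + sup_norm \<mu>"

definition sft_accurate ::
  "nat \<Rightarrow> nat \<Rightarrow> (real \<Rightarrow> complex) \<Rightarrow> (real \<Rightarrow> complex) \<Rightarrow> (int \<Rightarrow> complex) \<Rightarrow> bool" where
  "sft_accurate s L a \<mu> v \<longleftrightarrow>
     (let \<delta> = sft_error s L a \<mu>; ahat = fcoeff1 a in
       (\<forall>\<omega>\<in>band L. cmod (ahat \<omega>) > (4 + 2 * sqrt 2) * \<delta> \<longrightarrow> \<omega> \<in> supp v) \<and>
       sup_norm (restr (supp v) (\<lambda>\<omega>. ahat \<omega> - v \<omega>)) \<le> sqrt 2 * \<delta> \<and>
       l2_norm (band L) (\<lambda>\<omega>. ahat \<omega> - v \<omega>)
         \<le> l2_norm (band L) (\<lambda>\<omega>. ahat \<omega> - best_terms (2 * s) (band L) ahat \<omega>)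
            + (8 * sqrt 2 + 6) * sqrt (real s) * \<delta>)"

definition sparse_on :: "nat \<Rightarrow> 'i set \<Rightarrow> ('i \<Rightarrow> complex) \<Rightarrow> bool" where
  "sparse_on m J y \<longleftrightarrow> supp y \<subseteq> J \<and> finite (supp y) \<and> card (supp y) \<le> m"

definition sft_input :: "(real \<Rightarrow> complex) \<Rightarrow> (real \<Rightarrow> complex) \<Rightarrow> bool" where
  "sft_input a \<mu> \<longleftrightarrow>
     wiener1 a \<and> continuous_on UNIV a \<and> periodic1 \<mu> \<and> bounded (range \<mu>)"

text \<open>A family of algorithms indexed by \<open>s\<close> and \<open>L\<close>. The runtime bound has \<open>ln s\<close> in the
  denominator, so it makes no claim for \<open>s = 1\<close>.\<close>

definition sublinear_sft :: "(nat \<Rightarrow> nat \<Rightarrow> sft) \<Rightarrow> bool" where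
  "sublinear_sft A \<longleftrightarrow>
     (\<forall>s L a \<mu>. 1 \<le> s \<and> 2 * s \<le> L \<and> sft_input a \<mu> \<longrightarrow>
        (let v = result (\<lambda>t. a t + \<mu> t) (A s L)
         in sparse_on (2 * s) (band L) v \<and> sft_accurate s L a \<mu> v)) \<and>
     (\<exists>C. \<forall>s L a \<mu>. 2 \<le> s \<and> 2 * s \<le> L \<and> sft_input a \<mu> \<longrightarrow>
        real (samples (\<lambda>t. a t + \<mu> t) (A s L)) \<le> C * (real s ^ 2 * ln (real L) ^ 4 / ln (real s)) \<and>
        real (operations (\<lambda>t. a t + \<mu> t) (A s L)) \<le> C * (real s ^ 2 * ln (real L) ^ 4 / ln (real s)))"

text \<open>A randomized algorithm is a probability distribution on programs. Its success probability is
  for each fixed input; sparsity and runtime hold for every outcome of the random choices.\<close>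

definition sublinear_sft_mc :: "(nat \<Rightarrow> nat \<Rightarrow> real \<Rightarrow> sft pmf) \<Rightarrow> bool" where
  "sublinear_sft_mc A \<longleftrightarrow>
     (\<forall>s L \<sigma> a \<mu>. 1 \<le> s \<and> 2 * s \<le> L \<and> 0 < \<sigma> \<and> \<sigma> \<le> 1/3 \<and> sft_input a \<mu> \<longrightarrow>
        (\<forall>p\<in>set_pmf (A s L \<sigma>). sparse_on (2 * s) (band L) (result (\<lambda>t. a t + \<mu> t) p)) \<and>
        measure_pmf.prob (A s L \<sigma>) {p. sft_accurate s L a \<mu> (result (\<lambda>t. a t + \<mu> t) p)} \<ge> 1 - \<sigma>) \<and>
     (\<exists>C. \<forall>s L \<sigma> a \<mu>. 1 \<le> s \<and> 2 * s \<le> L \<and> 0 < \<sigma> \<and> \<sigma> \<le> 1/3 \<and> sft_input a \<mu> \<longrightarrow>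
        (\<forall>p\<in>set_pmf (A s L \<sigma>).
           real (samples (\<lambda>t. a t + \<mu> t) p) \<le> C * (real s * ln (real L) ^ 3 * ln (real L / \<sigma>)) \<and>
           real (operations (\<lambda>t. a t + \<mu> t) p) \<le> C * (real s * ln (real L) ^ 3 * ln (real L / \<sigma>))))"

definition centered_mod :: "nat \<Rightarrow> int \<Rightarrow> int" where
  "centered_mod N m = (THE r. r \<in> band N \<and> [r = m] (mod int N))"

text \<open>A sample request is a pair of the number of the univariate transform issuing it and the point,
  so that the noise may differ between transforms even at the same point.\<close>

type_synonym request = "nat \<times> (nat \<Rightarrow> real)"

text \<open>\<open>phase_coord\<close> computes coordinate \<open>l\<close> of the frequency encoded in \<open>v\<close> and the transforms \<open>w l\<close> of
  the shifted functions; \<open>dflt l \<omega>\<close> is the arbitrary value used if \<open>w l \<omega> = 0\<close>.\<close>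

definition phase_coord ::
  "nat \<Rightarrow> (nat \<Rightarrow> int \<Rightarrow> int) \<Rightarrow> (int \<Rightarrow> complex) \<Rightarrow> (nat \<Rightarrow> int \<Rightarrow> complex) \<Rightarrow> int \<Rightarrow> nat
    \<Rightarrow> ('q, int) prog" where
  "phase_coord N dflt v w \<omega> l = do {
     x \<leftarrow> op (v \<omega>);
     y \<leftarrow> op (w l \<omega>);
     zero \<leftarrow> op (y = 0);
     m \<leftarrow> (if zero then op (dflt l \<omega>)
          else do {
            q \<leftarrow> op (y / x);
            \<theta> \<leftarrow> op (Arg q);
            r \<leftarrow> op (real N * \<theta>);
            r' \<leftarrow> op (r / (2 * pi));
            op (round r')
          });
     op (centered_mod N m)
   }"

definition compute_dot :: "nat \<Rightarrow> (nat \<Rightarrow> int) \<Rightarrow> (nat \<Rightarrow> int) \<Rightarrow> ('q, int) prog" where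
  "compute_dot d k z =
     for_each [0..<d] (\<lambda>l acc. do { p \<leftarrow> op (k l * z l); op (acc + p) }) 0"

text \<open>Addressing the entry of a vector at a \<open>d\<close>-dimensional index is charged \<open>d\<close> operations.\<close>

definition address :: "nat \<Rightarrow> ('q, unit) prog" where
  "address d = for_each [0..<d] (\<lambda>_ _. Return ()) ()"

definition process_frequency ::
  "nat \<Rightarrow> nat \<Rightarrow> (nat \<Rightarrow> int) \<Rightarrow> (nat \<Rightarrow> int \<Rightarrow> int) \<Rightarrow> (int \<Rightarrow> complex) \<Rightarrow> (nat \<Rightarrow> int \<Rightarrow> complex)
    \<Rightarrow> int \<Rightarrow> ((nat \<Rightarrow> int) \<Rightarrow> complex) \<Rightarrow> ('q, (nat \<Rightarrow> int) \<Rightarrow> complex) prog" where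
  "process_frequency d N z dflt v w \<omega> b = do {
     k \<leftarrow> for_each [0..<d]
           (\<lambda>l k. do { m \<leftarrow> phase_coord N dflt v w \<omega> l; op (k(l := m)) }) (\<lambda>_. undefined);
     h \<leftarrow> compute_dot d k z;
     match \<leftarrow> op (h = \<omega>);
     if match then do {
       address d;
       x \<leftarrow> op (v \<omega>);
       y \<leftarrow> op (b k);
       u \<leftarrow> op (y + x);
       op (b(k := u))
     } else Return b
   }"

text \<open>The modified algorithm: the final check tests equality over the integers. \<open>P 0\<close> is the
  univariate transform applied to \<open>t \<mapsto> f (t z)\<close>, and \<open>P (Suc l)\<close> the one applied to the shift of \<open>f\<close> in
  coordinate \<open>l\<close>; for a deterministic transform all of them coincide, otherwise they are the outcomes
  of \<open>d + 1\<close> independent random choices.\<close>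

definition phase_encoding ::
  "nat \<Rightarrow> nat \<Rightarrow> (nat \<Rightarrow> int) \<Rightarrow> (nat \<Rightarrow> int \<Rightarrow> int) \<Rightarrow> (nat \<Rightarrow> sft)
    \<Rightarrow> (request, (nat \<Rightarrow> int) \<Rightarrow> complex) prog" where
  "phase_encoding d N z dflt P = do {
     v \<leftarrow> map_prog (\<lambda>t. (0, line d z t)) id (P 0);
     w \<leftarrow> for_each [0..<d]
           (\<lambda>l w. do {
              vl \<leftarrow> map_prog (\<lambda>t. (Suc l, shift l (1 / real N) (line d z t))) id (P (Suc l));
              op (w(l := vl))
            }) (\<lambda>_ _. 0);
     for_each (sorted_list_of_set (supp v)) (process_frequency d N z dflt v w) (\<lambda>_. 0)
   }"

definition mc_choices :: "nat \<Rightarrow> sft pmf \<Rightarrow> (nat \<Rightarrow> sft) pmf" where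
  "mc_choices d A = Pi_pmf {..d} (Return (\<lambda>_. 0)) (\<lambda>_. A)"

definition noisy :: "((nat \<Rightarrow> real) \<Rightarrow> complex) \<Rightarrow> (request \<Rightarrow> complex) \<Rightarrow> request \<Rightarrow> complex" where
  "noisy f \<eta> q = f (snd q) + \<eta> q"

definition error_estimate ::
  "nat \<Rightarrow> nat \<Rightarrow> (nat \<Rightarrow> int) set \<Rightarrow> nat \<Rightarrow> real \<Rightarrow> ((nat \<Rightarrow> int) \<Rightarrow> complex)
    \<Rightarrow> ((nat \<Rightarrow> int) \<Rightarrow> complex) \<Rightarrow> bool" where
  "error_estimate d N I s e c b \<longleftrightarrow>
     l2_norm (Zd d) (\<lambda>k. b k - c k)
     \<le> (24 + 3 * real N) *
         (l1_norm (Zd d) (\<lambda>k. restr I c k - best_terms s I (restr I c) k) / sqrt (real s)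
          + sqrt (real s) * l1_norm (Zd d) (\<lambda>k. c k - restr I c k)
          + sqrt (real s) * e)
       + l2_norm (Zd d) (\<lambda>k. c k - restr I c k)"

end

theory Submission
  imports Defs
begin

text \<open>A continuous function with summable Fourier coefficients is the sum of its Fourier series, so sampling
  \<open>f\<close> along \<open>t z\<close> gives a univariate function whose coefficient at \<open>\<omega>\<close> is the sum of the \<open>c\<^sub>k\<close> with
  \<open>k \<cdot> z = \<omega>\<close>; shifting \<open>f\<close> by \<open>1/N\<close> in coordinate \<open>l\<close> multiplies \<open>c\<^sub>k\<close> by \<open>exp (2 \<pi> i k\<^sub>l / N)\<close>. At most one
  \<open>k\<close> in \<open>I\<close> contributes to each \<open>\<omega>\<close>, and the remaining contributions sum to at most the \<open>\<ell>\<^sup>1\<close> norm of \<open>c\<close> off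
  \<open>I\<close>. Hence all univariate errors \<open>\<delta>\<close> are bounded by one quantity. Since \<open>sin (\<pi> / N) \<ge> 3 / N\<close>, the phase of
  the quotient of two computed coefficients rounds to the correct \<open>k\<^sub>l\<close> unless the coefficient is of order
  \<open>N \<delta>\<close>; each of the at most \<open>2 s\<close> small coefficients that are misplaced is counted at most twice.\<close>

section \<open>Fourier series on the torus\<close>

text \<open>The constant \<open>24 + 3 * real N\<close> dictates how aliasing is recorded. It is
  kept for each frequency separately, as \<open>aliasing \<omega>\<close>: a misplaced value is then
  at most a multiple of \<open>err\<close> plus a multiple of \<open>aliasing \<omega>\<close>, and
  in the l2 sum over frequencies the second part costs the l1 norm once instead of
  \<open>sqrt (2 * s)\<close> times. With the total aliasing in every threshold, the same
  computation would put \<open>4 * (sqrt 2 + 1) / 3\<close>, which exceeds 3, in front of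
  \<open>N\<close> for large \<open>N\<close>. Pointwise convergence of the Fourier series rests on
  uniqueness: a continuous periodic function without nonzero coefficients is zero. The route is
  Stone-Weierstrass on a product of circles, applied to the algebra of those functions whose
  multiplication keeps all coefficients zero. The \<open>d + 1\<close> sampled functions differ only
  by factors of modulus 1 on the coefficients. The error analysis is therefore done once, for a
  summable sequence and an arbitrary such factor.\<close>

definition character :: "nat \<Rightarrow> (nat \<Rightarrow> int) \<Rightarrow> (nat \<Rightarrow> real) \<Rightarrow> complex" where
  "character d k x = cis (2 * pi * (\<Sum>l<d. real_of_int (k l) * x l))"

lemma norm_character [simp]: "cmod (character d k x) = 1"
  by (simp add: character_def)

lemma continuous_on_coordinate: "continuous_on X (\<lambda>x::'i \<Rightarrow> 'a::topological_space. x l)"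
  using continuous_on_product_then_coordinatewise[OF continuous_on_id, of X l] by (simp add: id_def)

lemma continuous_on_character [continuous_intros]: "continuous_on X (character d k)"
proof -
  have "continuous_on UNIV (character d k)"
    unfolding character_def cis_conv_exp by (intro continuous_intros continuous_on_coordinate)
  then show ?thesis using continuous_on_subset by blast
qed

lemma fcoeff_character: "fcoeff d f k = (LINT x|torus_measure d. f x * cnj (character d k x))"
  by (simp add: fcoeff_def character_def cis_cnj)

lemma prob_space_unit_interval: "prob_space (restrict_space lborel {0..1::real})"
  by (rule prob_spaceI) (simp add: space_restrict_space emeasure_restrict_space)

lemma prob_space_torus: "prob_space (torus_measure d)"
  unfolding torus_measure_def by (intro prob_space_PiM prob_space_unit_interval)

lemma space_torus: "space (torus_measure d) = {..<d} \<rightarrow>\<^sub>E {0..1}"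
  by (simp add: torus_measure_def space_PiM space_restrict_space)

text \<open>Points of \<open>torus_measure d\<close> are \<open>undefined\<close> from coordinate
  \<open>d\<close> on, whereas \<open>f\<close> is continuous on the full product. The identity map
  links the two: each of its coordinates is measurable or constant, and the Borel sets of this
  countable product are generated coordinatewise.\<close>

lemma borel_measurable_torus_continuous:
  fixes f :: "(nat \<Rightarrow> real) \<Rightarrow> 'a::topological_space"
  assumes "continuous_on UNIV f"
  shows "f \<in> borel_measurable (torus_measure d)"
proof -
  have coord: "(\<lambda>x. x l) \<in> measurable (torus_measure d) borel" for l
  proof (cases "l < d")
    case True
    have "(\<lambda>x. x l) \<in> measurable (torus_measure d) (restrict_space lborel {0..1::real})"
      unfolding torus_measure_def by (rule measurable_component_singleton) (use True in auto)
    moreover have "measurable (torus_measure d) (restrict_space lborel {0..1::real})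
        \<subseteq> measurable (torus_measure d) borel"
      by (auto simp: measurable_restrict_space2_iff)
    ultimately show ?thesis by blast
  next
    case False
    have "(\<lambda>x. x l) \<in> measurable (torus_measure d) borel
        \<longleftrightarrow> (\<lambda>x. undefined::real) \<in> measurable (torus_measure d) borel"
      by (rule measurable_cong) (use False in \<open>auto simp: space_torus PiE_def extensional_def\<close>)
    then show ?thesis by simp
  qed
  have "(\<lambda>x. x) \<in> measurable (torus_measure d) (Pi\<^sub>M UNIV (\<lambda>_. borel :: real measure))"
    by (rule measurable_PiM_single') (use coord in auto)
  then have "(\<lambda>x. x) \<in> measurable (torus_measure d) (borel :: (nat \<Rightarrow> real) measure)"
    using measurable_cong_sets[OF refl sets_PiM_equal_borel] by blast
  then show ?thesis
    using measurable_compose borel_measurable_continuous_onI[OF assms] by blast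
qed

lemma integrable_torus_bounded:
  fixes f :: "(nat \<Rightarrow> real) \<Rightarrow> complex"
  assumes "f \<in> borel_measurable (torus_measure d)" "\<And>x. cmod (f x) \<le> B"
  shows "integrable (torus_measure d) f"
proof -
  interpret prob_space "torus_measure d" by (rule prob_space_torus)
  show ?thesis by (rule integrable_const_bound[of _ B]) (use assms in auto)
qed

text \<open>The torus as a product of unit circles, where the Stone--Weierstrass theorem applies
  (functions on \<open>nat \<Rightarrow> real\<close> of period 1 do not separate points).\<close>

definition circles :: "nat \<Rightarrow> (nat \<Rightarrow> complex) set" where
  "circles d = (\<Pi>\<^sub>E l\<in>UNIV. if l < d then sphere 0 1 else {1})"

definition to_circles :: "nat \<Rightarrow> (nat \<Rightarrow> real) \<Rightarrow> nat \<Rightarrow> complex" where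
  "to_circles d x = (\<lambda>l. if l < d then cis (2 * pi * x l) else 1)"

lemma to_circles_in: "to_circles d x \<in> circles d"
  by (auto simp: to_circles_def circles_def)

lemma circles_norm: "w \<in> circles d \<Longrightarrow> l < d \<Longrightarrow> cmod (w l) = 1"
  using PiE_mem[of w UNIV "\<lambda>l. if l < d then sphere 0 1 else {1}" l] by (simp add: circles_def)

lemma compact_circles: "compact (circles d)"
proof -
  have "compactin (product_topology (\<lambda>_::nat. euclidean::complex topology) UNIV) (circles d)"
    unfolding circles_def compactin_PiE by auto
  then show ?thesis by (simp add: euclidean_product_topology)
qed

lemma continuous_on_to_circles: "continuous_on UNIV (to_circles d)"
proof (rule continuous_on_coordinatewise_then_product)
  fix l
  show "continuous_on UNIV (\<lambda>x. to_circles d x l)"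
    by (cases "l < d") (auto simp: to_circles_def cis_conv_exp intro!: continuous_intros continuous_on_coordinate)
qed

lemma cis_eqD:
  assumes "cis (2 * pi * s) = cis (2 * pi * t)"
  shows "s - t \<in> \<int>"
proof -
  have "exp (\<i> * complex_of_real (2 * pi * s)) = exp (\<i> * complex_of_real (2 * pi * t))"
    using assms by (simp add: cis_conv_exp)
  then obtain n :: int where "\<i> * complex_of_real (2 * pi * s) = \<i> * complex_of_real (2 * pi * t) + (of_int (2 * n) * pi) * \<i>"
    unfolding exp_eq by blast
  then have "\<i> * complex_of_real (2 * pi * s) = \<i> * complex_of_real (2 * pi * t + 2 * n * pi)"
    by (simp add: algebra_simps)
  then have "2 * pi * s = 2 * pi * t + 2 * n * pi"
    by (metis complex_i_not_zero mult_cancel_left of_real_eq_iff)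
  then have "2 * pi * (s - t) = 2 * pi * n" by (simp add: algebra_simps)
  then have "s - t = n" by simp
  then show ?thesis by simp
qed

text \<open>Inverting \<open>to_circles\<close> through \<open>Arg\<close> is discontinuous at the
  branch cut, but the jumps are whole periods of \<open>f\<close>. So continuity at
  \<open>w0\<close> may be checked with another choice of angles, one whose cut stays away from
  \<open>w0\<close>.\<close>

lemma continuous_periodic_factor:
  assumes per: "periodic d f" and cont: "continuous_on UNIV f"
  obtains F where "continuous_on (circles d) F" "\<And>x. f x = F (to_circles d x)"
proof
  define F where "F = (\<lambda>w. f (\<lambda>l. Arg (w l) / (2 * pi)))"
  show "f x = F (to_circles d x)" for x
  proof -
    have "x l - Arg (to_circles d x l) / (2 * pi) \<in> \<int>" if "l < d" for l
      by (rule cis_eqD) (use that in \<open>simp add: to_circles_def cis_Arg\<close>)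
    then show ?thesis using per unfolding periodic_def F_def by simp
  qed
  show "continuous_on (circles d) F"
    unfolding continuous_on_eq_continuous_within
  proof
    fix w0 assume w0: "w0 \<in> circles d"
    \<comment> \<open>On \<open>U\<close> each \<open>w l / w0 l\<close> stays in the right half
      plane, off the cut of \<open>Arg\<close>; \<open>\<theta>\<close> measures angles relative to
      \<open>w0\<close>.\<close>
    define U where "U = (\<Inter>l\<in>{..<d}. {w. 0 < Re (w l / w0 l)})"
    define \<theta> where "\<theta> = (\<lambda>w l. if l < d then (Arg (w l / w0 l) + Arg (w0 l)) / (2 * pi) else 0)"
    have nz: "w0 l \<noteq> 0" if "l < d" for l
      using circles_norm[OF w0 that] by auto
    have "open {w. 0 < Re (w l / w0 l)}" if "l < d" for l
    proof (rule open_Collect_less)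
      show "continuous_on UNIV (\<lambda>w. Re (w l / w0 l))"
        using nz[OF that] by (intro continuous_on_Re continuous_on_divide continuous_on_coordinate continuous_on_const) auto
    qed simp
    then have "open U" unfolding U_def by (intro open_INT) auto
    have "w0 \<in> U" using nz by (auto simp: U_def)
    have "continuous_on U \<theta>"
    proof (rule continuous_on_coordinatewise_then_product)
      fix l
      show "continuous_on U (\<lambda>x. \<theta> x l)"
      proof (cases "l < d")
        case True
        have "continuous_on U (\<lambda>x. Arg (x l / w0 l))"
        proof (rule continuous_on_compose2[OF continuous_on_Arg])
          show "continuous_on U (\<lambda>x. x l / w0 l)" by (intro continuous_on_divide continuous_on_coordinate continuous_on_const) (use nz True in auto)
          show "(\<lambda>x. x l / w0 l) ` U \<subseteq> - \<real>\<^sub>\<le>\<^sub>0"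
          proof (intro image_subsetI ComplI)
            fix x assume "x \<in> U"
            then have "0 < Re (x l / w0 l)" using True unfolding U_def by blast
            moreover assume "x l / w0 l \<in> \<real>\<^sub>\<le>\<^sub>0"
            ultimately show False unfolding complex_nonpos_Reals_iff by linarith
          qed
        qed
        then show ?thesis using True by (auto simp: \<theta>_def intro!: continuous_on_divide continuous_on_add continuous_on_const)
      qed (simp add: \<theta>_def)
    qed
    then have "continuous_on U (\<lambda>w. f (\<theta> w))"
      by (rule continuous_on_compose2[OF cont]) auto
    moreover have "F w = f (\<theta> w)" if "w \<in> circles d \<inter> U" for w
    proof -
      \<comment> \<open>Both angles belong to the same point \<open>w l\<close> of the circle, so
        they differ by whole turns.\<close>
      have "Arg (w l) / (2 * pi) - \<theta> w l \<in> \<int>" if l: "l < d" for l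
      proof (rule cis_eqD)
        have n1: "norm (w l) = 1" "norm (w0 l) = 1"
          using w0 \<open>w \<in> circles d \<inter> U\<close> l circles_norm by auto
        have sgn1: "sgn z = z" if "norm z = 1" for z :: complex using that by (simp add: sgn_eq)
        have "cis (2 * pi * \<theta> w l) = cis (Arg (w l / w0 l) + Arg (w0 l))" by (simp add: \<theta>_def l)
        also have "\<dots> = cis (Arg (w l / w0 l)) * cis (Arg (w0 l))" by (simp only: cis_mult)
        also have "\<dots> = sgn (w l / w0 l) * sgn (w0 l)" using n1 nz[OF l] by (subst (1 2) cis_Arg) auto
        also have "\<dots> = w l" using n1 nz[OF l] by (simp add: sgn1 norm_divide)
        also have "\<dots> = cis (Arg (w l))" using n1 sgn1[of "w l"] cis_Arg[of "w l"] by force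
        finally show "cis (2 * pi * (Arg (w l) / (2 * pi))) = cis (2 * pi * \<theta> w l)" by simp
      qed
      then show ?thesis using per unfolding periodic_def F_def by simp
    qed
    ultimately have "continuous_on (circles d \<inter> U) F"
      by (metis (no_types, lifting) continuous_on_cong continuous_on_subset inf_le2)
    then have "continuous (at w0 within circles d \<inter> U) F"
      using w0 \<open>w0 \<in> U\<close> by (simp add: continuous_on_eq_continuous_within)
    moreover have "at w0 within circles d \<inter> U = at w0 within circles d"
      by (rule at_within_nhd[OF \<open>w0 \<in> U\<close> \<open>open U\<close>]) auto
    ultimately show "continuous (at w0 within circles d) F" by simp
  qed
qed

lemma fcoeff_times_character:
  "fcoeff d (\<lambda>x. h x * character d j x) k = fcoeff d h (\<lambda>l. k l - j l)"
proof -
  have "character d j x * cnj (character d k x) = cnj (character d (\<lambda>l. k l - j l) x)" for x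
    by (simp add: character_def cis_cnj cis_mult sum_subtractf algebra_simps)
  then show ?thesis by (simp add: fcoeff_character mult.assoc)
qed

lemma integrable_torus_times:
  fixes h u :: "(nat \<Rightarrow> real) \<Rightarrow> complex"
  assumes h: "integrable (torus_measure d) h" and u: "continuous_on UNIV u" and B: "\<And>x. cmod (u x) \<le> B"
  shows "integrable (torus_measure d) (\<lambda>x. h x * u x)"
proof (rule Bochner_Integration.integrable_bound)
  show "integrable (torus_measure d) (\<lambda>x. B *\<^sub>R h x)" using h by simp
  show "(\<lambda>x. h x * u x) \<in> borel_measurable (torus_measure d)"
    using borel_measurable_torus_continuous[OF u] h by (intro borel_measurable_times) auto
  have "cmod (h x * u x) \<le> norm (B *\<^sub>R h x)" for x
  proof -
    have "cmod (h x) * cmod (u x) \<le> cmod (h x) * \<bar>B\<bar>"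
      using B[of x] by (intro mult_left_mono) auto
    then show ?thesis by (simp add: norm_mult mult.commute)
  qed
  then show "AE x in torus_measure d. cmod (h x * u x) \<le> norm (B *\<^sub>R h x)" by simp
qed

lemma continuous_circles_bounded:
  fixes q :: "(nat \<Rightarrow> complex) \<Rightarrow> 'a::real_normed_vector"
  assumes q: "continuous_on (circles d) q"
  obtains B where "\<And>x. norm (q (to_circles d x)) \<le> B" "0 \<le> B"
proof -
  have "bounded (q ` circles d)"
    using compact_continuous_image[OF q compact_circles] compact_imp_bounded by blast
  then obtain B where "\<And>w. w \<in> circles d \<Longrightarrow> norm (q w) \<le> B" by (auto simp: bounded_iff)
  then have *: "norm (q (to_circles d x)) \<le> B" for x using to_circles_in by blast
  moreover have "0 \<le> B" using order_trans[OF norm_ge_zero *[of undefined]] .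
  ultimately show thesis by (rule that)
qed

lemma continuous_on_circles_compose:
  assumes "continuous_on (circles d) q"
  shows "continuous_on UNIV (\<lambda>x. q (to_circles d x))"
  by (rule continuous_on_compose2[OF assms continuous_on_to_circles]) (use to_circles_in in auto)

definition vanishing :: "nat \<Rightarrow> ((nat \<Rightarrow> real) \<Rightarrow> complex) \<Rightarrow> bool" where
  "vanishing d h \<longleftrightarrow> integrable (torus_measure d) h \<and> (\<forall>k. fcoeff d h k = 0)"

text \<open>Characters are multipliers since they only shift the coefficients, and a product of multipliers is
  one by associativity; so trigonometric polynomials never have to be written out.\<close>

definition multipliers :: "nat \<Rightarrow> ((nat \<Rightarrow> complex) \<Rightarrow> real) set" where
  "multipliers d = {q. continuous_on (circles d) q \<and>
     (\<forall>h. vanishing d h \<longrightarrow> vanishing d (\<lambda>x. h x * complex_of_real (q (to_circles d x))))}"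

lemma integrable_torus_times_circles:
  fixes h :: "(nat \<Rightarrow> real) \<Rightarrow> complex" and q :: "(nat \<Rightarrow> complex) \<Rightarrow> real"
  assumes "integrable (torus_measure d) h" "continuous_on (circles d) q"
  shows "integrable (torus_measure d) (\<lambda>x. h x * complex_of_real (q (to_circles d x)))"
proof -
  obtain B where "\<And>x. norm (q (to_circles d x)) \<le> B" by (rule continuous_circles_bounded[OF assms(2)]) blast
  then show ?thesis
    by (intro integrable_torus_times[OF assms(1), of _ B] continuous_on_of_real
        continuous_on_circles_compose assms(2)) auto
qed

lemma vanishing_add:
  assumes "vanishing d h" "vanishing d h'"
  shows "vanishing d (\<lambda>x. h x + h' x)"
proof -
  have int: "integrable (torus_measure d) (\<lambda>x. h x * cnj (character d k x))" if "vanishing d h" for h k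
    using that by (intro integrable_torus_times[where B = 1]) (auto simp: vanishing_def intro!: continuous_intros)
  show ?thesis
    using assms int[OF assms(1)] int[OF assms(2)]
    by (auto simp: vanishing_def fcoeff_character distrib_right)
qed

lemma vanishing_scale: "vanishing d h \<Longrightarrow> vanishing d (\<lambda>x. c * h x)"
  by (auto simp: vanishing_def fcoeff_character mult.assoc)

lemma vanishing_character: "vanishing d h \<Longrightarrow> vanishing d (\<lambda>x. h x * character d j x)"
  by (auto simp: vanishing_def fcoeff_times_character intro!: continuous_intros integrable_torus_times[where B = 1])

lemma character_unit:
  assumes "l < d"
  shows "character d (\<lambda>i. if i = l then c else 0) x = cis (2 * pi * (real_of_int c * x l))"
proof -
  have "(\<Sum>i<d. real_of_int (if i = l then c else 0) * x i) = (\<Sum>i<d. if i = l then real_of_int c * x i else 0)"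
    by (intro sum.cong) auto
  also have "\<dots> = real_of_int c * x l" using assms by simp
  finally show ?thesis by (simp add: character_def)
qed

text \<open>Cosine and sine are combinations of the characters at plus and minus the
  \<open>l\<close>-th unit vector.\<close>

lemma multipliers_coordinate:
  assumes l: "l < d"
  shows "(\<lambda>w. Re (w l)) \<in> multipliers d" "(\<lambda>w. Im (w l)) \<in> multipliers d"
proof -
  let ?u = "\<lambda>c. character d (\<lambda>i. if i = l then c else 0)"
  have Re: "complex_of_real (Re (to_circles d x l)) = (1/2) * ?u 1 x + (1/2) * ?u (-1) x" for x
    using l by (simp add: to_circles_def character_unit complex_eq_iff)
  have Im: "complex_of_real (Im (to_circles d x l)) = (-\<i>/2) * ?u 1 x + (\<i>/2) * ?u (-1) x" for x
    using l by (simp add: to_circles_def character_unit complex_eq_iff)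
  have "vanishing d (\<lambda>x. h x * (c * ?u 1 x + c' * ?u (-1) x))" if "vanishing d h" for h c c'
  proof -
    have "vanishing d (\<lambda>x. c * (h x * ?u 1 x) + c' * (h x * ?u (-1) x))"
      by (intro vanishing_add vanishing_scale vanishing_character that)
    then show ?thesis by (simp add: algebra_simps)
  qed
  then show "(\<lambda>w. Re (w l)) \<in> multipliers d" "(\<lambda>w. Im (w l)) \<in> multipliers d"
    unfolding multipliers_def mem_Collect_eq Re Im
    by (intro conjI allI impI continuous_on_Re continuous_on_Im continuous_on_coordinate; blast)+
qed

text \<open>The real Stone-Weierstrass theorem asks for a point-separating algebra with constants.
  Points of \<open>circles d\<close> are 1 from coordinate \<open>d\<close> on, so two distinct ones
  differ in the real or imaginary part of an earlier coordinate.\<close>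

lemma function_ring_multipliers: "function_ring_on (multipliers d) (circles d)"
proof
  show "compact (circles d)" by (rule compact_circles)
  show "continuous_on (circles d) q" if "q \<in> multipliers d" for q
    using that by (simp add: multipliers_def)
  show "(\<lambda>x. q x + r x) \<in> multipliers d" if "q \<in> multipliers d" "r \<in> multipliers d" for q r
    using that vanishing_add by (auto simp: multipliers_def distrib_left intro!: continuous_on_add)
  show "(\<lambda>x. q x * r x) \<in> multipliers d" if "q \<in> multipliers d" "r \<in> multipliers d" for q r
    using that by (auto simp: multipliers_def mult.assoc[symmetric] intro!: continuous_on_mult)
  show "(\<lambda>_. c) \<in> multipliers d" for c
    using vanishing_scale[of d _ "complex_of_real c"] by (auto simp: multipliers_def mult.commute)
  show "\<exists>f\<in>multipliers d. f x \<noteq> f y" if xy: "x \<in> circles d" "y \<in> circles d" "x \<noteq> y" for x y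
  proof -
    obtain l where l: "x l \<noteq> y l" using xy(3) by blast
    have "l < d"
    proof (rule ccontr)
      assume "\<not> l < d"
      then have "w l = 1" if "w \<in> circles d" for w
        using PiE_mem[of w UNIV "\<lambda>l. if l < d then sphere 0 1 else {1}" l] that by (simp add: circles_def)
      then show False using xy(1,2) l by metis
    qed
    then show ?thesis using l multipliers_coordinate[of l d] by (metis complex_eq_iff)
  qed
qed

section \<open>Uniqueness of the Fourier coefficients of a continuous function\<close>

lemma emeasure_unit_interval_pos:
  assumes "open X" "t \<in> X" "0 \<le> t" "t < (1::real)"
  shows "0 < emeasure (restrict_space lborel {0..1}) (X \<inter> {0..1})"
proof -
  obtain e where e: "0 < e" "ball t e \<subseteq> X" using assms openE by blast
  \<comment> \<open>An interval to the right of \<open>t\<close> fits into the unit interval because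
    \<open>t < 1\<close>, which fractional parts satisfy.\<close>
  define r where "r = min (e / 2) (1 - t)"
  have r: "0 < r" "r < e" "t + r \<le> 1" using e assms by (auto simp: r_def)
  have "{t..t + r} \<subseteq> X \<inter> {0..1}"
    using r e assms by (auto simp: subset_iff dist_real_def)
  then have "emeasure lborel {t..t+r} \<le> emeasure lborel (X \<inter> {0..1})"
    using assms by (intro emeasure_mono) auto
  moreover have "0 < emeasure lborel {t..t+r}" using r by simp
  ultimately show ?thesis by (simp add: emeasure_restrict_space)
qed

text \<open>Non-empty open subsets of the torus have positive measure. A point where
  \<open>g\<close> is nonzero has a box neighbourhood free of zeros; its first \<open>d\<close>
  sides, cut to the unit interval, form a set \<open>A\<close> of positive measure.\<close>

lemma AE_torus_zero_imp_zero:
  fixes g :: "(nat \<Rightarrow> real) \<Rightarrow> complex"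
  assumes per: "periodic d g" and cont: "continuous_on UNIV g" and AE: "AE x in torus_measure d. g x = 0"
  shows "g x = 0"
proof (rule ccontr)
  assume nz: "g x \<noteq> 0"
  define x1 where "x1 = (\<lambda>l. frac (x l))"
  have "g x = g x1" using per unfolding periodic_def x1_def by (simp add: frac_def)
  then have "x1 \<in> {y. g y \<noteq> 0}" using nz by simp
  moreover have "open {y. g y \<noteq> 0}" by (intro open_Collect_neq cont continuous_on_const)
  then have "openin (product_topology (\<lambda>_::nat. euclidean::real topology) UNIV) {y. g y \<noteq> 0}"
    by (simp add: euclidean_product_topology)
  ultimately obtain X where X: "x1 \<in> Pi\<^sub>E UNIV X" "\<And>i. open (X i)" "Pi\<^sub>E UNIV X \<subseteq> {y. g y \<noteq> 0}"
    using product_topology_open_contains_basis by (metis (no_types, lifting) open_openin)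
  let ?M = "\<lambda>_::nat. restrict_space lborel {0..1::real}"
  interpret product_sigma_finite ?M
    using prob_space_unit_interval by (intro product_sigma_finite.intro prob_space_imp_sigma_finite)
  define A where "A = (\<Pi>\<^sub>E l\<in>{..<d}. X l \<inter> {0..1})"
  have sets: "X l \<inter> {0..1} \<in> sets (?M l)" for l
    using X(2)[of l] by (auto simp: sets_restrict_space)
  have Asets: "A \<in> sets (torus_measure d)"
    unfolding A_def torus_measure_def by (intro sets_PiM_I_finite sets) auto
  have "emeasure (torus_measure d) A = (\<Prod>l<d. emeasure (?M l) (X l \<inter> {0..1}))"
    unfolding A_def torus_measure_def by (intro emeasure_PiM sets) auto
  also have "\<dots> > 0"
  proof -
    have "emeasure (?M l) (X l \<inter> {0..1}) \<noteq> 0" for l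
      using emeasure_unit_interval_pos[OF X(2), of "x1 l" l] X(1)
      by (force simp: x1_def frac_lt_1 PiE_iff)
    then show ?thesis by (simp add: zero_less_iff_neq_zero)
  qed
  finally have pos: "emeasure (torus_measure d) A > 0" .
  have "g y \<noteq> 0" if "y \<in> A" for y
  proof -
    \<comment> \<open>A point of \<open>A\<close> fixes only the first \<open>d\<close> coordinates.
      Completing it by \<open>x1\<close> leads into the box and does not change the value of
      \<open>g\<close>.\<close>
    have "(\<lambda>l. if l < d then y l else x1 l) \<in> Pi\<^sub>E UNIV X"
      using that X(1) by (auto simp: A_def PiE_iff)
    then have "g (\<lambda>l. if l < d then y l else x1 l) \<noteq> 0" using X(3) by auto
    moreover have "g y = g (\<lambda>l. if l < d then y l else x1 l)"
      using per unfolding periodic_def by simp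
    ultimately show ?thesis by simp
  qed
  then have "AE y in torus_measure d. y \<notin> A" using AE by (auto elim: eventually_mono)
  then have "emeasure (torus_measure d) A = 0"
    using Asets AE_iff_measurable[of A "torus_measure d" "\<lambda>y. y \<notin> A"] sets.sets_into_space[OF Asets]
    by (auto simp: Int_absorb1 Collect_conj_eq)
  then show False using pos by simp
qed

text \<open>By Stone-Weierstrass, \<open>g\<close> times any continuous real function of the circle
  coordinates has integral 0. Applied to the real and imaginary parts of \<open>g\<close> itself,
  this makes the integral of |g|^2 vanish.\<close>

lemma fcoeff_zero_imp_zero:
  fixes g :: "(nat \<Rightarrow> real) \<Rightarrow> complex"
  assumes per: "periodic d g" and cont: "continuous_on UNIV g" and zero: "\<And>k. fcoeff d g k = 0"
  shows "g x = 0"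
proof -
  interpret prob_space "torus_measure d" by (rule prob_space_torus)
  interpret function_ring_on "multipliers d" "circles d" by (rule function_ring_multipliers)
  obtain F where F: "continuous_on (circles d) F" "\<And>x. g x = F (to_circles d x)"
    by (rule continuous_periodic_factor[OF per cont]) blast
  obtain B where B: "\<And>x. cmod (g x) \<le> B" "0 \<le> B"
    using continuous_circles_bounded[OF F(1)] F(2) by metis
  have int: "integrable (torus_measure d) g"
    by (rule integrable_torus_bounded[OF borel_measurable_torus_continuous[OF cont] B(1)])
  then have van: "vanishing d g" using zero by (simp add: vanishing_def)
  have orth: "(LINT x|torus_measure d. g x * complex_of_real (u (to_circles d x))) = 0"
    if u: "continuous_on (circles d) u" for u
  proof -
    let ?J = "LINT x|torus_measure d. g x * complex_of_real (u (to_circles d x))"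
    have "cmod ?J \<le> B * \<epsilon>" if \<epsilon>: "0 < \<epsilon>" for \<epsilon>
    proof -
      obtain q where q: "q \<in> multipliers d" "\<And>w. w \<in> circles d \<Longrightarrow> \<bar>u w - q w\<bar> < \<epsilon>"
        using Stone_Weierstrass_basic[OF u \<epsilon>] by blast
      have qc: "continuous_on (circles d) q" using q(1) continuous by blast
      have iu: "integrable (torus_measure d) (\<lambda>x. g x * complex_of_real (u (to_circles d x)))"
        and iq: "integrable (torus_measure d) (\<lambda>x. g x * complex_of_real (q (to_circles d x)))"
        by (intro integrable_torus_times_circles int u qc)+
      have "vanishing d (\<lambda>x. g x * complex_of_real (q (to_circles d x)))"
        using q(1) van by (simp add: multipliers_def)
      \<comment> \<open>The coefficient at frequency 0 is the plain integral.\<close>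
      then have "fcoeff d (\<lambda>x. g x * complex_of_real (q (to_circles d x))) (\<lambda>_. 0) = 0"
        by (simp add: vanishing_def)
      then have "(LINT x|torus_measure d. g x * complex_of_real (q (to_circles d x))) = 0"
        by (simp add: fcoeff_def)
      then have "?J = (LINT x|torus_measure d. g x * complex_of_real (u (to_circles d x))
          - g x * complex_of_real (q (to_circles d x)))"
        by (simp add: Bochner_Integration.integral_diff[OF iu iq])
      also have "cmod \<dots> \<le> (LINT x|torus_measure d. B * \<epsilon>)"
      proof (rule order_trans[OF integral_norm_bound integral_mono])
        show "cmod (g x * complex_of_real (u (to_circles d x)) - g x * complex_of_real (q (to_circles d x)))
            \<le> B * \<epsilon>" for x
        proof -
          have "cmod (g x) * \<bar>u (to_circles d x) - q (to_circles d x)\<bar> \<le> B * \<epsilon>"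
            using B q(2)[OF to_circles_in[of d x]] by (intro mult_mono) auto
          then show ?thesis
            by (metis norm_mult norm_of_real of_real_diff right_diff_distrib)
        qed
      qed (auto intro!: integrable_norm Bochner_Integration.integrable_diff iu iq)
      also have "\<dots> = B * \<epsilon>" by (simp add: prob_space)
      finally show ?thesis .
    qed
    then have "cmod ?J \<le> 0 + \<epsilon>" if "0 < \<epsilon>" for \<epsilon>
    proof -
      \<comment> \<open>Dividing by \<open>B + 1\<close> rather than \<open>B\<close> covers
        \<open>B = 0\<close>.\<close>
      have "cmod ?J \<le> B * (\<epsilon> / (B + 1))"
        using B that \<open>\<And>\<epsilon>. 0 < \<epsilon> \<Longrightarrow> cmod ?J \<le> B * \<epsilon>\<close>[of "\<epsilon> / (B + 1)"] by simp
      also have "\<dots> \<le> \<epsilon>" using B that by (simp add: field_simps)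
      finally show ?thesis by simp
    qed
    then have "cmod ?J \<le> 0" by (rule field_le_epsilon)
    then show ?thesis by simp
  qed
  have ReF: "continuous_on (circles d) (\<lambda>w. Re (F w))" and ImF: "continuous_on (circles d) (\<lambda>w. Im (F w))"
    using F(1) by (auto intro: continuous_on_Re continuous_on_Im)
  have iR: "integrable (torus_measure d) (\<lambda>x. g x * complex_of_real (Re (g x)))"
    and iI: "integrable (torus_measure d) (\<lambda>x. g x * complex_of_real (Im (g x)))"
    using integrable_torus_times_circles[OF int ReF] integrable_torus_times_circles[OF int ImF]
    by (simp_all add: F(2))
  \<comment> \<open>The product \<open>g * cnj g\<close> is split because \<open>orth\<close> speaks
    of real multipliers.\<close>
  have "(LINT x|torus_measure d. complex_of_real ((cmod (g x))\<^sup>2))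
      = (LINT x|torus_measure d. g x * complex_of_real (Re (g x)) - \<i> * (g x * complex_of_real (Im (g x))))"
    by (intro Bochner_Integration.integral_cong refl)
       (simp add: complex_eq_iff cmod_power2, simp add: power2_eq_square)
  also have "\<dots> = (LINT x|torus_measure d. g x * complex_of_real (Re (g x)))
      - \<i> * (LINT x|torus_measure d. g x * complex_of_real (Im (g x)))"
    using iR iI by simp
  also have "\<dots> = 0" using orth[OF ReF] orth[OF ImF] by (simp add: F(2)[symmetric])
  finally have "(LINT x|torus_measure d. (cmod (g x))\<^sup>2) = 0"
    unfolding integral_complex_of_real of_real_eq_0_iff .
  moreover have "integrable (torus_measure d) (\<lambda>x. (cmod (g x))\<^sup>2)"
  proof (rule integrable_const_bound[of _ "B\<^sup>2"])
    show "AE x in torus_measure d. norm ((cmod (g x))\<^sup>2) \<le> B\<^sup>2" using B by (auto intro: power_mono)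
    show "(\<lambda>x. (cmod (g x))\<^sup>2) \<in> borel_measurable (torus_measure d)" using int by auto
  qed
  ultimately have "AE x in torus_measure d. (cmod (g x))\<^sup>2 = 0"
    by (subst (asm) integral_nonneg_eq_0_iff_AE) auto
  then have "AE x in torus_measure d. g x = 0" by simp
  then show ?thesis by (rule AE_torus_zero_imp_zero[OF per cont])
qed

section \<open>Termwise integration, orthogonality and the Fourier series\<close>

lemma (in prob_space) has_sum_integral:
  fixes u :: "'k \<Rightarrow> 'a \<Rightarrow> complex"
  assumes bound: "\<And>k x. k \<in> A \<Longrightarrow> cmod (u k x) \<le> B k" and B: "B summable_on A"
    and int: "\<And>k. k \<in> A \<Longrightarrow> integrable M (u k)" and S: "integrable M S"
    and sum: "\<And>x. ((\<lambda>k. u k x) has_sum S x) A"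
  shows "((\<lambda>k. LINT x|M. u k x) has_sum (LINT x|M. S x)) A"
  unfolding has_sum_def
proof (rule tendstoI)
  fix e :: real assume e: "0 < e"
  \<comment> \<open>An unordered sum is a limit over finite subsets, not along a sequence; uniform
    convergence on a space of mass 1 takes the place of dominated convergence.\<close>
  have "uniform_limit UNIV (\<lambda>F x. \<Sum>k\<in>F. u k x) S (finite_subsets_at_top A)"
    by (rule Weierstrass_m_test_general') (use bound B sum in auto)
  then have "\<forall>\<^sub>F F in finite_subsets_at_top A. \<forall>x. dist (\<Sum>k\<in>F. u k x) (S x) < e / 2"
    using e by (auto simp: uniform_limit_iff dest!: spec[of _ "e / 2"])
  moreover have "\<forall>\<^sub>F F in finite_subsets_at_top A. finite F \<and> F \<subseteq> A"
    by (intro eventually_finite_subsets_at_top_weakI) auto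
  ultimately show "\<forall>\<^sub>F F in finite_subsets_at_top A. dist (\<Sum>k\<in>F. LINT x|M. u k x) (LINT x|M. S x) < e"
  proof eventually_elim
    case (elim F)
    have iF: "integrable M (\<lambda>x. \<Sum>k\<in>F. u k x)" using elim int by auto
    have "(\<Sum>k\<in>F. LINT x|M. u k x) - (LINT x|M. S x) = (LINT x|M. (\<Sum>k\<in>F. u k x) - S x)"
      using elim int by (subst Bochner_Integration.integral_diff[OF iF S], subst Bochner_Integration.integral_sum) auto
    also have "cmod \<dots> \<le> (LINT x|M. e / 2)"
      by (rule order_trans[OF integral_norm_bound integral_mono])
         (use elim in \<open>auto intro!: integrable_norm Bochner_Integration.integrable_diff iF S less_imp_le simp: dist_norm\<close>)
    also have "\<dots> < e" using e by (simp add: prob_space)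
    finally show ?case by (simp add: dist_norm)
  qed
qed

lemma integral_cis_unit_interval:
  "(LINT t:{0..1}|lborel. cis (2 * pi * real_of_int n * t)) = (if n = 0 then 1 else 0)"
proof (cases "n = 0")
  case True
  then show ?thesis by (simp add: set_lebesgue_integral_def)
next
  case False
  let ?c = "2 * pi * real_of_int n"
  let ?F = "\<lambda>t. - (\<i> / ?c) * cis (?c * t)"
  have "((\<lambda>t. cis (?c * t)) has_vector_derivative (?c * \<i> * cis (?c * t))) (at t within T)" for t T
  proof -
    have "((\<lambda>z. exp (\<i> * (complex_of_real ?c * z))) has_field_derivative
        (?c * \<i> * exp (\<i> * (complex_of_real ?c * of_real t)))) (at (of_real t))"
      by (auto intro!: derivative_eq_intros)
    from has_vector_derivative_real_field[OF this] show ?thesis by (simp add: cis_conv_exp)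
  qed
  then have "(?F has_vector_derivative (- (\<i> / ?c) * (?c * \<i> * cis (?c * t)))) (at t within T)" for t T
    by (rule has_vector_derivative_mult_right)
  moreover have "- (\<i> / ?c) * (?c * \<i> * cis (?c * t)) = cis (?c * t)" for t
    using False by (simp add: field_simps)
  ultimately have "(?F has_vector_derivative cis (?c * t)) (at t within T)" for t T by metis
  then have "(LINT t|lborel. indicator {0..1} t *\<^sub>R cis (?c * t)) = ?F 1 - ?F 0"
    by (intro integral_FTC_atLeastAtMost) (auto simp: cis_conv_exp intro!: continuous_intros)
  also have "\<dots> = 0" using cis_multiple_2pi[of "real_of_int n"] by simp
  finally show ?thesis using False by (simp add: set_lebesgue_integral_def)
qed

lemma integral_character:
  "(LINT x|torus_measure d. character d k x) = (if \<forall>l<d. k l = 0 then 1 else 0)"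
proof -
  let ?M = "\<lambda>_::nat. restrict_space lborel {0..1::real}"
  interpret product_sigma_finite ?M
    using prob_space_unit_interval by (intro product_sigma_finite.intro prob_space_imp_sigma_finite)
  interpret I: prob_space "restrict_space lborel {0..1::real}" by (rule prob_space_unit_interval)
  let ?f = "\<lambda>l t. cis (2 * pi * real_of_int (k l) * t)"
  have int: "integrable (restrict_space lborel {0..1}) (?f l)" for l
    by (rule I.integrable_const_bound[of _ 1]) (auto intro!: measurable_restrict_space1 simp: cis_conv_exp)
  have "character d k x = (\<Prod>l<d. ?f l (x l))" for x
  proof -
    have "cis (\<Sum>l\<in>A. h l) = (\<Prod>l\<in>A. cis (h l))" if "finite A" for A :: "nat set" and h
      using that by (induction A rule: finite_induct) (auto simp: cis_mult[symmetric])
    then show ?thesis by (simp add: character_def sum_distrib_left mult.assoc)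
  qed
  then have "(LINT x|torus_measure d. character d k x) = (\<Prod>l<d. LINT t|restrict_space lborel {0..1}. ?f l t)"
    unfolding torus_measure_def using product_integral_prod[OF finite_lessThan int, of d] by simp
  also have "\<dots> = (\<Prod>l<d. if k l = 0 then 1 else 0)"
    by (simp add: integral_restrict_space integral_cis_unit_interval[unfolded set_lebesgue_integral_def] set_lebesgue_integral_def)
  also have "\<dots> = (if \<forall>l<d. k l = 0 then 1 else 0)" by auto
  finally show ?thesis .
qed

lemma fcoeff_restrict: "fcoeff d f (restrict k {..<d}) = fcoeff d f k"
  by (simp add: fcoeff_def)

lemma character_periodic: "periodic d (character d k)"
  unfolding periodic_def
proof (intro allI impI)
  fix x y :: "nat \<Rightarrow> real" assume "\<forall>l<d. x l - y l \<in> \<int>"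
  then have "(\<Sum>l<d. real_of_int (k l) * (x l - y l)) \<in> \<int>" by (intro Ints_sum Ints_mult) auto
  then have "cis (2 * pi * (\<Sum>l<d. real_of_int (k l) * (x l - y l))) = 1" by (rule cis_multiple_2pi)
  moreover have "character d k x = character d k y * cis (2 * pi * (\<Sum>l<d. real_of_int (k l) * (x l - y l)))"
    by (simp add: character_def cis_mult sum_subtractf algebra_simps)
  ultimately show "character d k x = character d k y" by simp
qed

text \<open>The series converges uniformly to a continuous \<open>S\<close>, which has the
  coefficients of \<open>f\<close> by orthogonality. Uniqueness applied to \<open>f - S\<close>
  gives \<open>f = S\<close>.\<close>

lemma fourier_series:
  assumes f: "wiener d f" and cont: "continuous_on UNIV f"
  shows "((\<lambda>k. fcoeff d f k * character d k x) has_sum f x) (Zd d)"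
proof -
  interpret prob_space "torus_measure d" by (rule prob_space_torus)
  let ?c = "fcoeff d f"
  define S where "S = (\<lambda>x. \<Sum>\<^sub>\<infinity>k\<in>Zd d. ?c k * character d k x)"
  have c: "(\<lambda>k. cmod (?c k)) summable_on Zd d" and per: "periodic d f" and int: "integrable (torus_measure d) f"
    using f by (auto simp: wiener_def)
  have abs: "(\<lambda>k. norm (?c k * character d k x)) summable_on Zd d" for x
    using c by (simp add: norm_mult)
  have sum: "((\<lambda>k. ?c k * character d k x) has_sum S x) (Zd d)" for x
    unfolding S_def by (rule has_sum_infsum[OF abs_summable_summable[OF abs]])
  have "uniform_limit UNIV (\<lambda>F x. \<Sum>k\<in>F. ?c k * character d k x) S (finite_subsets_at_top (Zd d))"
    unfolding S_def by (rule Weierstrass_m_test_general[OF _ c]) (simp add: norm_mult)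
  then have Scont: "continuous_on UNIV S"
    by (rule uniform_limit_theorem[rotated]) (auto intro!: always_eventually continuous_on_sum continuous_on_mult continuous_on_const continuous_on_character)
  have Sper: "periodic d S"
    unfolding periodic_def
  proof (intro allI impI)
    fix x y :: "nat \<Rightarrow> real" assume "\<forall>l<d. x l - y l \<in> \<int>"
    then have "character d k x = character d k y" for k
      using character_periodic unfolding periodic_def by blast
    then show "S x = S y" by (simp add: S_def)
  qed
  have "cmod (S x) \<le> (\<Sum>\<^sub>\<infinity>k\<in>Zd d. cmod (?c k))" for x
    using norm_infsum_bound[OF abs] by (simp add: S_def norm_mult)
  then have Sint: "integrable (torus_measure d) S"
    by (rule integrable_torus_bounded[OF borel_measurable_torus_continuous[OF Scont]])
  have times: "integrable (torus_measure d) (\<lambda>x. h x * cnj (character d k x))"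
    if "integrable (torus_measure d) h" for h k
    by (rule integrable_torus_times[OF that, of _ 1]) (auto intro!: continuous_on_cnj continuous_on_character)
  have chint: "integrable (torus_measure d) (character d k)" for k
    by (rule integrable_torus_bounded[of _ _ 1]) (auto intro!: borel_measurable_torus_continuous continuous_on_character)
  have coeffS: "fcoeff d S k = ?c k" if k: "k \<in> Zd d" for k
  proof -
    have orth: "(LINT x|torus_measure d. character d j x * cnj (character d k x)) = (if j = k then 1 else 0)"
      if j: "j \<in> Zd d" for j
    proof -
      have "character d j x * cnj (character d k x) = character d (\<lambda>l. j l - k l) x" for x
        by (simp add: character_def cis_cnj cis_mult sum_subtractf algebra_simps)
      moreover have "(\<forall>l<d. j l - k l = 0) \<longleftrightarrow> j = k"
        using PiE_ext[OF j[unfolded Zd_def] k[unfolded Zd_def]] by auto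
      ultimately show ?thesis by (simp add: integral_character)
    qed
    have "((\<lambda>j. LINT x|torus_measure d. ?c j * character d j x * cnj (character d k x))
        has_sum (LINT x|torus_measure d. S x * cnj (character d k x))) (Zd d)"
    proof (rule has_sum_integral[OF _ c])
      show "((\<lambda>j. ?c j * character d j x * cnj (character d k x)) has_sum S x * cnj (character d k x)) (Zd d)" for x
        by (rule has_sum_cmult_left[OF sum])
    qed (auto simp: norm_mult intro!: times Sint chint)
    then have "((\<lambda>j. ?c j * (if j = k then 1 else 0)) has_sum fcoeff d S k) (Zd d)"
      by (subst (asm) has_sum_cong[where g = "\<lambda>j. ?c j * (if j = k then 1 else 0)"])
         (simp_all add: mult.assoc orth fcoeff_character)
    moreover have "((\<lambda>j. ?c j * (if j = k then 1 else 0)) has_sum ?c k) (Zd d)"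
    proof -
      have "((\<lambda>j. ?c j * (if j = k then 1 else 0)) has_sum (\<Sum>j\<in>{k}. ?c j * (if j = k then 1 else 0))) {k}"
        by (rule has_sum_finite) simp
      then show ?thesis by (subst has_sum_cong_neutral[where T = "{k}"]) (use k in auto)
    qed
    ultimately show ?thesis by (rule has_sum_unique)
  qed
  have "fcoeff d (\<lambda>x. f x - S x) k = 0" for k
  proof -
    \<comment> \<open>Uniqueness asks for every index function, but only its first \<open>d\<close>
      values affect a coefficient.\<close>
    have "restrict k {..<d} \<in> Zd d" by (simp add: Zd_def)
    then have "fcoeff d S k = fcoeff d f k" using coeffS fcoeff_restrict by metis
    then show ?thesis
      using times[OF int, of k] times[OF Sint, of k] by (simp add: fcoeff_character left_diff_distrib)
  qed
  moreover have "periodic d (\<lambda>x. f x - S x)" using per Sper unfolding periodic_def by simp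
  moreover have "continuous_on UNIV (\<lambda>x. f x - S x)" by (intro continuous_on_diff cont Scont)
  ultimately have "f x - S x = 0" by (intro fcoeff_zero_imp_zero[of d "\<lambda>x. f x - S x"])
  then show ?thesis using sum[of x] by simp
qed

section \<open>Univariate series obtained by merging frequencies\<close>

lemma has_sum_fibers:
  fixes g :: "'k \<Rightarrow> 'b::banach" and m :: "'k \<Rightarrow> 'm"
  assumes "g summable_on K"
  shows "((\<lambda>\<omega>. \<Sum>\<^sub>\<infinity>k\<in>{k\<in>K. m k = \<omega>}. g k) has_sum (\<Sum>\<^sub>\<infinity>k\<in>K. g k)) UNIV"
proof (rule has_sum_SigmaD)
  have bij: "bij_betw snd (SIGMA \<omega>:UNIV. {k\<in>K. m k = \<omega>}) K"
    by (rule bij_betwI[where g = "\<lambda>k. (m k, k)"]) auto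
  show "((\<lambda>p. g (snd p)) has_sum (\<Sum>\<^sub>\<infinity>k\<in>K. g k)) (SIGMA \<omega>:UNIV. {k\<in>K. m k = \<omega>})"
    using has_sum_infsum[OF assms] has_sum_reindex_bij_betw[OF bij] by blast
  show "((\<lambda>k. g (snd (\<omega>, k))) has_sum (\<Sum>\<^sub>\<infinity>k\<in>{k\<in>K. m k = \<omega>}. g k)) {k\<in>K. m k = \<omega>}" for \<omega>
    using summable_on_subset_banach[OF assms] by (simp add: has_sum_infsum)
qed

text \<open>Several \<open>k\<close> may share the frequency \<open>m k\<close>, so termwise
  integration against one exponential collects a whole fiber. With \<open>b\<close> and
  \<open>m\<close> arbitrary, the line and its shifts are covered alike.\<close>

lemma univariate_series:
  fixes b :: "'k \<Rightarrow> complex" and m :: "'k \<Rightarrow> int"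
  assumes b: "(\<lambda>k. cmod (b k)) summable_on K"
    and a: "\<And>t. ((\<lambda>k. b k * cis (2 * pi * real_of_int (m k) * t)) has_sum a t) K"
  shows "fcoeff1 a \<omega> = (\<Sum>\<^sub>\<infinity>k\<in>{k\<in>K. m k = \<omega>}. b k)" "continuous_on UNIV a" "wiener1 a"
proof -
  interpret I: prob_space "restrict_space lborel {0..1::real}" by (rule prob_space_unit_interval)
  let ?e = "\<lambda>n t. cis (2 * pi * real_of_int n * t)"
  have econt: "continuous_on T (?e n)" for n T by (auto simp: cis_conv_exp intro!: continuous_intros)
  have "uniform_limit UNIV (\<lambda>F t. \<Sum>k\<in>F. b k * ?e (m k) t) a (finite_subsets_at_top K)"
    by (rule Weierstrass_m_test_general'[OF _ _ b]) (use a in \<open>auto simp: norm_mult\<close>)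
  then show cont: "continuous_on UNIV a"
    by (rule uniform_limit_theorem[rotated]) (auto intro!: always_eventually continuous_intros econt)
  have integrable: "integrable (restrict_space lborel {0..1}) g" if "continuous_on UNIV g" for g :: "real \<Rightarrow> complex"
  proof -
    have "set_integrable lborel {0..1} g"
      using continuous_on_subset[OF that] by (intro borel_integrable_atLeastAtMost') auto
    then show ?thesis by (subst integrable_restrict_space) (auto simp: set_integrable_def)
  qed
  have coeff: "fcoeff1 a \<omega> = (\<Sum>\<^sub>\<infinity>k\<in>{k\<in>K. m k = \<omega>}. b k)" for \<omega>
  proof -
    have I: "(LINT t|restrict_space lborel {0..1}. g t) = (LINT t:{0..1}|lborel. g t)" for g :: "real \<Rightarrow> complex"
      by (simp add: integral_restrict_space set_lebesgue_integral_def)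
    have "((\<lambda>k. LINT t|restrict_space lborel {0..1}. b k * ?e (m k) t * ?e (-\<omega>) t)
        has_sum (LINT t|restrict_space lborel {0..1}. a t * ?e (-\<omega>) t)) K"
    proof (rule I.has_sum_integral[OF _ b])
      show "((\<lambda>k. b k * ?e (m k) t * ?e (-\<omega>) t) has_sum a t * ?e (-\<omega>) t) K" for t
        by (rule has_sum_cmult_left[OF a])
    qed (auto simp: norm_mult intro!: integrable continuous_intros econt cont)
    moreover have "(LINT t|restrict_space lborel {0..1}. b k * ?e (m k) t * ?e (-\<omega>) t)
        = (if m k = \<omega> then b k else 0)" for k
    proof -
      have "b k * ?e (m k) t * ?e (-\<omega>) t = b k * ?e (m k - \<omega>) t" for t
        by (simp add: cis_mult algebra_simps)
      then have "(LINT t|restrict_space lborel {0..1}. b k * ?e (m k) t * ?e (-\<omega>) t)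
          = b k * (LINT t|restrict_space lborel {0..1}. ?e (m k - \<omega>) t)"
        by (simp only: integral_mult_right_zero)
      then show ?thesis by (simp only: I integral_cis_unit_interval) simp
    qed
    moreover have "(LINT t|restrict_space lborel {0..1}. a t * ?e (-\<omega>) t) = fcoeff1 a \<omega>"
      by (simp add: I fcoeff1_def)
    ultimately have "((\<lambda>k. if m k = \<omega> then b k else 0) has_sum fcoeff1 a \<omega>) K" by simp
    then have "(b has_sum fcoeff1 a \<omega>) {k\<in>K. m k = \<omega>}"
      by (subst (asm) has_sum_cong_neutral[where g = b and T = "{k\<in>K. m k = \<omega>}"]) auto
    then show ?thesis by (simp add: infsumI)
  qed
  then show "fcoeff1 a \<omega> = (\<Sum>\<^sub>\<infinity>k\<in>{k\<in>K. m k = \<omega>}. b k)" .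
  have "periodic1 a" unfolding periodic1_def
  proof (intro allI impI)
    fix x y :: real assume xy: "x - y \<in> \<int>"
    have "?e n x = ?e n y" for n
    proof -
      have "cis (2 * pi * (real_of_int n * (x - y))) = 1" using xy by (intro cis_multiple_2pi Ints_mult) auto
      moreover have "?e n x = ?e n y * cis (2 * pi * (real_of_int n * (x - y)))"
        by (simp add: cis_mult algebra_simps)
      ultimately show ?thesis by simp
    qed
    then show "a x = a y" using a[of x] a[of y] has_sum_unique by (metis (no_types, lifting) has_sum_cong)
  qed
  moreover have "set_integrable lborel {0..1} a"
    using continuous_on_subset[OF cont] by (intro borel_integrable_atLeastAtMost') auto
  moreover have "(\<lambda>\<omega>. cmod (fcoeff1 a \<omega>)) summable_on UNIV"
  proof (rule summable_on_comparison_test)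
    \<comment> \<open>Fiber sums of absolute values dominate the coefficients, and they are summable
      as a regrouping of a summable family.\<close>
    show "(\<lambda>\<omega>. \<Sum>\<^sub>\<infinity>k\<in>{k\<in>K. m k = \<omega>}. cmod (b k)) summable_on UNIV"
      using has_sum_fibers[OF b] has_sum_imp_summable by blast
    show "cmod (fcoeff1 a \<omega>) \<le> (\<Sum>\<^sub>\<infinity>k\<in>{k\<in>K. m k = \<omega>}. cmod (b k))" for \<omega>
      unfolding coeff by (intro norm_infsum_bound summable_on_subset_banach[OF b]) auto
  qed auto
  ultimately show "wiener1 a" by (simp add: wiener1_def)
qed

section \<open>Best term approximation and phase rounding\<close>

text \<open>Greedy choice: a largest remaining entry extends a set of \<open>n\<close> largest
  ones.\<close>

lemma largest_entries_exists:
  assumes J: "finite J"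
  shows "\<exists>S. largest_entries s J y S"
proof -
  have "\<exists>S\<subseteq>J. card S = n \<and> (\<forall>i\<in>S. \<forall>j\<in>J - S. cmod (y j) \<le> cmod (y i))" if "n \<le> card J" for n
    using that
  proof (induction n)
    case 0
    then show ?case by (intro exI[of _ "{}"]) auto
  next
    case (Suc n)
    then obtain S where S: "S \<subseteq> J" "card S = n" "\<And>i j. i \<in> S \<Longrightarrow> j \<in> J - S \<Longrightarrow> cmod (y j) \<le> cmod (y i)"
      by auto
    have "finite (J - S)" "J - S \<noteq> {}" using S Suc.prems J by auto
    then have "Max ((\<lambda>j. cmod (y j)) ` (J - S)) \<in> (\<lambda>j. cmod (y j)) ` (J - S)"
      by (intro Max_in) auto
    then obtain i where i0: "i \<in> J - S" "Max ((\<lambda>j. cmod (y j)) ` (J - S)) = cmod (y i)" by (rule imageE)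
    have i: "i \<in> J - S" "\<And>j. j \<in> J - S \<Longrightarrow> cmod (y j) \<le> cmod (y i)"
      using i0 Max_ge[of "(\<lambda>j. cmod (y j)) ` (J - S)"] \<open>finite (J - S)\<close> by auto
    have "card (insert i S) = Suc n" using S i J finite_subset by (metis DiffD2 card_insert_disjoint)
    then show ?case using S i by (intro exI[of _ "insert i S"]) auto
  qed
  from this[of "min s (card J)"] show ?thesis unfolding largest_entries_def by auto
qed

lemma best_terms_cases:
  assumes "finite J"
  obtains S where "largest_entries s J y S" "best_terms s J y = restr S y"
  using someI_ex[OF largest_entries_exists[OF assms, of s y]] by (auto simp: best_terms_def)

text \<open>Exchange argument: \<open>S\<close> has at least as many elements as \<open>T\<close>,
  so \<open>T - S\<close> injects into \<open>S - T\<close>, and every entry at an index of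
  \<open>S\<close> dominates those outside.\<close>

lemma sum_le_largest_entries:
  assumes J: "finite J" and S: "largest_entries s J y S" and T: "T \<subseteq> J" "card T \<le> s"
  shows "(\<Sum>i\<in>J - S. cmod (y i)) \<le> (\<Sum>i\<in>J - T. cmod (y i))"
proof -
  have SJ: "S \<subseteq> J" and cS: "card S = min s (card J)"
    and top: "\<And>i j. i \<in> S \<Longrightarrow> j \<in> J - S \<Longrightarrow> cmod (y j) \<le> cmod (y i)"
    using S by (auto simp: largest_entries_def)
  have fin: "finite S" "finite T" using J SJ T finite_subset by blast+
  have "card T \<le> card S" using cS T card_mono[OF J T(1)] by simp
  then have "card (T - S) \<le> card (S - T)"
    using fin by (metis card_le_sym_Diff)
  then obtain h where h: "h ` (T - S) \<subseteq> S - T" "inj_on h (T - S)"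
    using card_le_inj fin by (metis finite_Diff)
  have "(\<Sum>i\<in>T - S. cmod (y i)) \<le> (\<Sum>i\<in>T - S. cmod (y (h i)))"
    using top h T by (intro sum_mono) blast
  also have "\<dots> = (\<Sum>i\<in>h ` (T - S). cmod (y i))" using h by (simp add: sum.reindex)
  also have "\<dots> \<le> (\<Sum>i\<in>S - T. cmod (y i))" using h fin by (intro sum_mono2) auto
  finally have "(\<Sum>i\<in>T - S. cmod (y i)) \<le> (\<Sum>i\<in>S - T. cmod (y i))" .
  moreover have "(\<Sum>i\<in>J - S. cmod (y i)) = (\<Sum>i\<in>T - S. cmod (y i)) + (\<Sum>i\<in>J - (S \<union> T). cmod (y i))"
    using J fin T by (subst sum.union_disjoint[symmetric]) (auto intro!: sum.cong)
  moreover have "(\<Sum>i\<in>J - T. cmod (y i)) = (\<Sum>i\<in>S - T. cmod (y i)) + (\<Sum>i\<in>J - (S \<union> T). cmod (y i))"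
    using J fin SJ by (subst sum.union_disjoint[symmetric]) (auto intro!: sum.cong)
  ultimately show ?thesis by simp
qed

lemma l2_norm_finite: "finite J \<Longrightarrow> l2_norm J y = L2_set (\<lambda>i. cmod (y i)) J"
  by (simp add: l2_norm_def L2_set_def)

text \<open>The comparison set \<open>T\<close> is free: later it is the image of at most
  \<open>s\<close> indices from \<open>I\<close>, where the sampled function need not have its
  largest coefficients.\<close>

lemma best_terms_l1_le:
  assumes J: "finite J" and T: "T \<subseteq> J" "card T \<le> s"
  shows "l1_norm J (\<lambda>i. y i - best_terms s J y i) \<le> (\<Sum>i\<in>J - T. cmod (y i))"
proof -
  obtain S where S: "largest_entries s J y S" "best_terms s J y = restr S y"
    by (rule best_terms_cases[OF J])
  have "l1_norm J (\<lambda>i. y i - best_terms s J y i) = (\<Sum>i\<in>J - S. cmod (y i))"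
    unfolding S(2) l1_norm_def using J
    by (auto simp: restr_def infsum_finite intro!: sum.mono_neutral_cong_right)
  then show ?thesis using sum_le_largest_entries[OF J S(1) T] by simp
qed

text \<open>A Stechkin-type estimate. If anything is left over, at least \<open>s\<close> of the
  \<open>2 * s\<close> largest indices lie outside \<open>T\<close>, so each remaining entry is at
  most \<open>q / s\<close>; the squares then sum to at most \<open>q / s\<close> times the l1
  remainder.\<close>

lemma best_terms_l2_le:
  assumes J: "finite J" and T: "T \<subseteq> J" "card T \<le> s" and s: "1 \<le> s"
  shows "l2_norm J (\<lambda>i. y i - best_terms (2 * s) J y i) \<le> (\<Sum>i\<in>J - T. cmod (y i)) / sqrt (real s)"
proof -
  define q where "q = (\<Sum>i\<in>J - T. cmod (y i))"
  have q: "0 \<le> q" by (simp add: q_def sum_nonneg)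
  obtain S where S: "largest_entries (2 * s) J y S" "best_terms (2 * s) J y = restr S y"
    by (rule best_terms_cases[OF J])
  have SJ: "S \<subseteq> J" and cS: "card S = min (2 * s) (card J)"
    and top: "\<And>i j. i \<in> S \<Longrightarrow> j \<in> J - S \<Longrightarrow> cmod (y j) \<le> cmod (y i)"
    using S by (auto simp: largest_entries_def)
  have fin: "finite S" "finite T" using J SJ T finite_subset by blast+
  have entry: "cmod (y j) \<le> q / s" if j: "j \<in> J - S" for j
  proof -
    \<comment> \<open>A leftover index \<open>j\<close> makes \<open>S\<close> a proper subset of
      \<open>J\<close>, hence of size exactly \<open>2 * s\<close>.\<close>
    have "card S \<noteq> card J" using j SJ J card_subset_eq by blast
    then have "s \<le> card (S - T)" using cS T fin diff_card_le_card_Diff[of T S] by linarith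
    then have "real s * cmod (y j) \<le> real (card (S - T)) * cmod (y j)"
      by (intro mult_right_mono) auto
    also have "\<dots> \<le> (\<Sum>i\<in>S - T. cmod (y i))" using top[OF _ j] by (intro sum_bounded_below) auto
    also have "\<dots> \<le> q" unfolding q_def using J SJ by (intro sum_mono2) auto
    finally show ?thesis using s by (simp add: field_simps)
  qed
  have "l2_norm J (\<lambda>i. y i - best_terms (2 * s) J y i) = sqrt (\<Sum>i\<in>J - S. (cmod (y i))\<^sup>2)"
    unfolding S(2) l2_norm_def using J
    by (auto simp: restr_def infsum_finite intro!: sum.mono_neutral_cong_right)
  also have "(\<Sum>i\<in>J - S. (cmod (y i))\<^sup>2) \<le> (\<Sum>i\<in>J - S. q / s * cmod (y i))"
    unfolding power2_eq_square by (intro sum_mono mult_right_mono entry) auto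
  also have "\<dots> = q / s * (\<Sum>i\<in>J - S. cmod (y i))" by (simp add: sum_distrib_left)
  also have "\<dots> \<le> q / s * q"
    unfolding q_def using T s
    by (intro mult_left_mono sum_le_largest_entries[OF J S(1)]) (auto simp: sum_nonneg)
  finally have "l2_norm J (\<lambda>i. y i - best_terms (2 * s) J y i) \<le> sqrt (q / s * q)" by simp
  also have "\<dots> = q / sqrt (real s)" using q by (simp add: real_sqrt_divide)
  finally show ?thesis by (simp add: q_def)
qed

section \<open>Residues in the band and rounding of phases\<close>

lemma band_eq: "band n = {1 - int ((n + 1) div 2) .. int (n div 2)}"
proof -
  have "\<lfloor>real n / 2\<rfloor> = int (n div 2)"
    using floor_divide_of_nat_eq[of n 2, where ?'a = real] by simp
  moreover have "\<lceil>real n / 2\<rceil> = int ((n + 1) div 2)"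
    by (cases "even n") (auto elim!: evenE oddE intro!: ceiling_unique)
  ultimately show ?thesis by (auto simp: band_def)
qed

lemma finite_band: "finite (band n)"
  by (simp add: band_eq)

lemma band_cong_unique:
  assumes "r \<in> band n" "r' \<in> band n" "[r = r'] (mod int n)"
  shows "r = r'"
proof (rule ccontr)
  assume "r \<noteq> r'"
  then have "int n \<le> \<bar>r - r'\<bar>"
    using assms(3) dvd_imp_le_int[of "r - r'" "int n"] by (simp add: cong_iff_dvd_diff)
  moreover have "\<bar>r - r'\<bar> < int n" using assms(1,2) by (auto simp: band_eq)
  ultimately show False by simp
qed

lemma centered_mod_eq:
  assumes "r \<in> band N" "[r = m] (mod int N)"
  shows "centered_mod N m = r"
  unfolding centered_mod_def
  by (rule the_equality) (use assms band_cong_unique in \<open>auto simp: cong_def\<close>)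

lemma centered_mod_in_band:
  assumes "1 \<le> N"
  shows "centered_mod N m \<in> band N"
proof -
  \<comment> \<open>The band is the interval from \<open>- h\<close> to \<open>N - 1 - h\<close>;
    adding \<open>h\<close> turns it into the standard residues.\<close>
  define h where "h = int ((N + 1) div 2) - 1"
  define r where "r = (m + h) mod int N - h"
  have "0 \<le> (m + h) mod int N" "(m + h) mod int N < int N" using assms by auto
  moreover have "int N - 1 - h = int (N div 2)" by (simp add: h_def)
  ultimately have "r \<in> band N" by (auto simp: band_eq r_def h_def)
  moreover have "[r = m] (mod int N)"
    unfolding r_def cong_def by (metis add_diff_cancel_right' mod_diff_left_eq)
  ultimately show ?thesis using centered_mod_eq by metis
qed

text \<open>This is where the constant 3 in front of \<open>N\<close> and the condition \<open>6 \<le> N\<close> come from.\<close>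

lemma sin_pi_div_ge:
  assumes "6 \<le> N"
  shows "3 / real N \<le> sin (pi / real N)"
proof -
  have "convex_on {0..pi} (\<lambda>x. - sin x)"
    by (rule f''_ge0_imp_convex[where f' = "\<lambda>x. - cos x" and f'' = sin])
       (auto intro!: derivative_eq_intros sin_ge_zero)
  \<comment> \<open>This is the chord of the sine from 0 to \<open>pi / 6\<close>, where its value
    is 1/2, taken at the fraction \<open>6 / N\<close> of the way.\<close>
  from convex_onD[OF this, of "6 / real N" 0 "pi / 6"] assms
  show ?thesis by (simp add: sin_30 field_simps)
qed

text \<open>After division by the ideal phase the quotient \<open>p\<close> lies within
  \<open>3 / N \<le> sin (pi / N)\<close> of 1, so its angle is below \<open>pi / N\<close>, half
  the spacing of the admissible phases. \<open>Arg\<close> may wrap around; this adds a multiple of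
  \<open>N\<close>, which \<open>centered_mod\<close> removes.\<close>

lemma round_phase:
  assumes N: "6 \<le> N" and \<kappa>: "\<kappa> \<in> band N" and v: "v \<noteq> 0"
    and close: "cmod (w - cis (2 * pi * real_of_int \<kappa> / real N) * v) < 3 / real N * cmod v"
  shows "centered_mod N (round (real N * Arg (w / v) / (2 * pi))) = \<kappa>"
proof -
  define \<theta> where "\<theta> = 2 * pi * real_of_int \<kappa> / real N"
  define q where "q = w / v"
  define p where "p = q * cis (- \<theta>)"
  have "p - 1 = (w - cis \<theta> * v) / v * cis (- \<theta>)"
    using v by (simp add: p_def q_def diff_divide_distrib left_diff_distrib cis_mult)
  then have "cmod (p - 1) = cmod (w - cis \<theta> * v) / cmod v" by (simp add: norm_mult norm_divide)
  also have "\<dots> < 3 / real N" using close v by (simp add: \<theta>_def field_simps)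
  finally have p1: "cmod (p - 1) < 3 / real N" .
  also have "3 / real N \<le> 1 / 2" using N by (simp add: field_simps)
  finally have Rep: "0 < Re p" using abs_Re_le_cmod[of "p - 1"] by simp
  then have p0: "p \<noteq> 0" by auto
  define \<phi> where "\<phi> = Arg p"
  have polar: "p = cmod p * cis \<phi>"
    using p0 by (simp add: \<phi>_def cis_Arg sgn_eq)
  \<comment> \<open>Turning \<open>p\<close> onto the positive axis shows that 1 has distance at
    least |sin \<phi>| from the ray of angle \<phi>.\<close>
  have "cmod (p - 1) = cmod ((p - 1) * cis (- \<phi>))" by (simp add: norm_mult)
  also have "(p - 1) * cis (- \<phi>) = cmod p - cis (- \<phi>)"
    by (subst polar) (simp add: left_diff_distrib cis_mult mult.assoc)
  finally have "\<bar>sin \<phi>\<bar> \<le> cmod (p - 1)" using abs_Im_le_cmod[of "cmod p - cis (- \<phi>)"] by simp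
  then have sin: "\<bar>sin \<phi>\<bar> < sin (pi / real N)" using p1 sin_pi_div_ge[OF N] by linarith
  \<comment> \<open>The sine is small near \<open>pi\<close> as well; the positive real part of
    \<open>p\<close> excludes those angles.\<close>
  have "0 < cos \<phi>" using Rep polar p0
    by (metis Re_complex_of_real cis.simps(1) mult_pos_pos norm_ge_zero times_complex.simps(1)
        Im_complex_of_real mult_zero_left diff_zero zero_less_mult_pos zero_less_norm_iff)
  have \<phi>range: "- pi < \<phi>" "\<phi> \<le> pi" using Arg_bounded[of p] by (auto simp: \<phi>_def)
  have half: "\<bar>\<phi>\<bar> \<le> pi / 2"
  proof (rule ccontr)
    assume "\<not> \<bar>\<phi>\<bar> \<le> pi / 2"
    then have "cos \<bar>\<phi>\<bar> \<le> 0"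
      using cos_monotone_0_pi_le[of "pi / 2" "\<bar>\<phi>\<bar>"] \<phi>range by auto
    then show False using \<open>0 < cos \<phi>\<close> by (simp add: cos_abs_real)
  qed
  have "\<bar>\<phi>\<bar> < pi / real N"
  proof (rule ccontr)
    assume "\<not> \<bar>\<phi>\<bar> < pi / real N"
    then have "sin (pi / real N) \<le> sin \<bar>\<phi>\<bar>"
    proof (intro sin_monotone_2pi_le half)
      show "- (pi / 2) \<le> pi / real N" by (rule order_trans[of _ 0]) auto
    qed simp
    then show False using sin by (cases "0 \<le> \<phi>") auto
  qed
  then have small: "\<bar>real N * \<phi> / (2 * pi)\<bar> < 1 / 2"
    using N by (simp add: field_simps abs_mult)
  have q0: "q \<noteq> 0" using p0 by (auto simp: p_def)
  have "q = p * cis \<theta>" by (simp add: p_def cis_mult mult.assoc)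
  then have "q = cmod p * cis (\<phi> + \<theta>)" by (subst (asm) polar) (simp add: cis_mult mult.assoc)
  then have "sgn q = cis (\<phi> + \<theta>)" using p0 by (simp add: sgn_eq norm_mult)
  then have "cis (Arg q) = cis (\<phi> + \<theta>)" using q0 by (simp add: cis_Arg)
  then have "Arg q / (2 * pi) - (\<phi> + \<theta>) / (2 * pi) \<in> \<int>" by (intro cis_eqD) simp
  then obtain n where n: "Arg q / (2 * pi) - (\<phi> + \<theta>) / (2 * pi) = real_of_int n" by (auto elim: Ints_cases)
  have "real N * Arg q / (2 * pi) - real_of_int (\<kappa> + int N * n) = real N * \<phi> / (2 * pi)"
  proof -
    have "Arg q / (2 * pi) = (\<phi> + \<theta>) / (2 * pi) + real_of_int n"
      using n by linarith
    then have "real N * (Arg q / (2 * pi)) = real N * ((\<phi> + \<theta>) / (2 * pi) + real_of_int n)"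
      by (rule arg_cong)
    also have "\<dots> = real N * \<phi> / (2 * pi) + \<kappa> + real N * n"
      using N by (simp add: \<theta>_def field_simps)
    finally show ?thesis by simp
  qed
  then have "round (real N * Arg q / (2 * pi)) = \<kappa> + int N * n"
    using small by (intro round_unique') (simp add: abs_minus_commute)
  then show ?thesis using \<kappa> by (simp add: q_def centered_mod_eq cong_def)
qed

section \<open>Minkowski's inequality and summability of squares\<close>

lemma l2_norm_triangle:
  assumes x: "(\<lambda>i. (cmod (x i))\<^sup>2) summable_on J" and y: "(\<lambda>i. (cmod (y i))\<^sup>2) summable_on J"
  shows "l2_norm J (\<lambda>i. x i + y i) \<le> l2_norm J x + l2_norm J y"
proof -
  have L2: "L2_set (\<lambda>i. cmod (x i)) F \<le> l2_norm J x" if "(\<lambda>i. (cmod (x i))\<^sup>2) summable_on J" "finite F" "F \<subseteq> J" for F x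
    unfolding L2_set_def l2_norm_def using that
    by (intro real_sqrt_le_mono finite_sum_le_infsum) auto
  have nn: "0 \<le> l2_norm J x" for x by (simp add: l2_norm_def infsum_nonneg)
  have fin: "(\<Sum>i\<in>F. (cmod (x i + y i))\<^sup>2) \<le> (l2_norm J x + l2_norm J y)\<^sup>2" if F: "finite F" "F \<subseteq> J" for F
  proof -
    have "L2_set (\<lambda>i. cmod (x i + y i)) F \<le> L2_set (\<lambda>i. cmod (x i) + cmod (y i)) F"
      by (intro L2_set_mono norm_triangle_ineq) auto
    also have "\<dots> \<le> L2_set (\<lambda>i. cmod (x i)) F + L2_set (\<lambda>i. cmod (y i)) F" by (rule L2_set_triangle_ineq)
    also have "\<dots> \<le> l2_norm J x + l2_norm J y" using L2 x y F by (intro add_mono) auto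
    finally have "(L2_set (\<lambda>i. cmod (x i + y i)) F)\<^sup>2 \<le> (l2_norm J x + l2_norm J y)\<^sup>2"
      by (intro power_mono) auto
    then show ?thesis by (simp add: L2_set_def sum_nonneg)
  qed
  have "(\<Sum>\<^sub>\<infinity>i\<in>J. (cmod (x i + y i))\<^sup>2) \<le> (l2_norm J x + l2_norm J y)\<^sup>2"
  proof (rule infsum_le_finite_sums[OF _ fin])
    show "(\<lambda>i. (cmod (x i + y i))\<^sup>2) summable_on J"
      by (rule nonneg_bdd_above_summable_on) (use fin in \<open>auto intro!: bdd_aboveI2\<close>)
  qed
  then have "l2_norm J (\<lambda>i. x i + y i) \<le> sqrt ((l2_norm J x + l2_norm J y)\<^sup>2)"
    unfolding l2_norm_def by (rule real_sqrt_le_mono)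
  then show ?thesis using nn by simp
qed

lemma square_summable:
  fixes x :: "'i \<Rightarrow> complex"
  assumes x: "(\<lambda>i. cmod (x i)) summable_on J"
  shows "(\<lambda>i. (cmod (x i))\<^sup>2) summable_on J"
proof (rule summable_on_comparison_test)
  show "(\<lambda>i. (\<Sum>\<^sub>\<infinity>i\<in>J. cmod (x i)) * cmod (x i)) summable_on J"
    by (rule summable_on_cmult_right[OF x])
  show "(cmod (x i))\<^sup>2 \<le> (\<Sum>\<^sub>\<infinity>i\<in>J. cmod (x i)) * cmod (x i)" if "i \<in> J" for i
    unfolding power2_eq_square
    using finite_sum_le_infsum[OF x, of "{i}"] that by (intro mult_right_mono) auto
qed auto

section \<open>Output and cost of the phase encoding program\<close>

lemma result_bind [simp]: "result F (bind_prog p g) = result F (g (result F p))"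
  by (induction p) auto

lemma samples_bind [simp]: "samples F (bind_prog p g) = samples F p + samples F (g (result F p))"
  by (induction p) auto

lemma operations_bind [simp]:
  "operations F (bind_prog p g) = operations F p + operations F (g (result F p))"
  by (induction p) auto

lemma result_map [simp]: "result F (map_prog g h p) = h (result (\<lambda>q. F (g q)) p)"
  by (induction p) auto

lemma samples_map [simp]: "samples F (map_prog g h p) = samples (\<lambda>q. F (g q)) p"
  by (induction p) auto

lemma operations_map [simp]: "operations F (map_prog g h p) = operations (\<lambda>q. F (g q)) p"
  by (induction p) auto

lemma op_simps [simp]: "result F (op x) = x" "samples F (op x) = 0" "operations F (op x) = 1"
  by (simp_all add: op_def)

lemma result_for_each [simp]:
  "result F (for_each xs body st) = fold (\<lambda>x st. result F (body x st)) xs st"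
  by (induction xs arbitrary: st) auto

lemma samples_for_each_le:
  assumes "\<And>x st. x \<in> set xs \<Longrightarrow> samples F (body x st) \<le> c"
  shows "samples F (for_each xs body st) \<le> length xs * c"
  using assms
proof (induction xs arbitrary: st)
  case (Cons x xs)
  have "samples F (for_each xs body (result F (body x st))) \<le> length xs * c"
    using Cons.IH Cons.prems by simp
  moreover have "samples F (body x st) \<le> c" using Cons.prems by simp
  ultimately show ?case by simp
qed simp

lemma samples_for_each_zero:
  assumes "\<And>x st. x \<in> set xs \<Longrightarrow> samples F (body x st) = 0"
  shows "samples F (for_each xs body st) = 0"
  using samples_for_each_le[of xs F body 0] assms by simp

lemma operations_for_each_le:
  assumes "\<And>x st. x \<in> set xs \<Longrightarrow> operations F (body x st) \<le> c"
  shows "operations F (for_each xs body st) \<le> length xs * (c + 1)"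
  using assms
proof (induction xs arbitrary: st)
  case (Cons x xs)
  have "operations F (for_each xs body (result F (body x st))) \<le> length xs * (c + 1)"
    using Cons.IH Cons.prems by simp
  moreover have "operations F (body x st) \<le> c" using Cons.prems by simp
  ultimately show ?case by simp
qed simp

section \<open>Decoding and accumulating a single frequency\<close>

definition phase_value ::
  "nat \<Rightarrow> (nat \<Rightarrow> int \<Rightarrow> int) \<Rightarrow> (int \<Rightarrow> complex) \<Rightarrow> (nat \<Rightarrow> int \<Rightarrow> complex) \<Rightarrow> int \<Rightarrow> nat \<Rightarrow> int" where
  "phase_value N dflt v w \<omega> l = centered_mod N
     (if w l \<omega> = 0 then dflt l \<omega> else round (real N * Arg (w l \<omega> / v \<omega>) / (2 * pi)))"

lemma result_phase_coord [simp]: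
  "result F (phase_coord N dflt v w \<omega> l) = phase_value N dflt v w \<omega> l"
  by (simp add: phase_coord_def phase_value_def)

lemma samples_phase_coord [simp]: "samples F (phase_coord N dflt v w \<omega> l) = 0"
  by (simp add: phase_coord_def)

lemma operations_phase_coord_le: "operations F (phase_coord N dflt v w \<omega> l) \<le> 9"
  by (simp add: phase_coord_def)

lemma fold_fun_upd:
  "fold (\<lambda>l k. k(l := g l)) [0..<d] k0 = (\<lambda>l. if l < d then g l else k0 l)"
  by (induction d) (auto simp: fun_eq_iff less_Suc_eq)

lemma result_compute_dot [simp]: "result F (compute_dot d k z) = dot d k z"
proof -
  have "fold (\<lambda>l acc. acc + k l * z l) [0..<d] 0 = (\<Sum>l<d. k l * z l)" by (induction d) auto
  then show ?thesis by (simp add: compute_dot_def dot_def)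
qed

definition decode ::
  "nat \<Rightarrow> nat \<Rightarrow> (nat \<Rightarrow> int \<Rightarrow> int) \<Rightarrow> (int \<Rightarrow> complex) \<Rightarrow> (nat \<Rightarrow> int \<Rightarrow> complex) \<Rightarrow> int \<Rightarrow> nat \<Rightarrow> int" where
  "decode d N dflt v w \<omega> = (\<lambda>l\<in>{..<d}. phase_value N dflt v w \<omega> l)"

lemma result_process_frequency [simp]:
  "result F (process_frequency d N z dflt v w \<omega> b) =
    (let k = decode d N dflt v w \<omega> in if dot d k z = \<omega> then b(k := b k + v \<omega>) else b)"
proof -
  have "result F (for_each [0..<d] (\<lambda>l k. phase_coord N dflt v w \<omega> l \<bind> (\<lambda>m. op (k(l := m)))) (\<lambda>_. undefined))
      = decode d N dflt v w \<omega>"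
    by (simp add: fold_fun_upd decode_def restrict_def)
  then show ?thesis
    unfolding process_frequency_def Let_def by (simp del: result_for_each)
qed

lemma samples_process_frequency [simp]: "samples F (process_frequency d N z dflt v w \<omega> b) = 0"
proof -
  have "samples F (for_each [0..<d] (\<lambda>l k. phase_coord N dflt v w \<omega> l \<bind> (\<lambda>m. op (k(l := m)))) (\<lambda>_. undefined)) = 0"
    by (rule samples_for_each_zero) simp
  moreover have "samples F (compute_dot d k z) = 0" for k
    unfolding compute_dot_def by (rule samples_for_each_zero) simp
  moreover have "samples F (address d) = 0"
    unfolding address_def by (rule samples_for_each_zero) simp
  ultimately show ?thesis by (simp add: process_frequency_def del: result_for_each)
qed

text \<open>Loop steps included, each coordinate costs 11 operations for decoding, 3 for the product
  with \<open>z\<close> and 1 for addressing; five more do not depend on \<open>d\<close>. Since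
  \<open>1 \<le> d\<close>, \<open>15 * d + 5 \<le> 20 * d\<close>.\<close>

lemma operations_process_frequency_le:
  assumes "1 \<le> d"
  shows "operations F (process_frequency d N z dflt v w \<omega> b) \<le> 20 * d"
proof -
  have 1: "operations F (for_each [0..<d] (\<lambda>l k. phase_coord N dflt v w \<omega> l \<bind> (\<lambda>m. op (k(l := m)))) (\<lambda>_. undefined))
      \<le> d * 11"
    by (rule order_trans[OF operations_for_each_le[where c = 10]]) (simp_all add: operations_phase_coord_le)
  have 2: "operations F (compute_dot d k z) \<le> d * 3" for k
    unfolding compute_dot_def by (rule order_trans[OF operations_for_each_le[where c = 2]]) simp_all
  have 3: "operations F (address d) \<le> d"
    unfolding address_def by (rule order_trans[OF operations_for_each_le[where c = 0]]) simp_all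
  let ?k = "result F (for_each [0..<d] (\<lambda>l k. phase_coord N dflt v w \<omega> l \<bind> (\<lambda>m. op (k(l := m)))) (\<lambda>_. undefined))"
  have "operations F (process_frequency d N z dflt v w \<omega> b) \<le> d * 11 + operations F (compute_dot d ?k z) + 1 + (operations F (address d) + 4)"
    unfolding process_frequency_def using 1 by (simp del: result_for_each)
  then show ?thesis using 2[of ?k] 3 assms by linarith
qed

text \<open>Index 0 is the unshifted line and \<open>Suc l\<close> the shift in coordinate
  \<open>l\<close>, the numbering of the sample requests, so that one index covers all
  \<open>d + 1\<close> transforms.\<close>

definition sample_point :: "nat \<Rightarrow> nat \<Rightarrow> (nat \<Rightarrow> int) \<Rightarrow> nat \<Rightarrow> real \<Rightarrow> nat \<Rightarrow> real" where
  "sample_point d N z i t = (case i of 0 \<Rightarrow> line d z t | Suc l \<Rightarrow> shift l (1 / real N) (line d z t))"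

definition sampled ::
  "nat \<Rightarrow> nat \<Rightarrow> (nat \<Rightarrow> int) \<Rightarrow> (request \<Rightarrow> complex) \<Rightarrow> nat \<Rightarrow> real \<Rightarrow> complex" where
  "sampled d N z F i = (\<lambda>t. F (i, sample_point d N z i t))"

text \<open>The cell \<open>k\<close> can only change when \<open>\<omega> = m k\<close>, and a
  distinct list contains this value at most once. So no cell accumulates several
  coefficients.\<close>

lemma fold_collect:
  assumes "distinct xs"
  shows "fold (\<lambda>\<omega> b. let k = K \<omega> in if m k = \<omega> then b(k := b k + v \<omega>) else b) xs b0 k
    = b0 k + (if m k \<in> set xs \<and> K (m k) = k then v (m k) else (0::complex))"
  using assms
proof (induction xs arbitrary: b0)
  case (Cons \<omega> xs)
  let ?f = "\<lambda>\<omega> b. let k = K \<omega> in if m k = \<omega> then b(k := b k + v \<omega>) else b"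
  have "?f \<omega> b0 k = b0 k + (if m k = \<omega> \<and> K \<omega> = k then v \<omega> else 0)"
    by (cases "K \<omega> = k") (auto simp: Let_def)
  moreover have "fold ?f xs (?f \<omega> b0) k
      = ?f \<omega> b0 k + (if m k \<in> set xs \<and> K (m k) = k then v (m k) else 0)"
    using Cons by simp
  ultimately show ?case using Cons.prems by (cases "m k = \<omega>") (auto simp del: Let_def)
qed simp

text \<open>The entry at \<open>k\<close> depends only on what is decoded at the single frequency
  \<open>dot d k z\<close>. From \<open>d\<close> on, \<open>w\<close> keeps the zero it was
  initialized with.\<close>

lemma phase_encoding_result:
  fixes P :: "nat \<Rightarrow> sft" and F :: "request \<Rightarrow> complex" and d N :: nat and z :: "nat \<Rightarrow> int"
  defines "v \<equiv> result (sampled d N z F 0) (P 0)"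
  defines "w \<equiv> \<lambda>l. if l < d then result (sampled d N z F (Suc l)) (P (Suc l)) else (\<lambda>_. 0)"
  assumes fin: "finite (supp v)"
  shows "result F (phase_encoding d N z dflt P) =
    (\<lambda>k. if dot d k z \<in> supp v \<and> decode d N dflt v w (dot d k z) = k then v (dot d k z) else 0)"
proof -
  have *: "result F (phase_encoding d N z dflt P) =
      fold (\<lambda>\<omega> b. let k = decode d N dflt v w \<omega> in if dot d k z = \<omega> then b(k := b k + v \<omega>) else b)
        (sorted_list_of_set (supp v)) (\<lambda>_. 0)"
    unfolding v_def w_def
    by (simp add: phase_encoding_def fold_fun_upd Let_def sampled_def sample_point_def cong: if_cong)
  show ?thesis
    unfolding * using fin
    by (simp add: fun_eq_iff fold_collect[where m = "\<lambda>k. dot d k z" and K = "decode d N dflt v w"])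
qed

lemma phase_encoding_samples_le:
  fixes P :: "nat \<Rightarrow> sft" and F :: "request \<Rightarrow> complex" and d N :: nat and z :: "nat \<Rightarrow> int"
  assumes "samples (sampled d N z F 0) (P 0) \<le> c"
    and "\<And>l. l < d \<Longrightarrow> samples (sampled d N z F (Suc l)) (P (Suc l)) \<le> c"
  shows "samples F (phase_encoding d N z dflt P) \<le> (d + 1) * c"
proof -
  have "samples F (for_each xs (process_frequency d N z dflt v w) b) = 0" for xs v w b
    by (rule samples_for_each_zero) simp
  moreover have "samples F (for_each [0..<d] (\<lambda>l w.
        map_prog (\<lambda>t. (Suc l, shift l (1 / real N) (line d z t))) id (P (Suc l)) \<bind> (\<lambda>vl. op (w(l := vl)))) w) \<le> d * c" for w
    by (rule order_trans[OF samples_for_each_le[where c = c]])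
       (use assms(2) in \<open>simp_all add: sampled_def sample_point_def\<close>)
  ultimately show ?thesis
    using assms(1) by (simp add: phase_encoding_def sampled_def sample_point_def add_mono del: result_for_each)
qed

text \<open>Each shifted transform is charged two more operations, for storing it and for the loop
  step. A frequency takes \<open>20 * d + 1 \<le> 21 * d\<close>, loop step included.\<close>

lemma phase_encoding_operations_le:
  fixes P :: "nat \<Rightarrow> sft" and F :: "request \<Rightarrow> complex" and d N :: nat and z :: "nat \<Rightarrow> int"
  assumes d: "1 \<le> d" and "operations (sampled d N z F 0) (P 0) \<le> c"
    and "\<And>l. l < d \<Longrightarrow> operations (sampled d N z F (Suc l)) (P (Suc l)) \<le> c"
    and fin: "finite (supp (result (sampled d N z F 0) (P 0)))"
    and card: "card (supp (result (sampled d N z F 0) (P 0))) \<le> m"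
  shows "operations F (phase_encoding d N z dflt P) \<le> (d + 1) * (c + 2) + m * (21 * d)"
proof -
  let ?v = "result (sampled d N z F 0) (P 0)"
  let ?loop = "for_each [0..<d] (\<lambda>l w.
      map_prog (\<lambda>t. (Suc l, shift l (1 / real N) (line d z t))) id (P (Suc l)) \<bind> (\<lambda>vl. op (w(l := vl))))"
  have "operations F (for_each (sorted_list_of_set (supp ?v)) (process_frequency d N z dflt ?v w) b) \<le> m * (21 * d)" for w b
  proof -
    have "operations F (for_each (sorted_list_of_set (supp ?v)) (process_frequency d N z dflt ?v w) b)
        \<le> card (supp ?v) * (20 * d + 1)"
      by (rule order_trans[OF operations_for_each_le[where c = "20 * d"]])
         (simp_all add: operations_process_frequency_le[OF d])
    also have "\<dots> \<le> m * (21 * d)" using card d by (intro mult_mono) auto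
    finally show ?thesis .
  qed
  moreover have "operations F (?loop w) \<le> d * (c + 2)" for w
    by (rule order_trans[OF operations_for_each_le[where c = "c + 1"]])
       (use assms(3) in \<open>simp_all add: sampled_def sample_point_def\<close>)
  moreover have "operations F (phase_encoding d N z dflt P)
      = operations (sampled d N z F 0) (P 0) + (operations F (?loop (\<lambda>_ _. 0))
        + operations F (for_each (sorted_list_of_set (supp ?v))
            (process_frequency d N z dflt ?v (result F (?loop (\<lambda>_ _. 0)))) (\<lambda>_. 0)))"
    by (simp add: phase_encoding_def sampled_def sample_point_def del: result_for_each)
  ultimately have "operations F (phase_encoding d N z dflt P) \<le> c + (d * (c + 2) + m * (21 * d))"
    using assms(2) by (simp only: add_mono)
  then show ?thesis by simp
qed

section \<open>Error analysis\<close>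

lemma fiber_of_inj:
  assumes "inj_on m I" "k \<in> I"
  shows "{j\<in>I. m j = m k} = {k}"
  using assms by (auto dest: inj_onD)

text \<open>Functions are left behind here: the analysis concerns a summable sequence
  \<open>c\<close>. \<open>S\<close> stands for the leading indices of \<open>I\<close>, but until
  the estimate is assembled only its size matters.\<close>

locale sparse_setup =
  fixes d N s L :: nat and z :: "nat \<Rightarrow> int" and I S :: "(nat \<Rightarrow> int) set"
    and c :: "(nat \<Rightarrow> int) \<Rightarrow> complex" and e :: real
  assumes N: "6 \<le> N" and s: "1 \<le> s" and I: "finite I" "I \<subseteq> band_d d N"
    and inj: "inj_on (\<lambda>k. dot d k z) I" and I_band: "\<And>k. k \<in> I \<Longrightarrow> dot d k z \<in> band L"
    and S: "S \<subseteq> I" "card S \<le> s"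
    and c: "(\<lambda>k. cmod (c k)) summable_on Zd d" and e: "0 \<le> e"
begin

text \<open>\<open>u\<close> is the factor of modulus 1 by which a shift multiplies the coefficients
  (constantly 1 without a shift), so one argument serves all transforms.\<close>

definition coeff :: "((nat \<Rightarrow> int) \<Rightarrow> complex) \<Rightarrow> int \<Rightarrow> complex" where
  "coeff u \<omega> = (\<Sum>\<^sub>\<infinity>k\<in>{k\<in>Zd d. dot d k z = \<omega>}. c k * u k)"

definition main_part :: "((nat \<Rightarrow> int) \<Rightarrow> complex) \<Rightarrow> int \<Rightarrow> complex" where
  "main_part u \<omega> = (\<Sum>k\<in>{k\<in>I. dot d k z = \<omega>}. c k * u k)"

definition aliasing :: "int \<Rightarrow> real" where
  "aliasing \<omega> = (\<Sum>\<^sub>\<infinity>k\<in>{k\<in>Zd d - I. dot d k z = \<omega>}. cmod (c k))"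

definition aliasing_total :: real where
  "aliasing_total = (\<Sum>\<^sub>\<infinity>k\<in>Zd d - I. cmod (c k))"

definition tail :: real where
  "tail = (\<Sum>k\<in>I - S. cmod (c k))"

text \<open>This will bound every \<open>sft_error\<close>, and \<open>sqrt (real s) * err\<close>
  is the bracket of \<open>error_estimate\<close>.\<close>

definition err :: real where
  "err = tail / real s + aliasing_total + e"

lemma I_Zd: "I \<subseteq> Zd d"
  using I(2) by (auto simp: band_d_def Zd_def PiE_iff)

lemma aliasing_has_sum: "(aliasing has_sum aliasing_total) UNIV"
  unfolding aliasing_def aliasing_total_def
  using has_sum_fibers[OF summable_on_subset_banach[OF c], of "Zd d - I" "\<lambda>k. dot d k z"] by auto

lemma aliasing_nonneg: "0 \<le> aliasing \<omega>"
  by (simp add: aliasing_def infsum_nonneg)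

lemma aliasing_sum_le: "finite F \<Longrightarrow> sum aliasing F \<le> aliasing_total"
  using aliasing_has_sum aliasing_nonneg
  by (metis finite_sum_le_has_sum UNIV_I subset_UNIV)

lemma nonneg: "0 \<le> tail" "0 \<le> aliasing_total" "0 \<le> err" "aliasing_total \<le> err"
proof -
  show "0 \<le> tail" "0 \<le> aliasing_total" by (auto simp: tail_def aliasing_total_def sum_nonneg infsum_nonneg)
  then show "0 \<le> err" "aliasing_total \<le> err" using e by (auto simp: err_def)
qed

lemma main_part_single:
  assumes "k \<in> I"
  shows "main_part u (dot d k z) = c k * u k"
  unfolding main_part_def fiber_of_inj[OF inj assms] by simp

lemma main_part_empty: "\<omega> \<notin> (\<lambda>k. dot d k z) ` I \<Longrightarrow> main_part u \<omega> = 0"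
  unfolding main_part_def by (intro sum.neutral) auto

lemma coeff_main_part:
  assumes u: "\<And>k. cmod (u k) = 1"
  shows "cmod (coeff u \<omega> - main_part u \<omega>) \<le> aliasing \<omega>"
proof -
  let ?A = "{k\<in>I. dot d k z = \<omega>}" and ?B = "{k\<in>Zd d - I. dot d k z = \<omega>}"
  have abs: "(\<lambda>k. norm (c k * u k)) summable_on ?B"
    using summable_on_subset_banach[OF c, of ?B] u by (auto simp: norm_mult)
  have "{k\<in>Zd d. dot d k z = \<omega>} = ?A \<union> ?B" using I_Zd by auto
  then have "coeff u \<omega> = (\<Sum>\<^sub>\<infinity>k\<in>?A \<union> ?B. c k * u k)" by (simp add: coeff_def)
  also have "\<dots> = (\<Sum>\<^sub>\<infinity>k\<in>?A. c k * u k) + (\<Sum>\<^sub>\<infinity>k\<in>?B. c k * u k)"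
    by (rule infsum_Un_disjoint) (use I abs_summable_summable[OF abs] in auto)
  also have "(\<Sum>\<^sub>\<infinity>k\<in>?A. c k * u k) = main_part u \<omega>" using I by (simp add: main_part_def)
  finally have "coeff u \<omega> - main_part u \<omega> = (\<Sum>\<^sub>\<infinity>k\<in>?B. c k * u k)" by simp
  also have "cmod \<dots> \<le> (\<Sum>\<^sub>\<infinity>k\<in>?B. norm (c k * u k))" by (rule norm_infsum_bound[OF abs])
  also have "\<dots> = aliasing \<omega>" using u by (simp add: aliasing_def norm_mult)
  finally show ?thesis .
qed

text \<open>Off the image of \<open>S\<close>, the nonzero main parts are up to phase the
  \<open>c k\<close> with \<open>k \<in> I - S\<close>, one per frequency by injectivity; everything
  else is aliasing.\<close>

lemma coeff_tail_le:
  assumes u: "\<And>k. cmod (u k) = 1"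
  shows "(\<Sum>\<omega>\<in>band L - (\<lambda>k. dot d k z) ` S. cmod (coeff u \<omega>)) \<le> tail + sum aliasing (band L)"
proof -
  let ?m = "\<lambda>k. dot d k z"
  have "cmod (coeff u \<omega>) \<le> cmod (main_part u \<omega>) + aliasing \<omega>" for \<omega>
    using coeff_main_part[of u \<omega>, OF u] norm_triangle_ineq2[of "coeff u \<omega>" "main_part u \<omega>"] by linarith
  then have "(\<Sum>\<omega>\<in>band L - ?m ` S. cmod (coeff u \<omega>))
      \<le> (\<Sum>\<omega>\<in>band L - ?m ` S. cmod (main_part u \<omega>)) + sum aliasing (band L - ?m ` S)"
    unfolding sum.distrib[symmetric] by (rule sum_mono)
  also have "(\<Sum>\<omega>\<in>band L - ?m ` S. cmod (main_part u \<omega>)) = (\<Sum>\<omega>\<in>?m ` (I - S). cmod (main_part u \<omega>))"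
  proof (rule sum.mono_neutral_right)
    show "?m ` (I - S) \<subseteq> band L - ?m ` S"
      using I_band S inj by (auto dest: inj_onD)
    show "\<forall>\<omega>\<in>band L - ?m ` S - ?m ` (I - S). cmod (main_part u \<omega>) = 0"
      by (auto intro!: main_part_empty)
  qed (simp add: finite_band)
  also have "\<dots> = (\<Sum>k\<in>I - S. cmod (main_part u (?m k)))"
    using inj by (subst sum.reindex) (auto intro: inj_on_subset)
  also have "\<dots> = tail"
    unfolding tail_def by (intro sum.cong) (auto simp: main_part_single norm_mult u)
  also have "sum aliasing (band L - ?m ` S) \<le> sum aliasing (band L)"
    by (intro sum_mono2) (auto simp: finite_band aliasing_nonneg)
  finally show ?thesis by simp
qed

lemma card_S_image: "(\<lambda>k. dot d k z) ` S \<subseteq> band L" "card ((\<lambda>k. dot d k z) ` S) \<le> s"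
  using S I_band I by (auto intro: order_trans[OF card_image_le] finite_subset)

text \<open>Aliasing inside the band enters the best term error, aliasing outside it the truncation
  error. Together they amount to \<open>aliasing_total\<close> counted once.\<close>

lemma sft_error_le:
  assumes u: "\<And>k. cmod (u k) = 1" and a: "fcoeff1 a = coeff u" and \<mu>: "sup_norm \<mu> \<le> e"
  shows "sft_error s L a \<mu> \<le> err"
proof -
  have "l1_norm (band L) (\<lambda>\<omega>. coeff u \<omega> - best_terms s (band L) (coeff u) \<omega>) \<le> tail + sum aliasing (band L)"
    using best_terms_l1_le[OF finite_band card_S_image] coeff_tail_le[of u, OF u] by (rule order_trans)
  then have "l1_norm (band L) (\<lambda>\<omega>. coeff u \<omega> - best_terms s (band L) (coeff u) \<omega>) / s
      \<le> (tail + sum aliasing (band L)) / s" by (rule divide_right_mono) simp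
  also have "\<dots> \<le> tail / s + sum aliasing (band L)"
  proof -
    have "sum aliasing (band L) / s \<le> sum aliasing (band L) / 1"
      using s by (intro divide_left_mono) (auto simp: sum_nonneg aliasing_nonneg)
    then show ?thesis by (simp add: add_divide_distrib)
  qed
  finally have 1: "l1_norm (band L) (\<lambda>\<omega>. coeff u \<omega> - best_terms s (band L) (coeff u) \<omega>) / s
      \<le> tail / s + sum aliasing (band L)" .
  have "l1_norm UNIV (\<lambda>\<omega>. coeff u \<omega> - restr (band L) (coeff u) \<omega>) \<le> aliasing_total - sum aliasing (band L)"
  proof -
    have out: "(aliasing has_sum (aliasing_total - sum aliasing (band L))) (UNIV - band L)"
      by (rule has_sum_Diff[OF aliasing_has_sum]) (auto simp: finite_band)
    \<comment> \<open>Frequencies of \<open>I\<close> are all mapped into the band, so a coefficient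
      outside it consists of aliasing alone.\<close>
    have "cmod (coeff u \<omega>) \<le> aliasing \<omega>" if "\<omega> \<in> UNIV - band L" for \<omega>
    proof -
      have "\<omega> \<notin> (\<lambda>k. dot d k z) ` I" using that I_band by auto
      then show ?thesis using coeff_main_part[of u \<omega>, OF u] main_part_empty by simp
    qed
    moreover have "(\<lambda>\<omega>. cmod (coeff u \<omega>)) summable_on (UNIV - band L)"
      by (rule summable_on_comparison_test[OF has_sum_imp_summable[OF out]]) (use calculation in auto)
    ultimately have "(\<Sum>\<^sub>\<infinity>\<omega>\<in>UNIV - band L. cmod (coeff u \<omega>)) \<le> aliasing_total - sum aliasing (band L)"
      using infsum_mono[OF _ has_sum_imp_summable[OF out]] infsumI[OF out] by metis
    moreover have "l1_norm UNIV (\<lambda>\<omega>. coeff u \<omega> - restr (band L) (coeff u) \<omega>)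
        = (\<Sum>\<^sub>\<infinity>\<omega>\<in>UNIV - band L. cmod (coeff u \<omega>))"
      unfolding l1_norm_def by (rule infsum_cong_neutral) (auto simp: restr_def)
    ultimately show ?thesis by simp
  qed
  with 1 \<mu> show ?thesis unfolding sft_error_def err_def a by linarith
qed

text \<open>The 7 is the 6 from the guarantee of the transform plus 1 for the best
  \<open>2 * s\<close> term error, which is at most \<open>sqrt (real s) * err\<close> by the
  Stechkin-type estimate.\<close>

lemma sft_accurate_consequences:
  assumes u: "\<And>k. cmod (u k) = 1" and a: "fcoeff1 a = coeff u" and \<mu>: "sup_norm \<mu> \<le> e"
    and v: "sft_accurate s L a \<mu> v" and sparse: "sparse_on (2 * s) (band L) v"
  shows "\<And>\<omega>. \<omega> \<in> band L \<Longrightarrow> (4 + 2 * sqrt 2) * err < cmod (coeff u \<omega>) \<Longrightarrow> v \<omega> \<noteq> 0"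
    and "\<And>\<omega>. v \<omega> \<noteq> 0 \<Longrightarrow> cmod (coeff u \<omega> - v \<omega>) \<le> sqrt 2 * err"
    and "L2_set (\<lambda>\<omega>. cmod (coeff u \<omega> - v \<omega>)) (band L) \<le> (8 * sqrt 2 + 7) * (sqrt (real s) * err)"
proof -
  define \<delta> where "\<delta> = sft_error s L a \<mu>"
  have \<delta>: "\<delta> \<le> err" unfolding \<delta>_def by (rule sft_error_le[OF u a \<mu>])
  have acc: "\<forall>\<omega>\<in>band L. (4 + 2 * sqrt 2) * \<delta> < cmod (coeff u \<omega>) \<longrightarrow> \<omega> \<in> supp v"
    "sup_norm (restr (supp v) (\<lambda>\<omega>. coeff u \<omega> - v \<omega>)) \<le> sqrt 2 * \<delta>"
    "l2_norm (band L) (\<lambda>\<omega>. coeff u \<omega> - v \<omega>)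
      \<le> l2_norm (band L) (\<lambda>\<omega>. coeff u \<omega> - best_terms (2 * s) (band L) (coeff u) \<omega>)
        + (8 * sqrt 2 + 6) * sqrt (real s) * \<delta>"
    using v by (auto simp: sft_accurate_def Let_def \<delta>_def a)
  show "v \<omega> \<noteq> 0" if "\<omega> \<in> band L" "(4 + 2 * sqrt 2) * err < cmod (coeff u \<omega>)" for \<omega>
  proof -
    have "(4 + 2 * sqrt 2) * \<delta> \<le> (4 + 2 * sqrt 2) * err" using \<delta> by (intro mult_left_mono) auto
    then show ?thesis using acc(1) that by (auto simp: supp_def)
  qed
  show "cmod (coeff u \<omega> - v \<omega>) \<le> sqrt 2 * err" if "v \<omega> \<noteq> 0" for \<omega>
  proof -
    let ?r = "restr (supp v) (\<lambda>\<omega>. coeff u \<omega> - v \<omega>)"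
    \<comment> \<open>The supremum runs over all integers; finite support leaves finitely many
      values, so it bounds each of them.\<close>
    have "range (\<lambda>\<omega>. cmod (?r \<omega>)) \<subseteq> insert 0 ((\<lambda>\<omega>. cmod (?r \<omega>)) ` supp v)"
      by (auto simp: restr_def)
    then have "finite (range (\<lambda>\<omega>. cmod (?r \<omega>)))"
      using sparse by (meson finite.insertI finite_imageI finite_subset sparse_on_def)
    then have "cmod (?r \<omega>) \<le> sup_norm ?r"
      unfolding sup_norm_def by (intro cSUP_upper bdd_above_finite) auto
    also have "\<dots> \<le> sqrt 2 * err" by (rule order_trans[OF acc(2)]) (use \<delta> in simp)
    finally show ?thesis using that by (simp add: restr_def supp_def)
  qed
  have rs: "1 \<le> sqrt (real s)" "sqrt (real s) * sqrt (real s) = s" using s by auto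
  have "l2_norm (band L) (\<lambda>\<omega>. coeff u \<omega> - best_terms (2 * s) (band L) (coeff u) \<omega>)
      \<le> (tail + sum aliasing (band L)) / sqrt (real s)"
    using best_terms_l2_le[OF finite_band card_S_image s, of "coeff u"]
      divide_right_mono[OF coeff_tail_le[of u, OF u], of "sqrt (real s)"] by simp
  also have "\<dots> \<le> sqrt (real s) * err"
  proof -
    have "tail + sum aliasing (band L) \<le> tail + aliasing_total * s"
      using aliasing_sum_le[OF finite_band, of L] mult_left_mono[of 1 "real s" aliasing_total] nonneg s by simp
    also have "\<dots> \<le> s * err" using s e by (simp add: err_def field_simps)
    also have "\<dots> = (sqrt s * err) * sqrt s" using rs by (simp add: mult_ac)
    finally show ?thesis using rs by (simp add: divide_le_eq)
  qed
  finally have "l2_norm (band L) (\<lambda>\<omega>. coeff u \<omega> - best_terms (2 * s) (band L) (coeff u) \<omega>) \<le> sqrt s * err" .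
  moreover have "(8 * sqrt 2 + 6) * sqrt (real s) * \<delta> \<le> (8 * sqrt 2 + 6) * sqrt (real s) * err"
    using \<delta> by (intro mult_left_mono) auto
  ultimately show "L2_set (\<lambda>\<omega>. cmod (coeff u \<omega> - v \<omega>)) (band L) \<le> (8 * sqrt 2 + 7) * (sqrt (real s) * err)"
    using acc(3) by (simp add: l2_norm_finite[OF finite_band] algebra_simps)
qed

definition phase :: "nat \<Rightarrow> (nat \<Rightarrow> int) \<Rightarrow> complex" where
  "phase l k = cis (2 * pi * real_of_int (k l) / real N)"

lemma main_part_phase:
  assumes "k \<in> I"
  shows "main_part (phase l) (dot d k z) = phase l k * main_part (\<lambda>_. 1) (dot d k z)"
  using assms by (simp add: main_part_single)

text \<open>Above this bound \<open>w l \<omega> / v \<omega>\<close> would deviate from its ideal value by less than \<open>3 / N\<close>, in the scope of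
  \<open>round_phase\<close>. The second entry of the maximum ensures that \<open>\<omega>\<close> is in the support of every \<open>w l\<close>.\<close>

lemma decode_wrong_small:
  fixes v :: "int \<Rightarrow> complex" and w :: "nat \<Rightarrow> int \<Rightarrow> complex"
  assumes v: "\<And>\<omega>. v \<omega> \<noteq> 0 \<Longrightarrow> cmod (coeff (\<lambda>_. 1) \<omega> - v \<omega>) \<le> sqrt 2 * err"
    and w1: "\<And>l \<omega>. l < d \<Longrightarrow> \<omega> \<in> band L \<Longrightarrow> (4 + 2 * sqrt 2) * err < cmod (coeff (phase l) \<omega>) \<Longrightarrow> w l \<omega> \<noteq> 0"
    and w2: "\<And>l \<omega>. l < d \<Longrightarrow> w l \<omega> \<noteq> 0 \<Longrightarrow> cmod (coeff (phase l) \<omega> - w l \<omega>) \<le> sqrt 2 * err"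
    and k: "k \<in> I" and nz: "v (dot d k z) \<noteq> 0" and wrong: "decode d N dflt v w (dot d k z) \<noteq> k"
  shows "cmod (v (dot d k z))
    \<le> max (2 * sqrt 2 * real N / 3) (4 + 3 * sqrt 2) * err + 2 * real N / 3 * aliasing (dot d k z)"
proof (rule ccontr)
  define \<omega> where "\<omega> = dot d k z"
  assume "\<not> ?thesis"
  then have big: "max (2 * sqrt 2 * real N / 3) (4 + 3 * sqrt 2) * err + 2 * real N / 3 * aliasing \<omega> < cmod (v \<omega>)"
    by (simp add: \<omega>_def)
  have a0: "0 \<le> aliasing \<omega>" by (rule aliasing_nonneg)
  have vnz: "v \<omega> \<noteq> 0" using nz by (simp add: \<omega>_def)
  have "2 * sqrt 2 * real N / 3 * err \<le> max (2 * sqrt 2 * real N / 3) (4 + 3 * sqrt 2) * err"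
    "(4 + 3 * sqrt 2) * err \<le> max (2 * sqrt 2 * real N / 3) (4 + 3 * sqrt 2) * err"
    using nonneg(3) by (simp_all only: mult_right_mono max.cobounded1 max.cobounded2)
  then have big1: "2 * sqrt 2 * real N / 3 * err + 2 * real N / 3 * aliasing \<omega> < cmod (v \<omega>)"
    and big2: "(4 + 3 * sqrt 2) * err + 2 * real N / 3 * aliasing \<omega> < cmod (v \<omega>)"
    using big by linarith+
  have band: "\<omega> \<in> band L" using k I_band by (simp add: \<omega>_def)
  have k_band: "k \<in> {..<d} \<rightarrow>\<^sub>E band N" using k I by (auto simp: band_d_def)
  \<comment> \<open>The main parts at \<omega> differ by exactly the factor
    \<open>phase l k\<close>, so only two aliasing parts remain.\<close>
  have close: "cmod (coeff (phase l) \<omega> - phase l k * coeff (\<lambda>_. 1) \<omega>) \<le> 2 * aliasing \<omega>" for l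
  proof -
    have ph: "cmod (phase l j) = 1" for j by (simp add: phase_def)
    have "coeff (phase l) \<omega> - phase l k * coeff (\<lambda>_. 1) \<omega>
        = (coeff (phase l) \<omega> - main_part (phase l) \<omega>) - phase l k * (coeff (\<lambda>_. 1) \<omega> - main_part (\<lambda>_. 1) \<omega>)"
      using main_part_phase[OF k] by (simp add: \<omega>_def algebra_simps)
    also have "cmod \<dots> \<le> aliasing \<omega> + aliasing \<omega>"
      using coeff_main_part[of "phase l" \<omega>] coeff_main_part[of "\<lambda>_. 1" \<omega>] ph
      by (intro order_trans[OF norm_triangle_ineq4 add_mono]) (auto simp: norm_mult)
    finally show ?thesis by simp
  qed
  have "phase_value N dflt v w \<omega> l = k l" if l: "l < d" for l
  proof -
    have ph: "cmod (phase l j) = 1" for j by (simp add: phase_def)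
    \<comment> \<open>Passing from \<open>v\<close> to the coefficient raises the detection
      threshold \<open>4 + 2 * sqrt 2\<close> by \<open>sqrt 2\<close>; this is the origin of
      \<open>4 + 3 * sqrt 2\<close>.\<close>
    have "cmod (v \<omega>) - sqrt 2 * err \<le> cmod (coeff (\<lambda>_. 1) \<omega>)"
      using v[OF vnz] norm_triangle_ineq3[of "coeff (\<lambda>_. 1) \<omega>" "v \<omega>"] by linarith
    moreover have "cmod (coeff (\<lambda>_. 1) \<omega>) - 2 * aliasing \<omega> \<le> cmod (coeff (phase l) \<omega>)"
      using close[of l] norm_triangle_ineq3[of "coeff (phase l) \<omega>" "phase l k * coeff (\<lambda>_. 1) \<omega>"]
      by (simp add: norm_mult ph)
    moreover have "2 * aliasing \<omega> \<le> 2 * real N / 3 * aliasing \<omega>"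
      using a0 N by (intro mult_right_mono) auto
    ultimately have "(4 + 2 * sqrt 2) * err < cmod (coeff (phase l) \<omega>)"
      using big2 by (simp add: algebra_simps)
    then have wnz: "w l \<omega> \<noteq> 0" by (rule w1[OF l band])
    have "w l \<omega> - phase l k * v \<omega> = - (coeff (phase l) \<omega> - w l \<omega>)
        + ((coeff (phase l) \<omega> - phase l k * coeff (\<lambda>_. 1) \<omega>) + phase l k * (coeff (\<lambda>_. 1) \<omega> - v \<omega>))"
      by (simp add: algebra_simps)
    also have "cmod \<dots> \<le> sqrt 2 * err + (2 * aliasing \<omega> + sqrt 2 * err)"
      by (intro order_trans[OF norm_triangle_ineq add_mono[OF _ order_trans[OF norm_triangle_ineq add_mono]]])
         (use w2[OF l wnz] close[of l] v[OF vnz] in \<open>auto simp: norm_mult ph norm_minus_commute\<close>)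
    \<comment> \<open>The first threshold in \<open>big1\<close> is this deviation multiplied by
      \<open>N / 3\<close>.\<close>
    also have "\<dots> = 3 / real N * (2 * sqrt 2 * real N / 3 * err + 2 * real N / 3 * aliasing \<omega>)"
      using N by (simp add: field_simps)
    also have "\<dots> < 3 / real N * cmod (v \<omega>)"
      using N big1 by (intro mult_strict_left_mono) auto
    finally have "centered_mod N (round (real N * Arg (w l \<omega> / v \<omega>) / (2 * pi))) = k l"
      unfolding phase_def using k_band l by (intro round_phase[OF N _ vnz]) auto
    then show ?thesis using wnz by (simp add: phase_value_def)
  qed
  then have "decode d N dflt v w \<omega> = k"
    using k_band by (intro ext) (auto simp: decode_def PiE_iff extensional_def)
  then show False using wrong by (simp add: \<omega>_def)
qed


text \<open>The error splits over the fibers of \<open>dot d k z\<close>. There \<open>G\<close> is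
  what correct placement would leave and \<open>\<beta>\<close> bounds a misplaced value; Minkowski
  over the band then adds their l2 norms.\<close>

lemma decoded_l2_error:
  fixes v :: "int \<Rightarrow> complex" and w :: "nat \<Rightarrow> int \<Rightarrow> complex" and dflt :: "nat \<Rightarrow> int \<Rightarrow> int"
  defines "K \<equiv> decode d N dflt v w"
  defines "b \<equiv> \<lambda>k. if dot d k z \<in> supp v \<and> K (dot d k z) = k then v (dot d k z) else 0"
  assumes sparse: "sparse_on (2 * s) (band L) v"
    and v: "\<And>\<omega>. v \<omega> \<noteq> 0 \<Longrightarrow> cmod (coeff (\<lambda>_. 1) \<omega> - v \<omega>) \<le> sqrt 2 * err"
    and v2: "L2_set (\<lambda>\<omega>. cmod (coeff (\<lambda>_. 1) \<omega> - v \<omega>)) (band L) \<le> (8 * sqrt 2 + 7) * (sqrt (real s) * err)"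
    and w1: "\<And>l \<omega>. l < d \<Longrightarrow> \<omega> \<in> band L \<Longrightarrow> (4 + 2 * sqrt 2) * err < cmod (coeff (phase l) \<omega>) \<Longrightarrow> w l \<omega> \<noteq> 0"
    and w2: "\<And>l \<omega>. l < d \<Longrightarrow> w l \<omega> \<noteq> 0 \<Longrightarrow> cmod (coeff (phase l) \<omega> - w l \<omega>) \<le> sqrt 2 * err"
  shows "finite (supp b)" "l2_norm (Zd d) (\<lambda>k. b k - restr I c k) \<le> (24 + 3 * real N) * (sqrt (real s) * err)"
proof -
  let ?m = "\<lambda>k. dot d k z"
  let ?B = "band L"
  define \<kappa> where "\<kappa> = max (2 * sqrt 2 * real N / 3) (4 + 3 * sqrt 2)"
  define x where "x = (\<lambda>k. b k - restr I c k)"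
  define X where "X = I \<union> {k. ?m k \<in> supp v \<and> K (?m k) = k}"
  define \<beta> where "\<beta> = (\<lambda>\<omega>. if \<omega> \<in> supp v then \<kappa> * err + 2 * real N / 3 * aliasing \<omega> else 0)"
  define G where "G = (\<lambda>\<omega>. cmod (v \<omega> - main_part (\<lambda>_. 1) \<omega>))"
  have supp_v: "supp v \<subseteq> ?B" "finite (supp v)" "card (supp v) \<le> 2 * s"
    using sparse by (auto simp: sparse_on_def)
  have X_img: "{k. ?m k \<in> supp v \<and> K (?m k) = k} \<subseteq> K ` supp v" by force
  then have finX: "finite X" unfolding X_def using I supp_v by (simp add: finite_subset)
  have "supp b \<subseteq> X" by (auto simp: X_def b_def supp_def)
  then show "finite (supp b)" using finX finite_subset by blast
  have K_Zd: "K \<omega> \<in> Zd d" for \<omega> by (simp add: K_def decode_def Zd_def)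
  then have XZ: "X \<subseteq> Zd d" using I_Zd X_img by (auto simp: X_def)
  have x0: "x k = 0" if "k \<notin> X" for k
    using that by (auto simp: x_def X_def b_def restr_def)
  have mX: "?m ` X \<subseteq> ?B" using supp_v I_band by (auto simp: X_def)
  have \<kappa>0: "0 \<le> \<kappa>" by (simp add: \<kappa>_def le_max_iff_disj)
  have \<beta>0: "0 \<le> \<beta> \<omega>" for \<omega>
    using \<kappa>0 nonneg(3) aliasing_nonneg by (simp add: \<beta>_def)
  \<comment> \<open>On each fiber \<open>dot d k z = \<omega>\<close> there is at most one frequency of \<open>I\<close> and one decoded frequency; if they
    differ, both entries contribute, which costs the factor \<open>sqrt 2\<close>.\<close>
  have fiber: "(\<Sum>k\<in>{k\<in>X. ?m k = \<omega>}. (cmod (x k))\<^sup>2) \<le> (G \<omega> + sqrt 2 * \<beta> \<omega>)\<^sup>2" for \<omega>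
  proof -
    let ?F = "{k\<in>X. ?m k = \<omega>}"
    have G0: "0 \<le> G \<omega>" by (simp add: G_def)
    have single: "(\<Sum>k\<in>?F. (cmod (x k))\<^sup>2) \<le> (G \<omega> + sqrt 2 * \<beta> \<omega>)\<^sup>2"
      if F: "?F \<subseteq> {k}" and xk: "cmod (x k) \<le> G \<omega>" for k
    proof -
      have "(\<Sum>k\<in>?F. (cmod (x k))\<^sup>2) \<le> (\<Sum>k\<in>{k}. (cmod (x k))\<^sup>2)"
        by (intro sum_mono2 F) auto
      also have "\<dots> \<le> (G \<omega> + sqrt 2 * \<beta> \<omega>)\<^sup>2"
        using xk \<beta>0[of \<omega>] by (simp add: power_mono add_increasing2)
      finally show ?thesis .
    qed
    show ?thesis
    proof (cases "\<omega> \<in> ?m ` I")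
      case False
      \<comment> \<open>No index of \<open>I\<close> lies in this fiber: the only possible entry is
        a spurious decoded one, and \<open>main_part\<close> is 0.\<close>
      then have "?F \<subseteq> {K \<omega>}" by (auto simp: X_def)
      moreover have "cmod (x (K \<omega>)) \<le> G \<omega>" if nonempty: "?F \<noteq> {}"
      proof -
        obtain j where "j \<in> ?F" using nonempty by blast
        moreover from this have "j = K \<omega>" using \<open>?F \<subseteq> {K \<omega>}\<close> by blast
        ultimately have "K \<omega> \<in> X" "?m (K \<omega>) = \<omega>" by simp_all
        then have "K \<omega> \<notin> I" using False imageI[of "K \<omega>" I ?m] by metis
        then show ?thesis
          using \<open>?m (K \<omega>) = \<omega>\<close> main_part_empty[OF False]
          by (auto simp: x_def b_def restr_def G_def)
      qed
      moreover have "(\<Sum>k\<in>?F. (cmod (x k))\<^sup>2) \<le> (G \<omega> + sqrt 2 * \<beta> \<omega>)\<^sup>2" if "?F = {}"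
        unfolding that by simp
      ultimately show ?thesis using single[of "K \<omega>"] by blast
    next
      case True
      then obtain k where k: "k \<in> I" "?m k = \<omega>" by auto
      have only: "j = k" if "j \<in> I" "?m j = \<omega>" for j
        using inj k that by (auto dest: inj_onD)
      have main: "main_part (\<lambda>_. 1) \<omega> = c k" using main_part_single[OF k(1)] k(2) by simp
      consider "\<omega> \<notin> supp v" | "\<omega> \<in> supp v" "K \<omega> = k" | "\<omega> \<in> supp v" "K \<omega> \<noteq> k" by blast
      then show ?thesis
      proof cases
        case 1
        show ?thesis
        proof (rule single[of k])
          show "?F \<subseteq> {k}" using only 1 by (auto simp: X_def)
          show "cmod (x k) \<le> G \<omega>" using 1 k main by (simp add: x_def b_def restr_def G_def supp_def)
        qed
      next
        case 2
        show ?thesis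
        proof (rule single[of k])
          show "?F \<subseteq> {k}" using only 2 by (auto simp: X_def)
          show "cmod (x k) \<le> G \<omega>" using 2 k main by (simp add: x_def b_def restr_def G_def)
        qed
      next
        case 3
        have small: "cmod (v \<omega>) \<le> \<beta> \<omega>"
          using decode_wrong_small[OF v w1 w2 k(1), of dflt] 3 k
          by (simp add: \<beta>_def \<kappa>_def K_def supp_def)
        have ck: "cmod (c k) \<le> G \<omega> + cmod (v \<omega>)"
          using norm_triangle_ineq2[of "c k" "v \<omega>"] by (simp add: G_def main norm_minus_commute)
        have "?F \<subseteq> {k, K \<omega>}" using only by (auto simp: X_def)
        then have "(\<Sum>k\<in>?F. (cmod (x k))\<^sup>2) \<le> (\<Sum>k\<in>?F \<inter> {k, K \<omega>}. (cmod (x k))\<^sup>2)"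
          by (simp add: Int_absorb2)
        also have "\<dots> \<le> (cmod (c k))\<^sup>2 + (cmod (v \<omega>))\<^sup>2"
        proof -
          have "(cmod (x k))\<^sup>2 \<le> (cmod (c k))\<^sup>2" using 3 k by (simp add: x_def b_def restr_def)
          moreover have "(cmod (x (K \<omega>)))\<^sup>2 \<le> (cmod (v \<omega>))\<^sup>2" if "K \<omega> \<in> ?F"
          proof -
            have "K \<omega> \<notin> I" using only[of "K \<omega>"] that 3 by blast
            then show ?thesis using that 3 by (simp add: x_def b_def restr_def)
          qed
          moreover have "?F \<inter> {k, K \<omega>} = (if K \<omega> \<in> ?F then {k, K \<omega>} else {k})"
          proof -
            have "k \<in> ?F" using k by (simp add: X_def)
            then show ?thesis by auto
          qed
          moreover have "(\<Sum>k\<in>{k, K \<omega>}. (cmod (x k))\<^sup>2) = (cmod (x k))\<^sup>2 + (cmod (x (K \<omega>)))\<^sup>2"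
            using 3 by simp
          ultimately show ?thesis by (cases "K \<omega> \<in> ?F") (simp_all add: add_mono add_increasing2)
        qed
        also have "\<dots> \<le> (G \<omega> + cmod (v \<omega>))\<^sup>2 + (cmod (v \<omega>))\<^sup>2"
          using ck by (intro add_right_mono power_mono) auto
        \<comment> \<open>After expansion the squares on both sides agree, and only the mixed term
          grows, by the factor \<open>sqrt 2\<close>.\<close>
        also have "\<dots> \<le> (G \<omega> + sqrt 2 * cmod (v \<omega>))\<^sup>2"
        proof -
          have "1 \<le> sqrt 2" by simp
          then have "G \<omega> * cmod (v \<omega>) \<le> sqrt 2 * (G \<omega> * cmod (v \<omega>))"
            using G0 mult_right_mono[of 1 "sqrt 2" "G \<omega> * cmod (v \<omega>)"] by simp
          then show ?thesis by (simp add: power2_sum power_mult_distrib algebra_simps)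
        qed
        also have "\<dots> \<le> (G \<omega> + sqrt 2 * \<beta> \<omega>)\<^sup>2"
          using small G0 by (intro power_mono add_left_mono mult_left_mono) auto
        finally show ?thesis .
      qed
    qed
  qed
  have "l2_norm (Zd d) x = sqrt (\<Sum>k\<in>X. (cmod (x k))\<^sup>2)"
  proof -
    have "(\<Sum>\<^sub>\<infinity>k\<in>Zd d. (cmod (x k))\<^sup>2) = (\<Sum>\<^sub>\<infinity>k\<in>X. (cmod (x k))\<^sup>2)"
      by (rule infsum_cong_neutral) (use x0 XZ in auto)
    then show ?thesis using finX by (simp add: l2_norm_def)
  qed
  also have "(\<Sum>k\<in>X. (cmod (x k))\<^sup>2) = (\<Sum>\<omega>\<in>?B. \<Sum>k\<in>{k\<in>X. ?m k = \<omega>}. (cmod (x k))\<^sup>2)"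
    by (rule sum.group[symmetric, OF finX finite_band mX])
  also have "\<dots> \<le> (\<Sum>\<omega>\<in>?B. (G \<omega> + sqrt 2 * \<beta> \<omega>)\<^sup>2)" by (rule sum_mono[OF fiber])
  finally have "l2_norm (Zd d) x \<le> L2_set (\<lambda>\<omega>. G \<omega> + sqrt 2 * \<beta> \<omega>) ?B" by (simp add: L2_set_def)
  also have "\<dots> \<le> L2_set G ?B + sqrt 2 * L2_set \<beta> ?B"
    by (rule order_trans[OF L2_set_triangle_ineq]) (use L2_set_right_distrib[of "sqrt 2" \<beta> ?B] in simp)
  also have "L2_set G ?B \<le> (8 * sqrt 2 + 8) * (sqrt (real s) * err)"
  proof -
    have "L2_set G ?B \<le> L2_set (\<lambda>\<omega>. cmod (coeff (\<lambda>_. 1) \<omega> - v \<omega>) + aliasing \<omega>) ?B"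
    proof (rule L2_set_mono)
      show "G \<omega> \<le> cmod (coeff (\<lambda>_. 1) \<omega> - v \<omega>) + aliasing \<omega>" for \<omega>
        using coeff_main_part[of "\<lambda>_. 1" \<omega>]
          norm_triangle_ineq[of "v \<omega> - coeff (\<lambda>_. 1) \<omega>" "coeff (\<lambda>_. 1) \<omega> - main_part (\<lambda>_. 1) \<omega>"]
        by (simp add: G_def norm_minus_commute)
    qed (simp add: G_def)
    also have "\<dots> \<le> (8 * sqrt 2 + 7) * (sqrt (real s) * err) + aliasing_total"
      using v2 L2_set_le_sum[of ?B aliasing] aliasing_sum_le[OF finite_band, of L] aliasing_nonneg
      by (intro order_trans[OF L2_set_triangle_ineq] add_mono) auto
    also have "aliasing_total \<le> sqrt (real s) * err"
      using nonneg s mult_right_mono[of 1 "sqrt (real s)" err] by simp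
    finally show ?thesis by (simp add: algebra_simps)
  qed
  also have "L2_set \<beta> ?B \<le> sqrt 2 * (sqrt (real s) * (\<kappa> * err)) + 2 * real N / 3 * (sqrt (real s) * err)"
  proof -
    \<comment> \<open>Only the multiple of \<open>err\<close> is paid for on each of up to
      \<open>2 * s\<close> frequencies; the aliasing part is bounded by its l1 norm.\<close>
    have "L2_set \<beta> ?B \<le> L2_set (\<lambda>\<omega>. (if \<omega> \<in> supp v then \<kappa> * err else 0) + 2 * real N / 3 * aliasing \<omega>) ?B"
      by (intro L2_set_mono \<beta>0) (auto simp: \<beta>_def aliasing_nonneg)
    also have "\<dots> \<le> L2_set (\<lambda>\<omega>. if \<omega> \<in> supp v then \<kappa> * err else 0) ?B + 2 * real N / 3 * L2_set aliasing ?B"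
      by (rule order_trans[OF L2_set_triangle_ineq])
         (use L2_set_right_distrib[of "2 * real N / 3" aliasing ?B] in simp)
    also have "L2_set (\<lambda>\<omega>. if \<omega> \<in> supp v then \<kappa> * err else 0) ?B \<le> sqrt 2 * (sqrt (real s) * (\<kappa> * err))"
    proof -
      have "L2_set (\<lambda>\<omega>. if \<omega> \<in> supp v then \<kappa> * err else 0) ?B = L2_set (\<lambda>\<omega>. \<kappa> * err) (supp v)"
        unfolding L2_set_def using supp_v
        by (intro arg_cong[of _ _ sqrt] sum.mono_neutral_cong_right) (auto simp: finite_band)
      also have "\<dots> = sqrt (card (supp v)) * (\<kappa> * err)"
        using \<kappa>0 nonneg(3) by (simp add: L2_set_constant)
      also have "\<dots> \<le> sqrt (2 * s) * (\<kappa> * err)"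
      proof -
        have "real (card (supp v)) \<le> 2 * real s" using supp_v(3) by linarith
        then show ?thesis using \<kappa>0 nonneg(3) by (intro mult_right_mono real_sqrt_le_mono) auto
      qed
      finally show ?thesis by (simp add: real_sqrt_mult)
    qed
    also have "2 * real N / 3 * L2_set aliasing ?B \<le> 2 * real N / 3 * (sqrt (real s) * err)"
    proof (rule mult_left_mono)
      have "L2_set aliasing ?B \<le> aliasing_total"
        using L2_set_le_sum[of ?B aliasing] aliasing_sum_le[OF finite_band, of L] aliasing_nonneg by force
      also have "\<dots> \<le> sqrt (real s) * err"
        using nonneg s mult_right_mono[of 1 "sqrt (real s)" err] by simp
      finally show "L2_set aliasing ?B \<le> sqrt (real s) * err" .
    qed simp
    finally show ?thesis by simp
  qed
  finally have "l2_norm (Zd d) x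
      \<le> (8 * sqrt 2 + 8) * (sqrt (real s) * err)
        + sqrt 2 * (sqrt 2 * (sqrt (real s) * (\<kappa> * err)) + 2 * real N / 3 * (sqrt (real s) * err))"
    by simp
  also have "\<dots> = (8 * sqrt 2 + 8 + 2 * \<kappa> + 2 * sqrt 2 * real N / 3) * (sqrt (real s) * err)"
  proof -
    have "sqrt 2 * (sqrt 2 * (sqrt (real s) * (\<kappa> * err))) = 2 * \<kappa> * (sqrt (real s) * err)"
      by (simp add: mult.assoc[symmetric])
    then show ?thesis by (simp add: algebra_simps)
  qed
  also have "\<dots> \<le> (24 + 3 * real N) * (sqrt (real s) * err)"
  proof (rule mult_right_mono)
    define q where "q = sqrt 2 * real N"
    have sqrt2: "sqrt 2 \<le> 1415 / 1000" by (rule real_le_lsqrt) (auto simp: power2_eq_square)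
    then have "q \<le> 1415 / 1000 * real N" unfolding q_def by (rule mult_right_mono) simp
    moreover have q: "2 * sqrt 2 * real N / 3 = 2 / 3 * q" by (simp add: q_def)
    moreover have "6 \<le> real N" using N by simp
    \<comment> \<open>For the first value, \<open>N\<close> gets the coefficient
      \<open>2 * sqrt 2 < 3\<close>, and \<open>8 * sqrt 2 + 8 < 24\<close>. For the second, the
      constant \<open>14 * sqrt 2 + 16\<close> exceeds 24, and the excess is absorbed by the slack
      in the coefficient of \<open>N\<close>, as \<open>6 \<le> N\<close>.\<close>
    moreover have "\<kappa> = 2 / 3 * q \<or> \<kappa> = 4 + 3 * sqrt 2" by (simp add: \<kappa>_def max_def q)
    ultimately show "8 * sqrt 2 + 8 + 2 * \<kappa> + 2 * sqrt 2 * real N / 3 \<le> 24 + 3 * real N"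
      using sqrt2 unfolding q by (elim disjE) linarith+
    show "0 \<le> sqrt (real s) * err" using nonneg by simp
  qed
  finally show "l2_norm (Zd d) (\<lambda>k. b k - restr I c k) \<le> (24 + 3 * real N) * (sqrt (real s) * err)"
    by (simp add: x_def)
qed

end

section \<open>Sampling along the lattice line and its shifts\<close>

lemma character_cong:
  assumes "\<And>l. l < d \<Longrightarrow> x l - y l \<in> \<int>"
  shows "character d k x = character d k y"
  using character_periodic[of d k] assms by (simp add: periodic_def)

lemma character_line:
  "character d k (line d z t) = cis (2 * pi * real_of_int (dot d k z) * t)"
proof -
  have "character d k (line d z t) = character d k (\<lambda>l. t * real_of_int (z l))"
    by (rule character_cong) (simp add: line_def frac_def)
  also have "\<dots> = cis (2 * pi * real_of_int (dot d k z) * t)"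
    by (simp add: character_def dot_def sum_distrib_left sum_distrib_right mult_ac)
  finally show ?thesis .
qed

lemma character_shift_line:
  assumes l: "l < d"
  shows "character d k (shift l \<alpha> (line d z t))
    = cis (2 * pi * real_of_int (k l) * \<alpha>) * cis (2 * pi * real_of_int (dot d k z) * t)"
proof -
  let ?y = "\<lambda>i. t * real_of_int (z i) + (if i = l then \<alpha> else 0)"
  have "character d k (shift l \<alpha> (line d z t)) = character d k ?y"
    by (rule character_cong) (use l in \<open>simp add: shift_def line_def frac_def\<close>)
  moreover have "(\<Sum>i<d. real_of_int (k i) * ?y i)
      = (\<Sum>i<d. real_of_int (k i) * (t * real_of_int (z i)) + (if i = l then real_of_int (k l) * \<alpha> else 0))"
    by (intro sum.cong) (auto simp: algebra_simps)
  moreover have "\<dots> = real_of_int (dot d k z) * t + real_of_int (k l) * \<alpha>"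
    using l by (simp add: sum.distrib dot_def sum_distrib_left sum_distrib_right mult_ac)
  ultimately have "character d k (shift l \<alpha> (line d z t))
      = cis (2 * pi * (real_of_int (dot d k z) * t + real_of_int (k l) * \<alpha>))"
    by (simp only: character_def)
  then show ?thesis by (simp add: cis_mult algebra_simps)
qed

text \<open>The bandwidth has the odd form \<open>2 * m + 1\<close>, so its band is the symmetric
  interval from \<open>- m\<close> to \<open>m\<close>.\<close>

lemma dot_in_band:
  assumes "finite I" "k \<in> I"
  shows "dot d k z \<in> band (bandwidth d z I)"
proof -
  let ?mx = "Max (insert 0 ((\<lambda>k. \<bar>dot d k z\<bar>) ` I))"
  have "\<bar>dot d k z\<bar> \<le> ?mx" "0 \<le> ?mx" using assms by (auto intro: Max_ge)
  moreover from this have "bandwidth d z I = 2 * nat ?mx + 1" by (simp add: bandwidth_def)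
  ultimately show ?thesis by (auto simp: band_eq)
qed

text \<open>An odd number that is at least 2 is at least 3. Its logarithm is then at least 1, as the
  cost bounds require.\<close>

lemma bandwidth_ge_3:
  assumes I: "finite I" and s: "1 \<le> s" "2 * s \<le> bandwidth d z I"
  shows "3 \<le> bandwidth d z I"
proof -
  have "0 \<le> Max (insert 0 ((\<lambda>k. \<bar>dot d k z\<bar>) ` I))" using I by (auto intro: Max_ge)
  then have "bandwidth d z I = 2 * nat (Max (insert 0 ((\<lambda>k. \<bar>dot d k z\<bar>) ` I))) + 1"
    by (simp add: bandwidth_def)
  then obtain m where "bandwidth d z I = 2 * m + 1" by blast
  then show ?thesis using s by presburger
qed

definition sample_phase :: "nat \<Rightarrow> nat \<Rightarrow> (nat \<Rightarrow> int) \<Rightarrow> complex" where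
  "sample_phase N i k = (case i of 0 \<Rightarrow> 1 | Suc l \<Rightarrow> cis (2 * pi * real_of_int (k l) / real N))"

lemma sampled_series:
  fixes f :: "(nat \<Rightarrow> real) \<Rightarrow> complex" and N :: nat and z :: "nat \<Rightarrow> int"
  assumes f: "wiener d f" "continuous_on UNIV f" and i: "i \<le> d"
  defines "a \<equiv> \<lambda>t. f (sample_point d N z i t)"
  shows "fcoeff1 a \<omega> = (\<Sum>\<^sub>\<infinity>k\<in>{k\<in>Zd d. dot d k z = \<omega>}. fcoeff d f k * sample_phase N i k)"
    "continuous_on UNIV a" "wiener1 a"
proof -
  have norm: "cmod (sample_phase N i k) = 1" for k by (simp add: sample_phase_def split: nat.split)
  have "(\<lambda>k. cmod (fcoeff d f k * sample_phase N i k)) summable_on Zd d"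
    using f by (simp add: wiener_def norm_mult norm)
  moreover have "((\<lambda>k. fcoeff d f k * sample_phase N i k * cis (2 * pi * real_of_int (dot d k z) * t)) has_sum a t) (Zd d)" for t
  proof -
    have "character d k (sample_point d N z i t) = sample_phase N i k * cis (2 * pi * real_of_int (dot d k z) * t)" for k
      using i by (cases i) (simp_all add: sample_point_def sample_phase_def character_line character_shift_line)
    then show ?thesis
      using fourier_series[OF f, of "sample_point d N z i t"] by (simp add: a_def mult.assoc)
  qed
  ultimately show "fcoeff1 a \<omega> = (\<Sum>\<^sub>\<infinity>k\<in>{k\<in>Zd d. dot d k z = \<omega>}. fcoeff d f k * sample_phase N i k)"
    "continuous_on UNIV a" "wiener1 a"
    by (rule univariate_series)+
qed

text \<open>The noise is arbitrary on requests, but a request sees \<open>t\<close> only through the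
  multiple of \<open>z\<close> modulo 1, and \<open>z\<close> is integral.\<close>

lemma noise_periodic: "periodic1 (\<lambda>t. \<eta> (i, sample_point d N z i t))"
  unfolding periodic1_def
proof (intro allI impI)
  fix x y :: real assume xy: "x - y \<in> \<int>"
  have "frac (x * real_of_int m) = frac (y * real_of_int m)" for m
  proof -
    have "(x - y) * real_of_int m \<in> \<int>" using xy by (intro Ints_mult) auto
    then obtain n where "(x - y) * real_of_int m = real_of_int n" by (auto elim: Ints_cases)
    then have "x * real_of_int m = y * real_of_int m + real_of_int n" by (simp add: algebra_simps)
    then show ?thesis by (simp add: frac_def)
  qed
  then have "line d z x = line d z y" by (simp add: line_def)
  then show "\<eta> (i, sample_point d N z i x) = \<eta> (i, sample_point d N z i y)"
    by (simp add: sample_point_def split: nat.split)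
qed

lemma sft_input_sampled:
  assumes "wiener d f" "continuous_on UNIV f" "i \<le> d" and \<eta>: "\<And>q. cmod (\<eta> q) \<le> e"
  shows "sft_input (\<lambda>t. f (sample_point d N z i t)) (\<lambda>t. \<eta> (i, sample_point d N z i t))"
  using sampled_series(2,3)[OF assms(1-3)] noise_periodic \<eta>
  by (auto simp: sft_input_def bounded_iff intro!: exI[of _ e])

lemma sampled_noisy:
  "sampled d N z (noisy f \<eta>) i
    = (\<lambda>t. f (sample_point d N z i t) + \<eta> (i, sample_point d N z i t))"
  by (simp add: sampled_def noisy_def)

definition sampled_accurate ::
  "nat \<Rightarrow> nat \<Rightarrow> (nat \<Rightarrow> int) \<Rightarrow> ((nat \<Rightarrow> real) \<Rightarrow> complex) \<Rightarrow> (request \<Rightarrow> complex) \<Rightarrow> nat \<Rightarrow> nat \<Rightarrow> nat \<Rightarrow> sft \<Rightarrow> bool" where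
  "sampled_accurate d N z f \<eta> s L i p \<longleftrightarrow>
     sft_accurate s L (\<lambda>t. f (sample_point d N z i t)) (\<lambda>t. \<eta> (i, sample_point d N z i t))
       (result (sampled d N z (noisy f \<eta>) i) p)"

lemma decode_in_band: "1 \<le> N \<Longrightarrow> decode d N dflt v w \<omega> \<in> band_d d N"
  by (simp add: decode_def band_d_def phase_value_def centered_mod_in_band)

text \<open>Every nonzero entry is decoded from an element of the support of the first transform,
  and decoding always lands in the band. No accuracy enters, so this holds for each outcome of the
  random choices.\<close>

lemma phase_encoding_sparse:
  fixes P :: "nat \<Rightarrow> sft"
  assumes N: "1 \<le> N" and v: "sparse_on m B (result (sampled d N z F 0) (P 0))"
  shows "sparse_on m (band_d d N) (result F (phase_encoding d N z dflt P))"
proof -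
  let ?v = "result (sampled d N z F 0) (P 0)"
  let ?K = "decode d N dflt ?v (\<lambda>l. if l < d then result (sampled d N z F (Suc l)) (P (Suc l)) else (\<lambda>_. 0))"
  have fin: "finite (supp ?v)" and card: "card (supp ?v) \<le> m" using v by (auto simp: sparse_on_def)
  have sub: "supp (result F (phase_encoding d N z dflt P)) \<subseteq> ?K ` supp ?v"
  proof
    fix k assume "k \<in> supp (result F (phase_encoding d N z dflt P))"
    then have "dot d k z \<in> supp ?v" "?K (dot d k z) = k"
      unfolding phase_encoding_result[where P = P and d = d and N = N and z = z, OF fin]
      by (auto simp: supp_def split: if_splits)
    then show "k \<in> ?K ` supp ?v" by (intro image_eqI[of k ?K "dot d k z"]) (rule sym)
  qed
  have finK: "finite (?K ` supp ?v)" using fin by simp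
  have "supp (result F (phase_encoding d N z dflt P)) \<subseteq> band_d d N"
    using sub decode_in_band[OF N] by blast
  moreover have "card (supp (result F (phase_encoding d N z dflt P))) \<le> m"
    by (rule order_trans[OF card_mono[OF finK sub] order_trans[OF card_image_le[OF fin] card]])
  ultimately show ?thesis unfolding sparse_on_def using finite_subset[OF sub finK] by blast
qed

text \<open>The output is compared with the restriction of \<open>c\<close> to \<open>I\<close>,
  where the decoding estimate applies; the rest of \<open>c\<close> enters by the triangle
  inequality.\<close>

lemma phase_encoding_error_estimate:
  fixes f :: "(nat \<Rightarrow> real) \<Rightarrow> complex" and P :: "nat \<Rightarrow> sft"
  assumes N: "6 \<le> N" and s: "1 \<le> s" and I: "finite I" "I \<subseteq> band_d d N" and rec: "reconstructing d z M I"
    and f: "wiener d f" "continuous_on UNIV f" and e: "0 \<le> e" and \<eta>: "\<And>q. cmod (\<eta> q) \<le> e"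
    and L: "L = bandwidth d z I"
    and sparse: "\<And>i. i \<le> d \<Longrightarrow> sparse_on (2 * s) (band L) (result (sampled d N z (noisy f \<eta>) i) (P i))"
    and acc: "\<And>i. i \<le> d \<Longrightarrow> sampled_accurate d N z f \<eta> s L i (P i)"
  shows "error_estimate d N I s e (fcoeff d f) (result (noisy f \<eta>) (phase_encoding d N z dflt P))"
proof -
  let ?c = "fcoeff d f"
  \<comment> \<open>The very set chosen by \<open>best_terms\<close> serves as \<open>S\<close>, so
    that \<open>tail\<close> equals the best term error exactly.\<close>
  obtain S where best: "largest_entries s I (restr I ?c) S" "best_terms s I (restr I ?c) = restr S (restr I ?c)"
    by (rule best_terms_cases[OF I(1)])
  have SI: "S \<subseteq> I" "card S \<le> s" using best(1) by (auto simp: largest_entries_def)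
  have c: "(\<lambda>k. cmod (?c k)) summable_on Zd d" using f by (simp add: wiener_def)
  \<comment> \<open>Different residues modulo \<open>M\<close> come from different integers.\<close>
  have inj: "inj_on (\<lambda>k. dot d k z) I"
    using rec by (auto simp: reconstructing_def inj_on_def)
  interpret sparse_setup d N s L z I S ?c e
    by unfold_locales (use N s I inj dot_in_band[OF I(1)] SI c e L in auto)
  let ?v = "\<lambda>i. result (sampled d N z (noisy f \<eta>) i) (P i)"
  define w where "w = (\<lambda>l. if l < d then ?v (Suc l) else (\<lambda>_. 0))"
  have coeff: "fcoeff1 (\<lambda>t. f (sample_point d N z i t)) = coeff (sample_phase N i)" if "i \<le> d" for i
    using sampled_series(1)[OF f that] by (auto simp: coeff_def)
  have sup: "sup_norm (\<lambda>t. \<eta> (i, sample_point d N z i t)) \<le> e" for i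
    unfolding sup_norm_def by (rule cSUP_least) (use \<eta> in auto)
  have norm: "cmod (sample_phase N i k) = 1" for i k by (simp add: sample_phase_def split: nat.split)
  have phase0: "sample_phase N 0 = (\<lambda>_. 1)" and phaseS: "sample_phase N (Suc l) = phase l" for l
    by (auto simp: sample_phase_def phase_def)
  note conseq = sft_accurate_consequences[OF norm coeff sup acc[unfolded sampled_accurate_def] sparse]
  define b where "b = (\<lambda>k. if dot d k z \<in> supp (?v 0) \<and> decode d N dflt (?v 0) w (dot d k z) = k
    then ?v 0 (dot d k z) else 0)"
  have res: "result (noisy f \<eta>) (phase_encoding d N z dflt P) = b"
    unfolding b_def w_def using sparse[of 0] by (intro phase_encoding_result) (auto simp: sparse_on_def)
  have v1: "cmod (coeff (\<lambda>_. 1) \<omega> - ?v 0 \<omega>) \<le> sqrt 2 * err" if "?v 0 \<omega> \<noteq> 0" for \<omega>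
    using conseq(2)[of 0 \<omega>] that by (simp add: phase0)
  have v2: "L2_set (\<lambda>\<omega>. cmod (coeff (\<lambda>_. 1) \<omega> - ?v 0 \<omega>)) (band L) \<le> (8 * sqrt 2 + 7) * (sqrt (real s) * err)"
    using conseq(3)[of 0] by (simp add: phase0)
  have w1: "w l \<omega> \<noteq> 0" if "l < d" "\<omega> \<in> band L" "(4 + 2 * sqrt 2) * err < cmod (coeff (phase l) \<omega>)" for l \<omega>
    using conseq(1)[of "Suc l" \<omega>] that by (simp add: phaseS w_def)
  have w2: "cmod (coeff (phase l) \<omega> - w l \<omega>) \<le> sqrt 2 * err" if "l < d" "w l \<omega> \<noteq> 0" for l \<omega>
    using conseq(2)[of "Suc l" \<omega>] that by (simp add: phaseS w_def)
  note decoded = decoded_l2_error[where v = "?v 0" and w = w, OF sparse[OF le0] v1 v2 w1 w2]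
  have fin: "finite (supp b)"
    unfolding b_def by (rule decoded(1))
  have main: "l2_norm (Zd d) (\<lambda>k. b k - restr I ?c k) \<le> (24 + 3 * real N) * (sqrt (real s) * err)"
    unfolding b_def by (rule decoded(2))
  have b_Zd: "supp b \<subseteq> Zd d"
  proof
    fix k assume "k \<in> supp b"
    then have "decode d N dflt (?v 0) w (dot d k z) = k" by (auto simp: b_def supp_def split: if_splits)
    moreover have "decode d N dflt (?v 0) w (dot d k z) \<in> Zd d" by (simp add: decode_def Zd_def)
    ultimately show "k \<in> Zd d" by simp
  qed
  have tail: "l1_norm (Zd d) (\<lambda>k. restr I ?c k - best_terms s I (restr I ?c) k) = tail"
  proof -
    have "(\<Sum>\<^sub>\<infinity>k\<in>Zd d. cmod (restr I ?c k - restr S (restr I ?c) k)) = (\<Sum>\<^sub>\<infinity>k\<in>I - S. cmod (?c k))"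
      by (rule infsum_cong_neutral) (use I_Zd SI in \<open>auto simp: restr_def\<close>)
    then show ?thesis unfolding best(2) l1_norm_def tail_def using I by simp
  qed
  have aliasing: "l1_norm (Zd d) (\<lambda>k. ?c k - restr I ?c k) = aliasing_total"
    unfolding l1_norm_def aliasing_total_def by (rule infsum_cong_neutral) (auto simp: restr_def)
  have rest: "(\<lambda>k. cmod (restr I ?c k - ?c k)) summable_on Zd d"
    by (rule summable_on_comparison_test[OF c]) (auto simp: restr_def)
  have "(\<lambda>k. (cmod (b k - restr I ?c k))\<^sup>2) summable_on Zd d"
  proof -
    have "(\<lambda>k. (cmod (b k - restr I ?c k))\<^sup>2) summable_on (supp b \<union> I)" using fin I by simp
    then show ?thesis
      by (subst (asm) summable_on_cong_neutral[where T = "Zd d" and g = "\<lambda>k. (cmod (b k - restr I ?c k))\<^sup>2"])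
         (use b_Zd I_Zd in \<open>auto simp: supp_def restr_def\<close>)
  qed
  then have "l2_norm (Zd d) (\<lambda>k. (b k - restr I ?c k) + (restr I ?c k - ?c k))
      \<le> l2_norm (Zd d) (\<lambda>k. b k - restr I ?c k) + l2_norm (Zd d) (\<lambda>k. restr I ?c k - ?c k)"
    by (rule l2_norm_triangle) (rule square_summable[OF rest])
  moreover have "l2_norm (Zd d) (\<lambda>k. restr I ?c k - ?c k) = l2_norm (Zd d) (\<lambda>k. ?c k - restr I ?c k)"
    by (simp add: l2_norm_def norm_minus_commute)
  moreover have "sqrt (real s) * err = tail / sqrt (real s) + sqrt (real s) * aliasing_total + sqrt (real s) * e"
  proof -
    have "sqrt (real s) * (tail / real s) = tail / sqrt (real s)"
      using s by (simp add: field_simps flip: real_sqrt_mult)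
    then show ?thesis by (simp add: err_def algebra_simps)
  qed
  ultimately show ?thesis
    unfolding error_estimate_def res tail aliasing using main by simp
qed

text \<open>As \<open>s\<close> is at most \<beta>, the bookkeeping is absorbed by the cost of the
  transforms. With \<open>d + 1 \<le> 2 * d\<close>, the transforms give \<open>2 * C\<close>, their
  storage and loop steps 4, and the \<open>2 * s\<close> frequencies at \<open>21 * d\<close>
  operations each give 42.\<close>

lemma phase_encoding_cost:
  fixes P :: "nat \<Rightarrow> sft"
  assumes d: "1 \<le> d" and C: "0 \<le> C" and \<beta>: "1 \<le> s" "real s \<le> \<beta>"
    and samples: "\<And>i. i \<le> d \<Longrightarrow> real (samples (sampled d N z F i) (P i)) \<le> C * \<beta>"
    and operations: "\<And>i. i \<le> d \<Longrightarrow> real (operations (sampled d N z F i) (P i)) \<le> C * \<beta>"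
    and sparse: "sparse_on (2 * s) B (result (sampled d N z F 0) (P 0))"
  shows "real (samples F (phase_encoding d N z dflt P)) \<le> (2 * C + 46) * (real d * \<beta>)"
    "real (operations F (phase_encoding d N z dflt P)) \<le> (2 * C + 46) * (real d * \<beta>)"
proof -
  define m where "m = nat \<lfloor>C * \<beta>\<rfloor>"
  have \<beta>1: "1 \<le> \<beta>" using \<beta> by linarith
  have m: "real m \<le> C * \<beta>" using C \<beta>1 by (simp add: m_def)
  have le_m: "n \<le> m" if "real n \<le> C * \<beta>" for n using that by (simp add: m_def le_nat_floor)
  have d1: "real d + 1 \<le> 2 * real d" using d by simp
  have "real (samples F (phase_encoding d N z dflt P)) \<le> real ((d + 1) * m)"
    using phase_encoding_samples_le[of d N z F P m] samples le_m by (intro of_nat_mono) auto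
  also have "\<dots> \<le> 2 * real d * (C * \<beta>)"
    using m d1 by (simp only: of_nat_mult of_nat_add of_nat_1) (intro mult_mono, auto)
  also have "\<dots> \<le> (2 * C + 46) * (real d * \<beta>)" using \<beta>1 by (simp add: algebra_simps)
  finally show "real (samples F (phase_encoding d N z dflt P)) \<le> (2 * C + 46) * (real d * \<beta>)" .
  have "real (operations F (phase_encoding d N z dflt P)) \<le> real ((d + 1) * (m + 2) + 2 * s * (21 * d))"
    using phase_encoding_operations_le[OF d, of N z F P m "2 * s"] operations le_m sparse
    by (intro of_nat_mono) (auto simp: sparse_on_def)
  also have "\<dots> = (real d + 1) * (real m + 2) + 42 * (real d * real s)" by (simp add: algebra_simps)
  also have "\<dots> \<le> 2 * real d * (C * \<beta> + 2 * \<beta>) + 42 * (real d * \<beta>)"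
    using m d1 \<beta>1 \<beta> by (intro add_mono mult_mono mult_left_mono) auto
  also have "\<dots> = (2 * C + 46) * (real d * \<beta>)" by (simp add: algebra_simps)
  finally show "real (operations F (phase_encoding d N z dflt P)) \<le> (2 * C + 46) * (real d * \<beta>)" .
qed

section \<open>Logarithmic bounds and the union bound\<close>

lemma ln_ge_1: "3 \<le> x \<Longrightarrow> 1 \<le> ln (x::real)"
  using exp_le by (subst ln_ge_iff) auto

text \<open>Makes the deterministic bound an admissible \<beta> for
  \<open>phase_encoding_cost\<close>; the denominator is harmless because
  \<open>ln s \<le> ln L \<le> ln L ^ 4\<close>.\<close>

lemma le_sublinear_bound:
  assumes "2 \<le> s" "2 * s \<le> L" "3 \<le> L"
  shows "real s \<le> real s ^ 2 * ln (real L) ^ 4 / ln (real s)"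
proof -
  have lnL: "1 \<le> ln (real L)" using assms by (intro ln_ge_1) auto
  have lns: "0 < ln (real s)" "ln (real s) \<le> ln (real L)" using assms by auto
  have "real s * ln (real s) \<le> real s ^ 2 * ln (real L) ^ 4"
  proof (rule mult_mono)
    show "real s \<le> real s ^ 2" using assms by (simp add: power2_eq_square)
    show "ln (real s) \<le> ln (real L) ^ 4" using lns(2) self_le_power[OF lnL, of 4] by linarith
  qed (use lns in auto)
  then show ?thesis using lns by (simp add: field_simps)
qed

text \<open>Put \<open>x = d * L / \<sigma> \<ge> 3\<close>. Splitting the failure probability
  leaves at most \<open>6 * x \<le> x ^ 3\<close> under the logarithm, which costs a factor
  3.\<close>

lemma le_mc_bound:
  assumes d: "1 \<le> d" and L: "3 \<le> L" and \<sigma>: "0 < \<sigma>" "\<sigma> \<le> (1::real)"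
  shows "real s \<le> real s * ln (real L) ^ 3 * ln (real d * real L / \<sigma>)"
    "ln (real L / (\<sigma> / (3 * (real d + 1)))) \<le> 3 * ln (real d * real L / \<sigma>)"
    "0 \<le> ln (real L / (\<sigma> / (3 * (real d + 1))))"
proof -
  let ?x = "real d * real L / \<sigma>"
  have "3 \<le> real d * real L" using mult_mono[of 1 "real d" 3 "real L"] d L by simp
  also have "\<dots> \<le> ?x" using \<sigma> d L by (simp add: field_simps mult_le_cancel_left1)
  finally have x: "3 \<le> ?x" .
  then have lnx: "1 \<le> ln ?x" by (rule ln_ge_1)
  have lnL: "1 \<le> ln (real L)" using L by (intro ln_ge_1) auto
  have "1 \<le> ln (real L) ^ 3 * ln ?x" using mult_mono[of 1 "ln (real L) ^ 3" 1 "ln ?x"] lnx lnL by simp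
  then have "real s * 1 \<le> real s * (ln (real L) ^ 3 * ln ?x)" by (rule mult_left_mono) simp
  then show "real s \<le> real s * ln (real L) ^ 3 * ln ?x" by (simp add: mult.assoc)
  have eq: "real L / (\<sigma> / (3 * (real d + 1))) = 3 * (real d + 1) * real L / \<sigma>" by simp
  have "3 * (real d + 1) * real L / \<sigma> \<le> 6 * ?x"
  proof -
    have "3 * (real d + 1) * real L \<le> 6 * real d * real L" using d by (intro mult_right_mono) auto
    then show ?thesis using \<sigma> by (simp add: field_simps)
  qed
  moreover have "6 * ?x \<le> ?x ^ 3"
  proof -
    have "3 * 3 \<le> ?x * ?x" using x by (intro mult_mono) auto
    then have "6 * ?x \<le> ?x * ?x * ?x" using x by (intro mult_right_mono) auto
    then show ?thesis by (simp add: power3_eq_cube)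
  qed
  moreover have "1 \<le> 3 * (real d + 1) * real L / \<sigma>"
  proof -
    have "1 * 1 \<le> 3 * (real d + 1) * real L" using L by (intro mult_mono) auto
    then show ?thesis using \<sigma> by (simp add: field_simps)
  qed
  ultimately have y: "1 \<le> 3 * (real d + 1) * real L / \<sigma>" "3 * (real d + 1) * real L / \<sigma> \<le> ?x ^ 3"
    by linarith+
  show "0 \<le> ln (real L / (\<sigma> / (3 * (real d + 1))))" unfolding eq by (rule ln_ge_zero[OF y(1)])
  have "ln (3 * (real d + 1) * real L / \<sigma>) \<le> ln (?x ^ 3)"
    using y by (intro ln_le_cancel_iff[THEN iffD2]) linarith+
  also have "\<dots> = 3 * ln ?x" using x by (subst ln_realpow) simp_all
  finally show "ln (real L / (\<sigma> / (3 * (real d + 1)))) \<le> 3 * ln ?x" unfolding eq .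
qed

text \<open>Union bound over the \<open>d + 1\<close> transforms, each of which has the law
  \<open>A\<close>.\<close>

lemma mc_choices_all:
  assumes E: "\<And>i. i \<le> d \<Longrightarrow> 1 - \<tau> \<le> measure_pmf.prob A {p. E i p}"
    and imp: "\<And>P. P \<in> set_pmf (mc_choices d A) \<Longrightarrow> \<forall>i\<le>d. E i (P i) \<Longrightarrow> Q P"
  shows "1 - (real d + 1) * \<tau> \<le> measure_pmf.prob (mc_choices d A) {P. Q P}"
proof -
  let ?M = "mc_choices d A"
  have comp: "measure_pmf.prob ?M {P. \<not> E i (P i)} \<le> \<tau>" if "i \<le> d" for i
  proof -
    have "map_pmf (\<lambda>P. P i) ?M = A"
      unfolding mc_choices_def using that by (subst Pi_pmf_component) auto
    then have "measure_pmf.prob A {p. \<not> E i p} = measure_pmf.prob ?M ((\<lambda>P. P i) -` {p. \<not> E i p})"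
      by (metis measure_map_pmf)
    moreover have "measure_pmf.prob A {p. \<not> E i p} = 1 - measure_pmf.prob A {p. E i p}"
      using measure_pmf.prob_compl[of "{p. E i p}" A] by (simp add: Compl_eq_Diff_UNIV[symmetric] Collect_neg_eq)
    ultimately show ?thesis using E[OF that] by (simp add: vimage_def)
  qed
  have "1 - measure_pmf.prob ?M {P. Q P} = measure_pmf.prob ?M {P. \<not> Q P}"
    using measure_pmf.prob_compl[of "{P. Q P}" ?M] by (simp add: Compl_eq_Diff_UNIV[symmetric] Collect_neg_eq)
  \<comment> \<open>\<open>imp\<close> speaks of outcomes in the support; the others carry no
    mass.\<close>
  also have "\<dots> = measure_pmf.prob ?M ({P. \<not> Q P} \<inter> set_pmf ?M)" by (simp add: measure_Int_set_pmf)
  also have "\<dots> \<le> measure_pmf.prob ?M (\<Union>i\<in>{..d}. {P. \<not> E i (P i)})"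
    using imp by (intro measure_pmf.finite_measure_mono) auto
  also have "\<dots> \<le> (\<Sum>i\<in>{..d}. measure_pmf.prob ?M {P. \<not> E i (P i)})"
    by (rule measure_pmf.finite_measure_subadditive_finite) auto
  also have "\<dots> \<le> (\<Sum>i\<in>{..d}. \<tau>)" by (rule sum_mono) (use comp in auto)
  also have "\<dots> = (real d + 1) * \<tau>" by simp
  finally show ?thesis by simp
qed

lemma mc_choices_component:
  assumes "P \<in> set_pmf (mc_choices d A)" "i \<le> d"
  shows "P i \<in> set_pmf A"
  using assms by (auto simp: mc_choices_def set_Pi_pmf PiE_dflt_def)


theorem corollary2:
  fixes A :: "nat \<Rightarrow> nat \<Rightarrow> sft" and AMC :: "nat \<Rightarrow> nat \<Rightarrow> real \<Rightarrow> sft pmf"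
  shows
    "(sublinear_sft A \<longrightarrow>
       (\<exists>C::real. \<forall>d N s M (z :: nat \<Rightarrow> int) (I :: (nat \<Rightarrow> int) set) f \<eta> e dflt Mt.
          1 \<le> d \<and> 6 \<le> N \<and> 1 \<le> s \<and> finite I \<and> I \<subseteq> band_d d N \<and>
          Mt = bandwidth d z I \<and> 2 * s \<le> Mt \<and> reconstructing d z M I \<and> M \<le> Mt \<and>
          wiener d f \<and> continuous_on UNIV f \<and> 0 \<le> e \<and> (\<forall>q. cmod (\<eta> q) \<le> e) \<longrightarrow>
          (let prg = phase_encoding d N z dflt (\<lambda>_. A s Mt);
               b = result (noisy f \<eta>) prg;
               bound = real d * real s ^ 2 * ln (real Mt) ^ 4 / ln (real s)
           in sparse_on (2 * s) (band_d d N) b \<and>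
              error_estimate d N I s e (fcoeff d f) b \<and>
              (2 \<le> s \<longrightarrow>
                 real (samples (noisy f \<eta>) prg) \<le> C * bound \<and>
                 real (operations (noisy f \<eta>) prg) \<le> C * bound)))) \<and>
     (sublinear_sft_mc AMC \<longrightarrow>
       (\<exists>\<tau> :: real \<Rightarrow> nat \<Rightarrow> real.
          (\<forall>\<sigma> d. 0 < \<sigma> \<and> \<sigma> \<le> 1 \<and> 1 \<le> d \<longrightarrow> 0 < \<tau> \<sigma> d \<and> \<tau> \<sigma> d \<le> 1/3) \<and>
       (\<exists>C::real. \<forall>d N s M (z :: nat \<Rightarrow> int) (I :: (nat \<Rightarrow> int) set) f \<eta> e dflt Mt \<sigma>.
          1 \<le> d \<and> 6 \<le> N \<and> 1 \<le> s \<and> finite I \<and> I \<subseteq> band_d d N \<and>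
          Mt = bandwidth d z I \<and> 2 * s \<le> Mt \<and> reconstructing d z M I \<and> M \<le> Mt \<and>
          wiener d f \<and> continuous_on UNIV f \<and> 0 \<le> e \<and> (\<forall>q. cmod (\<eta> q) \<le> e) \<and>
          0 < \<sigma> \<and> \<sigma> \<le> 1 \<longrightarrow>
          (let choices = mc_choices d (AMC s Mt (\<tau> \<sigma> d));
               prg = phase_encoding d N z dflt;
               bound = real d * real s * ln (real Mt) ^ 3 * ln (real d * real Mt / \<sigma>)
           in measure_pmf.prob choices
                {P. error_estimate d N I s e (fcoeff d f) (result (noisy f \<eta>) (prg P))} \<ge> 1 - \<sigma> \<and>
              (\<forall>P\<in>set_pmf choices.
                 sparse_on (2 * s) (band_d d N) (result (noisy f \<eta>) (prg P)) \<and>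
                 real (samples (noisy f \<eta>) (prg P)) \<le> C * bound \<and>
                 real (operations (noisy f \<eta>) (prg P)) \<le> C * bound)))))"
proof (intro conjI impI)
  assume A: "sublinear_sft A"
  obtain C0 where C0: "\<And>s L a \<mu>. 2 \<le> s \<and> 2 * s \<le> L \<and> sft_input a \<mu> \<Longrightarrow>
      real (samples (\<lambda>t. a t + \<mu> t) (A s L)) \<le> C0 * (real s ^ 2 * ln (real L) ^ 4 / ln (real s)) \<and>
      real (operations (\<lambda>t. a t + \<mu> t) (A s L)) \<le> C0 * (real s ^ 2 * ln (real L) ^ 4 / ln (real s))"
    using A unfolding sublinear_sft_def by blast
  have A1: "sparse_on (2 * s) (band L) (result (\<lambda>t. a t + \<mu> t) (A s L))"
    "sft_accurate s L a \<mu> (result (\<lambda>t. a t + \<mu> t) (A s L))"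
    if "1 \<le> s" "2 * s \<le> L" "sft_input a \<mu>" for s L a \<mu>
    using A that unfolding sublinear_sft_def Let_def by blast+
  show "\<exists>C::real. \<forall>d N s M (z :: nat \<Rightarrow> int) (I :: (nat \<Rightarrow> int) set) f \<eta> e dflt Mt.
          1 \<le> d \<and> 6 \<le> N \<and> 1 \<le> s \<and> finite I \<and> I \<subseteq> band_d d N \<and>
          Mt = bandwidth d z I \<and> 2 * s \<le> Mt \<and> reconstructing d z M I \<and> M \<le> Mt \<and>
          wiener d f \<and> continuous_on UNIV f \<and> 0 \<le> e \<and> (\<forall>q. cmod (\<eta> q) \<le> e) \<longrightarrow>
          (let prg = phase_encoding d N z dflt (\<lambda>_. A s Mt);
               b = result (noisy f \<eta>) prg;
               bound = real d * real s ^ 2 * ln (real Mt) ^ 4 / ln (real s)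
           in sparse_on (2 * s) (band_d d N) b \<and>
              error_estimate d N I s e (fcoeff d f) b \<and>
              (2 \<le> s \<longrightarrow>
                 real (samples (noisy f \<eta>) prg) \<le> C * bound \<and>
                 real (operations (noisy f \<eta>) prg) \<le> C * bound))"
  \<comment> \<open>The absolute value is taken because \<open>C0\<close> is not known to be
    nonnegative, as \<open>phase_encoding_cost\<close> demands.\<close>
  proof (intro exI[of _ "2 * \<bar>C0\<bar> + 46"] allI impI, elim conjE)
    fix d N s M :: nat and z :: "nat \<Rightarrow> int" and I :: "(nat \<Rightarrow> int) set" and f :: "(nat \<Rightarrow> real) \<Rightarrow> complex"
      and \<eta> :: "request \<Rightarrow> complex" and e :: real and dflt :: "nat \<Rightarrow> int \<Rightarrow> int" and L :: nat
    assume d: "1 \<le> d" and N: "6 \<le> N" and s: "1 \<le> s" and I: "finite I" "I \<subseteq> band_d d N"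
      and L: "L = bandwidth d z I" and sL: "2 * s \<le> L" and rec: "reconstructing d z M I"
      and f: "wiener d f" "continuous_on UNIV f" and e: "0 \<le> e" and \<eta>: "\<forall>q. cmod (\<eta> q) \<le> e"
    let ?prg = "phase_encoding d N z dflt (\<lambda>_. A s L)"
    have \<eta>': "cmod (\<eta> q) \<le> e" for q using \<eta> by blast
    have input: "sft_input (\<lambda>t. f (sample_point d N z i t)) (\<lambda>t. \<eta> (i, sample_point d N z i t))"
      if "i \<le> d" for i using sft_input_sampled[OF f that \<eta>'] .
    have sparse: "sparse_on (2 * s) (band L) (result (sampled d N z (noisy f \<eta>) i) (A s L))" if "i \<le> d" for i
      unfolding sampled_noisy by (rule A1(1)[OF s sL input[OF that]])
    have acc: "sampled_accurate d N z f \<eta> s L i (A s L)" if "i \<le> d" for i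
      unfolding sampled_accurate_def sampled_noisy by (rule A1(2)[OF s sL input[OF that]])
    have "sparse_on (2 * s) (band_d d N) (result (noisy f \<eta>) ?prg)"
      by (rule phase_encoding_sparse[where P = "\<lambda>_. A s L", OF _ sparse]) (use N in auto)
    moreover have "error_estimate d N I s e (fcoeff d f) (result (noisy f \<eta>) ?prg)"
      by (rule phase_encoding_error_estimate[where P = "\<lambda>_. A s L", OF N s I rec f e \<eta>' L sparse acc])
    moreover have "real (samples (noisy f \<eta>) ?prg)
          \<le> (2 * \<bar>C0\<bar> + 46) * (real d * real s ^ 2 * ln (real L) ^ 4 / ln (real s))"
        "real (operations (noisy f \<eta>) ?prg)
          \<le> (2 * \<bar>C0\<bar> + 46) * (real d * real s ^ 2 * ln (real L) ^ 4 / ln (real s))" if s2: "2 \<le> s"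
    proof -
      define \<beta> where "\<beta> = real s ^ 2 * ln (real L) ^ 4 / ln (real s)"
      have s\<beta>: "real s \<le> \<beta>"
        unfolding \<beta>_def using bandwidth_ge_3[OF I(1) s] sL L s2 by (intro le_sublinear_bound) auto
      have "C0 * \<beta> \<le> \<bar>C0\<bar> * \<beta>" using s\<beta> by (intro mult_right_mono) auto
      then have cost: "real (samples (sampled d N z (noisy f \<eta>) i) (A s L)) \<le> \<bar>C0\<bar> * \<beta>"
        "real (operations (sampled d N z (noisy f \<eta>) i) (A s L)) \<le> \<bar>C0\<bar> * \<beta>" if "i \<le> d" for i
        using C0[of s L] input[OF that] s2 sL unfolding sampled_noisy \<beta>_def by (blast intro: order_trans)+
      note * = phase_encoding_cost[where P = "\<lambda>_. A s L", OF d abs_ge_zero s s\<beta> cost sparse[of 0, OF le0]]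
      have "real d * \<beta> = real d * real s ^ 2 * ln (real L) ^ 4 / ln (real s)" by (simp add: \<beta>_def)
      then show "real (samples (noisy f \<eta>) ?prg)
          \<le> (2 * \<bar>C0\<bar> + 46) * (real d * real s ^ 2 * ln (real L) ^ 4 / ln (real s))"
        "real (operations (noisy f \<eta>) ?prg)
          \<le> (2 * \<bar>C0\<bar> + 46) * (real d * real s ^ 2 * ln (real L) ^ 4 / ln (real s))"
        using * by metis+
    qed
    ultimately show "let prg = phase_encoding d N z dflt (\<lambda>_. A s L);
               b = result (noisy f \<eta>) prg;
               bound = real d * real s ^ 2 * ln (real L) ^ 4 / ln (real s)
           in sparse_on (2 * s) (band_d d N) b \<and>
              error_estimate d N I s e (fcoeff d f) b \<and>
              (2 \<le> s \<longrightarrow>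
                 real (samples (noisy f \<eta>) prg) \<le> (2 * \<bar>C0\<bar> + 46) * bound \<and>
                 real (operations (noisy f \<eta>) prg) \<le> (2 * \<bar>C0\<bar> + 46) * bound)"
      unfolding Let_def by blast
  qed
next
  assume A: "sublinear_sft_mc AMC"
  obtain C0 where C0: "\<And>s L \<sigma> a \<mu> p. 1 \<le> s \<and> 2 * s \<le> L \<and> 0 < \<sigma> \<and> \<sigma> \<le> 1/3 \<and> sft_input a \<mu> \<Longrightarrow>
      p \<in> set_pmf (AMC s L \<sigma>) \<Longrightarrow>
      real (samples (\<lambda>t. a t + \<mu> t) p) \<le> C0 * (real s * ln (real L) ^ 3 * ln (real L / \<sigma>)) \<and>
      real (operations (\<lambda>t. a t + \<mu> t) p) \<le> C0 * (real s * ln (real L) ^ 3 * ln (real L / \<sigma>))"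
    using A unfolding sublinear_sft_mc_def by blast
  have A1: "\<And>p. p \<in> set_pmf (AMC s L \<sigma>) \<Longrightarrow> sparse_on (2 * s) (band L) (result (\<lambda>t. a t + \<mu> t) p)"
    "measure_pmf.prob (AMC s L \<sigma>) {p. sft_accurate s L a \<mu> (result (\<lambda>t. a t + \<mu> t) p)} \<ge> 1 - \<sigma>"
    if "1 \<le> s" "2 * s \<le> L" "0 < \<sigma>" "\<sigma> \<le> 1/3" "sft_input a \<mu>" for s L \<sigma> a \<mu>
    using A that unfolding sublinear_sft_mc_def by blast+
  \<comment> \<open>Division by \<open>d + 1\<close> pays for the union bound, and the 3 keeps the
    value at most 1/3.\<close>
  define \<tau> :: "real \<Rightarrow> nat \<Rightarrow> real" where "\<tau> = (\<lambda>\<sigma> d. \<sigma> / (3 * (real d + 1)))"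
  have \<tau>: "0 < \<tau> \<sigma> d \<and> \<tau> \<sigma> d \<le> 1/3" if "0 < \<sigma>" "\<sigma> \<le> 1" for \<sigma> d
    using that by (simp add: \<tau>_def field_simps)
  show "\<exists>\<tau> :: real \<Rightarrow> nat \<Rightarrow> real.
          (\<forall>\<sigma> d. 0 < \<sigma> \<and> \<sigma> \<le> 1 \<and> 1 \<le> d \<longrightarrow> 0 < \<tau> \<sigma> d \<and> \<tau> \<sigma> d \<le> 1/3) \<and>
       (\<exists>C::real. \<forall>d N s M (z :: nat \<Rightarrow> int) (I :: (nat \<Rightarrow> int) set) f \<eta> e dflt Mt \<sigma>.
          1 \<le> d \<and> 6 \<le> N \<and> 1 \<le> s \<and> finite I \<and> I \<subseteq> band_d d N \<and>
          Mt = bandwidth d z I \<and> 2 * s \<le> Mt \<and> reconstructing d z M I \<and> M \<le> Mt \<and>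
          wiener d f \<and> continuous_on UNIV f \<and> 0 \<le> e \<and> (\<forall>q. cmod (\<eta> q) \<le> e) \<and>
          0 < \<sigma> \<and> \<sigma> \<le> 1 \<longrightarrow>
          (let choices = mc_choices d (AMC s Mt (\<tau> \<sigma> d));
               prg = phase_encoding d N z dflt;
               bound = real d * real s * ln (real Mt) ^ 3 * ln (real d * real Mt / \<sigma>)
           in measure_pmf.prob choices
                {P. error_estimate d N I s e (fcoeff d f) (result (noisy f \<eta>) (prg P))} \<ge> 1 - \<sigma> \<and>
              (\<forall>P\<in>set_pmf choices.
                 sparse_on (2 * s) (band_d d N) (result (noisy f \<eta>) (prg P)) \<and>
                 real (samples (noisy f \<eta>) (prg P)) \<le> C * bound \<and>
                 real (operations (noisy f \<eta>) (prg P)) \<le> C * bound)))"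
  \<comment> \<open>The factor 3 in front of \<open>\<bar>C0\<bar>\<close> is that of the logarithm
    in \<open>le_mc_bound\<close>.\<close>
  proof (rule exI[of _ \<tau>], intro conjI exI[of _ "2 * (3 * \<bar>C0\<bar>) + 46"] allI impI; (elim conjE)?)
    fix \<sigma> :: real and d :: nat assume "0 < \<sigma>" "\<sigma> \<le> 1"
    then show "0 < \<tau> \<sigma> d" "\<tau> \<sigma> d \<le> 1/3" using \<tau> by auto
  next
    fix d N s M :: nat and z :: "nat \<Rightarrow> int" and I :: "(nat \<Rightarrow> int) set" and f :: "(nat \<Rightarrow> real) \<Rightarrow> complex"
      and \<eta> :: "request \<Rightarrow> complex" and e :: real and dflt :: "nat \<Rightarrow> int \<Rightarrow> int" and L :: nat and \<sigma> :: real
    assume d: "1 \<le> d" and N: "6 \<le> N" and s: "1 \<le> s" and I: "finite I" "I \<subseteq> band_d d N"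
      and L: "L = bandwidth d z I" and sL: "2 * s \<le> L" and rec: "reconstructing d z M I"
      and f: "wiener d f" "continuous_on UNIV f" and e: "0 \<le> e" and \<eta>: "\<forall>q. cmod (\<eta> q) \<le> e"
      and \<sigma>: "0 < \<sigma>" "\<sigma> \<le> 1"
    let ?prg = "phase_encoding d N z dflt" and ?A = "AMC s L (\<tau> \<sigma> d)"
    define \<beta> where "\<beta> = real s * ln (real L) ^ 3 * ln (real d * real L / \<sigma>)"
    have \<tau>1: "0 < \<tau> \<sigma> d" and \<tau>3: "\<tau> \<sigma> d \<le> 1/3" using \<tau> \<sigma> by auto
    have \<eta>': "cmod (\<eta> q) \<le> e" for q using \<eta> by blast
    have input: "sft_input (\<lambda>t. f (sample_point d N z i t)) (\<lambda>t. \<eta> (i, sample_point d N z i t))"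
      if "i \<le> d" for i using sft_input_sampled[OF f that \<eta>'] .
    have sparse: "sparse_on (2 * s) (band L) (result (sampled d N z (noisy f \<eta>) i) p)"
      if "i \<le> d" "p \<in> set_pmf ?A" for i p
      unfolding sampled_noisy by (rule A1(1)[OF s sL \<tau>1 \<tau>3 input[OF that(1)] that(2)])
    have L3: "3 \<le> L" using bandwidth_ge_3[OF I(1) s] sL L by blast
    note bounds = le_mc_bound[OF d L3 \<sigma>, folded \<tau>_def]
    have s\<beta>: "real s \<le> \<beta>" unfolding \<beta>_def by (rule bounds(1))
    have lnL: "0 \<le> ln (real L)" using L3 by simp
    have "C0 * (real s * ln (real L) ^ 3 * ln (real L / \<tau> \<sigma> d)) \<le> \<bar>C0\<bar> * (real s * ln (real L) ^ 3 * ln (real L / \<tau> \<sigma> d))"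
      using bounds(3) lnL by (intro mult_right_mono) (auto simp: \<tau>_def)
    also have "\<dots> \<le> \<bar>C0\<bar> * (real s * ln (real L) ^ 3 * (3 * ln (real d * real L / \<sigma>)))"
      using bounds(2) lnL by (intro mult_left_mono) (auto simp: \<tau>_def)
    also have "\<dots> = 3 * \<bar>C0\<bar> * \<beta>" by (simp add: \<beta>_def)
    finally have le: "C0 * (real s * ln (real L) ^ 3 * ln (real L / \<tau> \<sigma> d)) \<le> 3 * \<bar>C0\<bar> * \<beta>" .
    have cost: "real (samples (sampled d N z (noisy f \<eta>) i) p) \<le> 3 * \<bar>C0\<bar> * \<beta>"
      "real (operations (sampled d N z (noisy f \<eta>) i) p) \<le> 3 * \<bar>C0\<bar> * \<beta>" if "i \<le> d" "p \<in> set_pmf ?A" for i p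
      using C0[of s L "\<tau> \<sigma> d"] input[OF that(1)] s sL \<tau>1 \<tau>3 that(2) le
      unfolding sampled_noisy by (blast intro: order_trans)+
    have prob: "1 - (real d + 1) * \<tau> \<sigma> d \<le> measure_pmf.prob (mc_choices d ?A)
        {P. error_estimate d N I s e (fcoeff d f) (result (noisy f \<eta>) (?prg P))}"
    proof (rule mc_choices_all)
      show "1 - \<tau> \<sigma> d \<le> measure_pmf.prob ?A {p. sampled_accurate d N z f \<eta> s L i p}" if "i \<le> d" for i
        unfolding sampled_accurate_def sampled_noisy by (rule A1(2)[OF s sL \<tau>1 \<tau>3 input[OF that]])
      show "error_estimate d N I s e (fcoeff d f) (result (noisy f \<eta>) (?prg P))"
        if P: "P \<in> set_pmf (mc_choices d ?A)" and acc: "\<forall>i\<le>d. sampled_accurate d N z f \<eta> s L i (P i)" for P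
        by (rule phase_encoding_error_estimate[OF N s I rec f e \<eta>' L])
           (use sparse mc_choices_component[OF P] acc in auto)
    qed
    moreover have "(real d + 1) * \<tau> \<sigma> d \<le> \<sigma>" using \<sigma> by (simp add: \<tau>_def field_simps)
    ultimately have "1 - \<sigma> \<le> measure_pmf.prob (mc_choices d ?A)
        {P. error_estimate d N I s e (fcoeff d f) (result (noisy f \<eta>) (?prg P))}" by linarith
    moreover have "sparse_on (2 * s) (band_d d N) (result (noisy f \<eta>) (?prg P))"
      "real (samples (noisy f \<eta>) (?prg P))
        \<le> (2 * (3 * \<bar>C0\<bar>) + 46) * (real d * real s * ln (real L) ^ 3 * ln (real d * real L / \<sigma>))"
      "real (operations (noisy f \<eta>) (?prg P))
        \<le> (2 * (3 * \<bar>C0\<bar>) + 46) * (real d * real s * ln (real L) ^ 3 * ln (real d * real L / \<sigma>))"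
      if P: "P \<in> set_pmf (mc_choices d ?A)" for P
    proof -
      have Pi: "P i \<in> set_pmf ?A" if "i \<le> d" for i using mc_choices_component[OF P that] .
      show "sparse_on (2 * s) (band_d d N) (result (noisy f \<eta>) (?prg P))"
        by (rule phase_encoding_sparse[where P = P, OF _ sparse[of 0, OF le0 Pi[OF le0]]]) (use N in auto)
      have "0 \<le> 3 * \<bar>C0\<bar>" by simp
      note * = phase_encoding_cost[where P = P, OF d this s s\<beta> cost(1)[OF _ Pi] cost(2)[OF _ Pi] sparse[OF le0 Pi[OF le0]]]
      have "real d * \<beta> = real d * real s * ln (real L) ^ 3 * ln (real d * real L / \<sigma>)" by (simp add: \<beta>_def)
      then show "real (samples (noisy f \<eta>) (?prg P))
          \<le> (2 * (3 * \<bar>C0\<bar>) + 46) * (real d * real s * ln (real L) ^ 3 * ln (real d * real L / \<sigma>))"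
        "real (operations (noisy f \<eta>) (?prg P))
          \<le> (2 * (3 * \<bar>C0\<bar>) + 46) * (real d * real s * ln (real L) ^ 3 * ln (real d * real L / \<sigma>))"
        using * by metis+
    qed
    ultimately show "let choices = mc_choices d (AMC s L (\<tau> \<sigma> d));
               prg = phase_encoding d N z dflt;
               bound = real d * real s * ln (real L) ^ 3 * ln (real d * real L / \<sigma>)
           in measure_pmf.prob choices
                {P. error_estimate d N I s e (fcoeff d f) (result (noisy f \<eta>) (prg P))} \<ge> 1 - \<sigma> \<and>
              (\<forall>P\<in>set_pmf choices.
                 sparse_on (2 * s) (band_d d N) (result (noisy f \<eta>) (prg P)) \<and>
                 real (samples (noisy f \<eta>) (prg P)) \<le> (2 * (3 * \<bar>C0\<bar>) + 46) * bound \<and>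
                 real (operations (noisy f \<eta>) (prg P)) \<le> (2 * (3 * \<bar>C0\<bar>) + 46) * bound)"
      unfolding Let_def by blast
  qed
qed

end
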